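(* Let $k$ be a field and let $A$ and $B$ be commutative Noetherian $k$-algebras such that $R = A \otimes_k B$ is also Noetherian. Let $I \subseteq A$ and $J \subseteq B$ be nonzero proper ideals, and let $u$ be a positive rational number. If the binomial expansion formula holds for $I$ and $J$ at power $u$, i.e., if $$\overline{(I+J)^u} = \sum_{\substack{0 \le w \le u \\ w \in \mathbb Q}} \overline{I^w} \cdot \overline{J^{u-w}},$$ then the binomial expansion formula holds for $I$ and $J$ at symbolic power $u$, i.e., $$\overline{(I+J)^{(u)}} = \sum_{\substack{0 \le w \le u \\ w \in \mathbb Q}} \overline{I^{(w)}} \cdot \overline{J^{(u-w)}}.$$
   Context: Ideals of $A$ or $B$ are identified with their extensions to $R$ where needed: $I+J$ denotes the ideal $IR+JR$ of $R$, and products such as $\overline{I^w}\cdot\overline{J^{u-w}}$ denote $(\overline{I^w}R)(\overline{J^{u-w}}R)$, where $\overline{I^w}$ is computed in $A$ and $\overline{J^{u-w}}$ in $B$ (and similarly for the rational symbolic powers). For an ideal $\mathfrak a$ of a Noetherian ring $S$ and a positive rational $u=\frac pq$ ($p,q$ positive integers), the $u$-th rational power is $\overline{\mathfrak a^u}=\{f\in S\mid f^q\in\overline{\mathfrak a^p}\}$, where $\overline{\mathfrak a^p}$ is the integral closure of $\mathfrak a^p$; it is independent of the presentation of $u$. The $u$-th rational symbolic power is $\overline{\mathfrak a^{(u)}}=\bigcap_{\mathfrak p\in\mathrm{Ass}_S(S/\mathfrak a)}(\overline{\mathfrak a^u}S_{\mathfrak p}\cap S)$, also for integer $u$. For exponent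 $0$ both are the unit ideal $S$. *)

theory Defs
  imports "HOL-Algebra.Algebra"
begin

section \<open>The tensor product of two algebras\<close>

text \<open>The free abelian group on \<open>carrier A \<times> carrier B\<close>, as a ring: the multiplication is the
  biadditive extension of \<open>(a, b) (a', b') = (a a', b b')\<close>.\<close>

definition pre_tensor_mult ::
  "('a, 'm) ring_scheme \<Rightarrow> ('b, 'n) ring_scheme \<Rightarrow> ('a \<times> 'b \<Rightarrow>\<^sub>0 int) \<Rightarrow> ('a \<times> 'b \<Rightarrow>\<^sub>0 int) \<Rightarrow> ('a \<times> 'b \<Rightarrow>\<^sub>0 int)"
  where "pre_tensor_mult A B c d =
    frag_extend (\<lambda>x. frag_extend (\<lambda>y. frag_of (fst x \<otimes>\<^bsub>A\<^esub> fst y, snd x \<otimes>\<^bsub>B\<^esub> snd y)) d) c"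

definition pre_tensor_ring ::
  "('a, 'm) ring_scheme \<Rightarrow> ('b, 'n) ring_scheme \<Rightarrow> ('a \<times> 'b \<Rightarrow>\<^sub>0 int) ring"
  where "pre_tensor_ring A B =
    \<lparr>carrier = {c. Poly_Mapping.keys c \<subseteq> carrier A \<times> carrier B},
     monoid.mult = pre_tensor_mult A B, one = frag_of (\<one>\<^bsub>A\<^esub>, \<one>\<^bsub>B\<^esub>), ring.zero = 0, add = (+)\<rparr>"

definition tensor_relators ::
  "('k, 'l) ring_scheme \<Rightarrow> ('k, 'a, 'm) module_scheme \<Rightarrow> ('k, 'b, 'n) module_scheme \<Rightarrow> ('a \<times> 'b \<Rightarrow>\<^sub>0 int) set"
  where "tensor_relators K A B =
    {frag_of (a \<oplus>\<^bsub>A\<^esub> a', b) - frag_of (a, b) - frag_of (a', b) | a a' b.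
       a \<in> carrier A \<and> a' \<in> carrier A \<and> b \<in> carrier B} \<union>
    {frag_of (a, b \<oplus>\<^bsub>B\<^esub> b') - frag_of (a, b) - frag_of (a, b') | a b b'.
       a \<in> carrier A \<and> b \<in> carrier B \<and> b' \<in> carrier B} \<union>
    {frag_of (c \<odot>\<^bsub>A\<^esub> a, b) - frag_of (a, c \<odot>\<^bsub>B\<^esub> b) | c a b.
       c \<in> carrier K \<and> a \<in> carrier A \<and> b \<in> carrier B}"

text \<open>The subgroup generated by the relators is an ideal of the ring above (lemma
  \<open>tensor_kernel_ideal\<close> below), so that its quotient is the ring \<open>A \<otimes>\<^sub>K B\<close>.\<close>

definition tensor_kernel ::
  "('k, 'l) ring_scheme \<Rightarrow> ('k, 'a, 'm) module_scheme \<Rightarrow> ('k, 'b, 'n) module_scheme \<Rightarrow> ('a \<times> 'b \<Rightarrow>\<^sub>0 int) set"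
  where "tensor_kernel K A B = generate (add_monoid (pre_tensor_ring A B)) (tensor_relators K A B)"

definition tensor_ring ::
  "('k, 'l) ring_scheme \<Rightarrow> ('k, 'a, 'm) module_scheme \<Rightarrow> ('k, 'b, 'n) module_scheme \<Rightarrow> ('a \<times> 'b \<Rightarrow>\<^sub>0 int) set ring"
  where "tensor_ring K A B = pre_tensor_ring A B Quot tensor_kernel K A B"

definition pure_tensor ::
  "('k, 'l) ring_scheme \<Rightarrow> ('k, 'a, 'm) module_scheme \<Rightarrow> ('k, 'b, 'n) module_scheme \<Rightarrow> 'a \<Rightarrow> 'b \<Rightarrow> ('a \<times> 'b \<Rightarrow>\<^sub>0 int) set"
  where "pure_tensor K A B a b = tensor_kernel K A B +>\<^bsub>pre_tensor_ring A B\<^esub> frag_of (a, b)"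

definition tensor_inl ::
  "('k, 'l) ring_scheme \<Rightarrow> ('k, 'a, 'm) module_scheme \<Rightarrow> ('k, 'b, 'n) module_scheme \<Rightarrow> 'a \<Rightarrow> ('a \<times> 'b \<Rightarrow>\<^sub>0 int) set"
  where "tensor_inl K A B a = pure_tensor K A B a \<one>\<^bsub>B\<^esub>"

definition tensor_inr ::
  "('k, 'l) ring_scheme \<Rightarrow> ('k, 'a, 'm) module_scheme \<Rightarrow> ('k, 'b, 'n) module_scheme \<Rightarrow> 'b \<Rightarrow> ('a \<times> 'b \<Rightarrow>\<^sub>0 int) set"
  where "tensor_inr K A B b = pure_tensor K A B \<one>\<^bsub>A\<^esub> b"


section \<open>Operations on ideals\<close>

definition ideal_ext :: "('s, 'n) ring_scheme \<Rightarrow> ('r \<Rightarrow> 's) \<Rightarrow> 'r set \<Rightarrow> 's set"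
  where "ideal_ext S h I = Idl\<^bsub>S\<^esub> (h ` I)"

definition ideal_contr :: "('r, 'm) ring_scheme \<Rightarrow> ('r \<Rightarrow> 's) \<Rightarrow> 's set \<Rightarrow> 'r set"
  where "ideal_contr R h L = {x \<in> carrier R. h x \<in> L}"

definition ideal_family_sum :: "('r, 'm) ring_scheme \<Rightarrow> ('i \<Rightarrow> 'r set) \<Rightarrow> 'i set \<Rightarrow> 'r set"
  where "ideal_family_sum R F W = Idl\<^bsub>R\<^esub> (\<Union>w\<in>W. F w)"


section \<open>Localization\<close>

definition frac_rel :: "('r, 'm) ring_scheme \<Rightarrow> 'r set \<Rightarrow> (('r \<times> 'r) \<times> ('r \<times> 'r)) set"
  where "frac_rel R M =
    {((r, s), (r', s')). r \<in> carrier R \<and> s \<in> M \<and> r' \<in> carrier R \<and> s' \<in> M \<and>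
       (\<exists>t\<in>M. t \<otimes>\<^bsub>R\<^esub> (r \<otimes>\<^bsub>R\<^esub> s' \<ominus>\<^bsub>R\<^esub> r' \<otimes>\<^bsub>R\<^esub> s) = \<zero>\<^bsub>R\<^esub>)}"

definition fraction :: "('r, 'm) ring_scheme \<Rightarrow> 'r set \<Rightarrow> 'r \<Rightarrow> 'r \<Rightarrow> ('r \<times> 'r) set"
  where "fraction R M r s = frac_rel R M `` {(r, s)}"

definition localization :: "('r, 'm) ring_scheme \<Rightarrow> 'r set \<Rightarrow> ('r \<times> 'r) set ring"
  where "localization R M =
    \<lparr>carrier = (carrier R \<times> M) // frac_rel R M,
     monoid.mult = (\<lambda>U V. \<Union>(r, s)\<in>U. \<Union>(r', s')\<in>V. fraction R M (r \<otimes>\<^bsub>R\<^esub> r') (s \<otimes>\<^bsub>R\<^esub> s')),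
     one = fraction R M \<one>\<^bsub>R\<^esub> \<one>\<^bsub>R\<^esub>,
     ring.zero = fraction R M \<zero>\<^bsub>R\<^esub> \<one>\<^bsub>R\<^esub>,
     add = (\<lambda>U V. \<Union>(r, s)\<in>U. \<Union>(r', s')\<in>V.
              fraction R M (r \<otimes>\<^bsub>R\<^esub> s' \<oplus>\<^bsub>R\<^esub> r' \<otimes>\<^bsub>R\<^esub> s) (s \<otimes>\<^bsub>R\<^esub> s'))\<rparr>"

definition localize_prime :: "('r, 'm) ring_scheme \<Rightarrow> 'r set \<Rightarrow> ('r \<times> 'r) set ring"
  where "localize_prime R P = localization R (carrier R - P)"

definition localize_map :: "('r, 'm) ring_scheme \<Rightarrow> 'r set \<Rightarrow> 'r \<Rightarrow> ('r \<times> 'r) set"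
  where "localize_map R P r = fraction R (carrier R - P) r \<one>\<^bsub>R\<^esub>"


section \<open>Associated primes\<close>

definition quot_module :: "('r, 'm) ring_scheme \<Rightarrow> 'r set \<Rightarrow> ('r, 'r set) module"
  where "quot_module R I =
    \<lparr>carrier = carrier (R Quot I), monoid.mult = monoid.mult (R Quot I), one = one (R Quot I),
     ring.zero = ring.zero (R Quot I), add = add (R Quot I),
     smult = (\<lambda>r x. (I +>\<^bsub>R\<^esub> r) \<otimes>\<^bsub>R Quot I\<^esub> x)\<rparr>"

definition associated_primes :: "('r, 'm) ring_scheme \<Rightarrow> ('r, 'x, 'n) module_scheme \<Rightarrow> 'r set set"
  where "associated_primes R N =
    {P. primeideal P R \<and> (\<exists>x\<in>carrier N. P = {r \<in> carrier R. r \<odot>\<^bsub>N\<^esub> x = \<zero>\<^bsub>N\<^esub>})}"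


section \<open>Rational powers and rational symbolic powers\<close>

text \<open>The powers of an ideal are those of the library's monoid of ideals, with \<open>I\<^sup>0\<close> the unit
  ideal.\<close>

definition integral_closure :: "('r, 'm) ring_scheme \<Rightarrow> 'r set \<Rightarrow> 'r set"
  where "integral_closure R I =
    {f \<in> carrier R. \<exists>n::nat. 0 < n \<and> (\<exists>c. (\<forall>i\<in>{1..n}. c i \<in> I [^]\<^bsub>ideals_set R\<^esub> i) \<and>
       f [^]\<^bsub>R\<^esub> n \<oplus>\<^bsub>R\<^esub> (\<Oplus>\<^bsub>R\<^esub>i\<in>{1..n}. c i \<otimes>\<^bsub>R\<^esub> f [^]\<^bsub>R\<^esub> (n - i)) = \<zero>\<^bsub>R\<^esub>)}"

text \<open>Only exponents \<open>u \<ge> 0\<close> are meaningful. For \<open>u > 0\<close> the set \<open>{f. f\<^sup>q \<in> closure (I\<^sup>p)}\<close> does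
  not depend on the presentation \<open>u = p / q\<close>; the one in lowest terms is used.\<close>

definition rational_power :: "('r, 'm) ring_scheme \<Rightarrow> 'r set \<Rightarrow> rat \<Rightarrow> 'r set"
  where "rational_power R I u =
    (if u = 0 then carrier R
     else let p = nat (fst (quotient_of u)); q = nat (snd (quotient_of u))
          in {f \<in> carrier R. f [^]\<^bsub>R\<^esub> q \<in> integral_closure R (I [^]\<^bsub>ideals_set R\<^esub> p)})"

definition rational_symbolic_power :: "('r, 'm) ring_scheme \<Rightarrow> 'r set \<Rightarrow> rat \<Rightarrow> 'r set"
  where "rational_symbolic_power R I u =
    (if u = 0 then carrier R
     else carrier R \<inter>
       (\<Inter>P\<in>associated_primes R (quot_module R I).
          ideal_contr R (localize_map R P)
            (ideal_ext (localize_prime R P) (localize_map R P) (rational_power R I u))))"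


section \<open>Well-definedness of the constructions\<close>

lemma pre_tensor_mult_zero [simp]:
  "pre_tensor_mult A B 0 d = 0" "pre_tensor_mult A B c 0 = 0"
  by (simp_all add: pre_tensor_mult_def frag_extend_eq_0)

lemma pre_tensor_mult_of [simp]:
  "pre_tensor_mult A B (frag_of (a, b)) (frag_of (a', b')) = frag_of (a \<otimes>\<^bsub>A\<^esub> a', b \<otimes>\<^bsub>B\<^esub> b')"
  by (simp add: pre_tensor_mult_def)

lemma frag_extend_fun_add: "frag_extend (\<lambda>x. f x + g x) c = frag_extend f c + frag_extend g c"
  by (simp add: frag_extend_def frag_cmul_distrib2 sum.distrib)

lemma frag_extend_fun_diff: "frag_extend (\<lambda>x. f x - g x) c = frag_extend f c - frag_extend g c"
  using frag_extend_fun_add[of "\<lambda>x. f x - g x" g c] by simp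

lemma pre_tensor_mult_add:
  "pre_tensor_mult A B (c + c') d = pre_tensor_mult A B c d + pre_tensor_mult A B c' d"
  "pre_tensor_mult A B d (c + c') = pre_tensor_mult A B d c + pre_tensor_mult A B d c'"
  by (simp_all add: pre_tensor_mult_def frag_extend_add frag_extend_fun_add)

lemma pre_tensor_mult_diff:
  "pre_tensor_mult A B (c - c') d = pre_tensor_mult A B c d - pre_tensor_mult A B c' d"
  "pre_tensor_mult A B d (c - c') = pre_tensor_mult A B d c - pre_tensor_mult A B d c'"
  by (simp_all add: pre_tensor_mult_def frag_extend_diff frag_extend_fun_diff)

lemma pre_tensor_mult_minus:
  "pre_tensor_mult A B (- c) d = - pre_tensor_mult A B c d"
  "pre_tensor_mult A B d (- c) = - pre_tensor_mult A B d c"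
  using pre_tensor_mult_diff[of A B 0 c d] pre_tensor_mult_diff(2)[of A B d 0 c] by simp_all

lemma keys_diff_subset:
  "Poly_Mapping.keys a \<subseteq> S \<Longrightarrow> Poly_Mapping.keys b \<subseteq> S \<Longrightarrow> Poly_Mapping.keys (a - b :: 'x \<Rightarrow>\<^sub>0 int) \<subseteq> S"
  by (metis (no_types, opaque_lifting) Un_least keys_diff order_trans)

lemma keys_add_subset:
  "Poly_Mapping.keys a \<subseteq> S \<Longrightarrow> Poly_Mapping.keys b \<subseteq> S \<Longrightarrow> Poly_Mapping.keys (a + b :: 'x \<Rightarrow>\<^sub>0 int) \<subseteq> S"
  by (metis (no_types, opaque_lifting) Un_least Poly_Mapping.keys_add order_trans)

lemma pre_tensor_ring_cring:
  assumes "cring A" "cring B"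
  shows "cring (pre_tensor_ring A B)"
proof -
  interpret A: cring A by fact
  interpret B: cring B by fact
  let ?S = "carrier A \<times> carrier B"
  let ?m = "pre_tensor_mult A B"
  have closed: "Poly_Mapping.keys (?m c d) \<subseteq> ?S"
    if "Poly_Mapping.keys c \<subseteq> ?S" "Poly_Mapping.keys d \<subseteq> ?S" for c d
    using that(1)
  proof (induction c rule: frag_induction)
    case (one x)
    show ?case using that(2)
    proof (induction d rule: frag_induction)
      case (one y)
      then show ?case using \<open>x \<in> ?S\<close> by (cases x, cases y) simp
    qed (simp_all add: pre_tensor_mult_diff keys_diff_subset)
  qed (simp_all add: pre_tensor_mult_diff keys_diff_subset)
  have comm: "?m c d = ?m d c"
    if "Poly_Mapping.keys c \<subseteq> ?S" "Poly_Mapping.keys d \<subseteq> ?S" for c d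
    using that(1)
  proof (induction c rule: frag_induction)
    case (one x)
    show ?case using that(2)
      by (induction d rule: frag_induction)
        (use one in \<open>auto simp: pre_tensor_mult_diff A.m_comm B.m_comm\<close>)
  qed (auto simp: pre_tensor_mult_diff)
  have assoc: "?m (?m c d) e = ?m c (?m d e)"
    if "Poly_Mapping.keys c \<subseteq> ?S" "Poly_Mapping.keys d \<subseteq> ?S" "Poly_Mapping.keys e \<subseteq> ?S" for c d e
    using that(1)
  proof (induction c rule: frag_induction)
    case c: (one x)
    show ?case using that(2)
    proof (induction d rule: frag_induction)
      case d: (one y)
      show ?case using that(3)
        by (induction e rule: frag_induction)
          (use c d in \<open>auto simp: pre_tensor_mult_diff A.m_assoc B.m_assoc\<close>)
    qed (auto simp: pre_tensor_mult_diff)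
  qed (auto simp: pre_tensor_mult_diff)
  have one: "?m (frag_of (\<one>\<^bsub>A\<^esub>, \<one>\<^bsub>B\<^esub>)) c = c" if "Poly_Mapping.keys c \<subseteq> ?S" for c
    using that by (induction c rule: frag_induction) (auto simp: pre_tensor_mult_diff)
  show ?thesis
  proof (rule cringI)
    show "abelian_group (pre_tensor_ring A B)"
    proof (rule abelian_groupI)
      show "\<exists>y\<in>carrier (pre_tensor_ring A B). y \<oplus>\<^bsub>pre_tensor_ring A B\<^esub> x = \<zero>\<^bsub>pre_tensor_ring A B\<^esub>"
        if "x \<in> carrier (pre_tensor_ring A B)" for x
        using that by (intro bexI[of _ "- x"]) (simp_all add: pre_tensor_ring_def)
    qed (simp_all add: pre_tensor_ring_def add_ac keys_add_subset)
    show "comm_monoid (pre_tensor_ring A B)"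
      by (rule comm_monoidI) (simp_all add: pre_tensor_ring_def closed one assoc, simp add: comm)
  qed (simp_all add: pre_tensor_ring_def pre_tensor_mult_add)
qed

lemma tensor_kernel_ideal:
  assumes "algebra K A" "algebra K B"
  shows "ideal (tensor_kernel K A B) (pre_tensor_ring A B)"
proof -
  interpret A: cring A using assms(1) by (simp add: algebra_def)
  interpret B: cring B using assms(2) by (simp add: algebra_def)
  interpret KA: algebra K A by fact
  interpret KB: algebra K B by fact
  let ?P = "pre_tensor_ring A B"
  interpret P: cring ?P
    by (rule pre_tensor_ring_cring) (rule A.cring_axioms B.cring_axioms)+
  let ?S = "carrier A \<times> carrier B"
  have gens: "tensor_relators K A B \<subseteq> carrier ?P"
    by (auto simp: tensor_relators_def pre_tensor_ring_def dest!: subsetD[OF keys_diff])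
  have neg: "inv\<^bsub>add_monoid ?P\<^esub> x = - x" if "x \<in> carrier ?P" for x
    using that P.minus_equality[of "- x" x] unfolding a_inv_def by (simp add: pre_tensor_ring_def)
  have sub: "subgroup (tensor_kernel K A B) (add_monoid ?P)"
    unfolding tensor_kernel_def using P.add.generate_is_subgroup gens by simp
  have diff: "a - b \<in> tensor_kernel K A B"
    if "a \<in> tensor_kernel K A B" "b \<in> tensor_kernel K A B" for a b
  proof -
    have "b \<in> carrier ?P" using subgroup.mem_carrier[OF sub that(2)] by simp
    then show ?thesis
      using subgroup.m_closed[OF sub that(1) subgroup.m_inv_closed[OF sub that(2)]] neg
      by (simp add: pre_tensor_ring_def)
  qed
  have zero: "0 \<in> tensor_kernel K A B"
    using subgroup.one_closed[OF sub] by (simp add: pre_tensor_ring_def)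
  have incl: "x \<in> tensor_kernel K A B" if "x \<in> tensor_relators K A B" for x
    using that by (simp add: tensor_kernel_def generate.incl)
  have gen_mult: "pre_tensor_mult A B (frag_of (a0, b0)) x \<in> tensor_relators K A B"
    if "a0 \<in> carrier A" "b0 \<in> carrier B" "x \<in> tensor_relators K A B" for a0 b0 x
  proof -
    note rel = that(3)
    consider (left) a a' b where "x = frag_of (a \<oplus>\<^bsub>A\<^esub> a', b) - frag_of (a, b) - frag_of (a', b)"
        "a \<in> carrier A" "a' \<in> carrier A" "b \<in> carrier B"
      | (right) a b b' where "x = frag_of (a, b \<oplus>\<^bsub>B\<^esub> b') - frag_of (a, b) - frag_of (a, b')"
        "a \<in> carrier A" "b \<in> carrier B" "b' \<in> carrier B"
      | (scalar) c a b where "x = frag_of (c \<odot>\<^bsub>A\<^esub> a, b) - frag_of (a, c \<odot>\<^bsub>B\<^esub> b)"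
        "c \<in> carrier K" "a \<in> carrier A" "b \<in> carrier B"
      using rel unfolding tensor_relators_def by blast
    then show ?thesis
    proof cases
      case left
      then show ?thesis
        using that(1,2) unfolding tensor_relators_def
        by (intro UnI1 CollectI exI[of _ "a0 \<otimes>\<^bsub>A\<^esub> a"] exI[of _ "a0 \<otimes>\<^bsub>A\<^esub> a'"] exI[of _ "b0 \<otimes>\<^bsub>B\<^esub> b"])
          (auto simp: pre_tensor_mult_diff A.r_distr)
    next
      case right
      then show ?thesis
        using that(1,2) unfolding tensor_relators_def
        by (intro UnI1 UnI2 CollectI exI[of _ "a0 \<otimes>\<^bsub>A\<^esub> a"] exI[of _ "b0 \<otimes>\<^bsub>B\<^esub> b"] exI[of _ "b0 \<otimes>\<^bsub>B\<^esub> b'"])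
          (auto simp: pre_tensor_mult_diff B.r_distr)
    next
      case scalar
      have "a0 \<otimes>\<^bsub>A\<^esub> (c \<odot>\<^bsub>A\<^esub> a) = c \<odot>\<^bsub>A\<^esub> (a0 \<otimes>\<^bsub>A\<^esub> a)"
        "b0 \<otimes>\<^bsub>B\<^esub> (c \<odot>\<^bsub>B\<^esub> b) = c \<odot>\<^bsub>B\<^esub> (b0 \<otimes>\<^bsub>B\<^esub> b)"
        using that(1,2) scalar KA.smult_assoc2[of c a a0] KB.smult_assoc2[of c b b0]
        by (simp_all add: A.m_comm B.m_comm)
      then show ?thesis
        using that(1,2) scalar unfolding tensor_relators_def
        by (intro UnI2 CollectI exI[of _ c] exI[of _ "a0 \<otimes>\<^bsub>A\<^esub> a"] exI[of _ "b0 \<otimes>\<^bsub>B\<^esub> b"])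
          (auto simp: pre_tensor_mult_diff)
    qed
  qed
  have mult: "pre_tensor_mult A B c x \<in> tensor_kernel K A B"
    if "Poly_Mapping.keys c \<subseteq> ?S" "x \<in> tensor_kernel K A B" for c x
    using that(1)
  proof (induction c rule: frag_induction)
    case (one y)
    have "pre_tensor_mult A B (frag_of y) x \<in> tensor_kernel K A B"
      using that(2) unfolding tensor_kernel_def
    proof (induction rule: generate.induct)
      case one
      show ?case using zero by (simp add: pre_tensor_ring_def tensor_kernel_def)
    next
      case (incl h)
      then show ?case using gen_mult[of "fst y" "snd y" h] \<open>y \<in> ?S\<close> by (auto intro: generate.incl)
    next
      case (inv h)
      then have "pre_tensor_mult A B (frag_of y) (- h) = 0 - pre_tensor_mult A B (frag_of y) h"
        by (simp add: pre_tensor_mult_minus)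
      then show ?case
        using gen_mult[of "fst y" "snd y" h] \<open>y \<in> ?S\<close> inv gens neg[of h] diff[OF zero incl]
        by (auto simp: tensor_kernel_def)
    next
      case (eng h1 h2)
      then show ?case
        using generate.eng[OF eng.IH] by (simp add: pre_tensor_ring_def pre_tensor_mult_add)
    qed
    then show ?case .
  qed (use zero diff in \<open>auto simp: pre_tensor_mult_diff\<close>)
  show ?thesis
  proof (rule idealI)
    show "ring ?P" by (rule P.ring_axioms)
    show "subgroup (tensor_kernel K A B) (add_monoid ?P)" by (rule sub)
  next
    fix a x assume a: "a \<in> tensor_kernel K A B" and x: "x \<in> carrier ?P"
    then show "x \<otimes>\<^bsub>?P\<^esub> a \<in> tensor_kernel K A B"
      using mult[of x a] by (simp add: pre_tensor_ring_def)
    moreover have "a \<in> carrier ?P" using subgroup.mem_carrier[OF sub a] by simp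
    ultimately show "a \<otimes>\<^bsub>?P\<^esub> x \<in> tensor_kernel K A B"
      using x P.m_comm by simp
  qed
qed

lemma tensor_ring_cring:
  assumes "algebra K A" "algebra K B"
  shows "cring (tensor_ring K A B)"
  unfolding tensor_ring_def
  using tensor_kernel_ideal[OF assms] pre_tensor_ring_cring[of A B] assms
  by (auto intro!: ideal.quotient_is_cring simp: algebra_def)

lemma pure_tensor_mult:
  assumes "algebra K A" "algebra K B"
    and "a \<in> carrier A" "a' \<in> carrier A" "b \<in> carrier B" "b' \<in> carrier B"
  shows "pure_tensor K A B a b \<otimes>\<^bsub>tensor_ring K A B\<^esub> pure_tensor K A B a' b' =
    pure_tensor K A B (a \<otimes>\<^bsub>A\<^esub> a') (b \<otimes>\<^bsub>B\<^esub> b')"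
proof -
  interpret N: ideal "tensor_kernel K A B" "pre_tensor_ring A B"
    by (rule tensor_kernel_ideal[OF assms(1,2)])
  show ?thesis
    using N.rcoset_mult_add[of "frag_of (a, b)" "frag_of (a', b')"] assms(3-6)
    by (simp add: tensor_ring_def FactRing_def pure_tensor_def pre_tensor_ring_def)
qed

lemma pure_tensor_eqI:
  assumes "algebra K A" "algebra K B"
    and "c \<in> carrier (pre_tensor_ring A B)" "d \<in> carrier (pre_tensor_ring A B)"
    and "c - d \<in> tensor_kernel K A B"
  shows "tensor_kernel K A B +>\<^bsub>pre_tensor_ring A B\<^esub> c = tensor_kernel K A B +>\<^bsub>pre_tensor_ring A B\<^esub> d"
proof -
  interpret N: ideal "tensor_kernel K A B" "pre_tensor_ring A B"
    by (rule tensor_kernel_ideal[OF assms(1,2)])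
  have "c \<in> tensor_kernel K A B +>\<^bsub>pre_tensor_ring A B\<^esub> d"
    using assms(5) by (auto simp: a_r_coset_def' pre_tensor_ring_def intro!: bexI[of _ "c - d"])
  then show ?thesis
    using N.a_repr_independence' assms(4) by metis
qed

lemma pure_tensor_balanced:
  assumes "algebra K A" "algebra K B"
    and "a \<in> carrier A" "a' \<in> carrier A" "b \<in> carrier B" "b' \<in> carrier B" "c \<in> carrier K"
  shows "pure_tensor K A B (a \<oplus>\<^bsub>A\<^esub> a') b =
      pure_tensor K A B a b \<oplus>\<^bsub>tensor_ring K A B\<^esub> pure_tensor K A B a' b"
    and "pure_tensor K A B a (b \<oplus>\<^bsub>B\<^esub> b') =
      pure_tensor K A B a b \<oplus>\<^bsub>tensor_ring K A B\<^esub> pure_tensor K A B a b'"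
    and "pure_tensor K A B (c \<odot>\<^bsub>A\<^esub> a) b = pure_tensor K A B a (c \<odot>\<^bsub>B\<^esub> b)"
proof -
  interpret A: cring A using assms(1) by (simp add: algebra_def)
  interpret B: cring B using assms(2) by (simp add: algebra_def)
  interpret KA: algebra K A by fact
  interpret KB: algebra K B by fact
  interpret N: ideal "tensor_kernel K A B" "pre_tensor_ring A B"
    by (rule tensor_kernel_ideal[OF assms(1,2)])
  have plus: "pure_tensor K A B x y \<oplus>\<^bsub>tensor_ring K A B\<^esub> pure_tensor K A B x' y' =
      tensor_kernel K A B +>\<^bsub>pre_tensor_ring A B\<^esub> (frag_of (x, y) + frag_of (x', y'))"
    if "x \<in> carrier A" "x' \<in> carrier A" "y \<in> carrier B" "y' \<in> carrier B" for x x' y y'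
    using N.a_rcos_sum[of "frag_of (x, y)" "frag_of (x', y')"] that
    by (simp add: tensor_ring_def FactRing_def pure_tensor_def pre_tensor_ring_def)
  have rel: "x \<in> tensor_kernel K A B" if "x \<in> tensor_relators K A B" for x
    using that by (simp add: tensor_kernel_def generate.incl)
  have carr: "frag_of (x, y) \<in> carrier (pre_tensor_ring A B)" if "x \<in> carrier A" "y \<in> carrier B" for x y
    using that by (simp add: pre_tensor_ring_def)
  have carr2: "frag_of (x, y) + frag_of (x', y') \<in> carrier (pre_tensor_ring A B)"
    if "x \<in> carrier A" "x' \<in> carrier A" "y \<in> carrier B" "y' \<in> carrier B" for x x' y y'
    using N.a_closed[OF carr[of x y] carr[of x' y']] that by (simp add: pre_tensor_ring_def)
  show "pure_tensor K A B (a \<oplus>\<^bsub>A\<^esub> a') b =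
      pure_tensor K A B a b \<oplus>\<^bsub>tensor_ring K A B\<^esub> pure_tensor K A B a' b"
    unfolding plus[OF assms(3,4,5,5)] unfolding pure_tensor_def
    by (rule pure_tensor_eqI[OF assms(1,2)]; (rule carr carr2 rel)?)
      (use assms in \<open>auto simp: tensor_relators_def diff_diff_eq[symmetric]\<close>)
  show "pure_tensor K A B a (b \<oplus>\<^bsub>B\<^esub> b') =
      pure_tensor K A B a b \<oplus>\<^bsub>tensor_ring K A B\<^esub> pure_tensor K A B a b'"
    unfolding plus[OF assms(3,3,5,6)] unfolding pure_tensor_def
    by (rule pure_tensor_eqI[OF assms(1,2)]; (rule carr carr2 rel)?)
      (use assms in \<open>auto simp: tensor_relators_def diff_diff_eq[symmetric]\<close>)
  show "pure_tensor K A B (c \<odot>\<^bsub>A\<^esub> a) b = pure_tensor K A B a (c \<odot>\<^bsub>B\<^esub> b)"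
    unfolding pure_tensor_def
    by (rule pure_tensor_eqI[OF assms(1,2)]; (rule carr rel)?)
      (use assms in \<open>auto simp: tensor_relators_def\<close>)
qed

lemma tensor_in_hom:
  assumes "algebra K A" "algebra K B"
  shows "tensor_inl K A B \<in> ring_hom A (tensor_ring K A B)"
    and "tensor_inr K A B \<in> ring_hom B (tensor_ring K A B)"
proof -
  interpret A: cring A using assms(1) by (simp add: algebra_def)
  interpret B: cring B using assms(2) by (simp add: algebra_def)
  interpret KA: algebra K A by fact
  have carr: "pure_tensor K A B a b \<in> carrier (tensor_ring K A B)"
    if "a \<in> carrier A" "b \<in> carrier B" for a b
  proof -
    have "frag_of (a, b) \<in> carrier (pre_tensor_ring A B)"
      using that by (simp add: pre_tensor_ring_def)
    then show ?thesis
      unfolding pure_tensor_def tensor_ring_def FactRing_def A_RCOSETS_def' a_r_coset_def' by auto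
  qed
  have one: "pure_tensor K A B \<one>\<^bsub>A\<^esub> \<one>\<^bsub>B\<^esub> = \<one>\<^bsub>tensor_ring K A B\<^esub>"
    by (simp add: pure_tensor_def tensor_ring_def FactRing_def pre_tensor_ring_def)
  have K: "\<zero>\<^bsub>K\<^esub> \<in> carrier K" by (rule KA.R.zero_closed)
  show "tensor_inl K A B \<in> ring_hom A (tensor_ring K A B)"
  proof (rule ring_hom_memI)
    fix x y assume "x \<in> carrier A" "y \<in> carrier A"
    then show "tensor_inl K A B (x \<otimes>\<^bsub>A\<^esub> y) = tensor_inl K A B x \<otimes>\<^bsub>tensor_ring K A B\<^esub> tensor_inl K A B y"
      using pure_tensor_mult[OF assms, of x y "\<one>\<^bsub>B\<^esub>" "\<one>\<^bsub>B\<^esub>"] by (simp add: tensor_inl_def)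
    show "tensor_inl K A B (x \<oplus>\<^bsub>A\<^esub> y) = tensor_inl K A B x \<oplus>\<^bsub>tensor_ring K A B\<^esub> tensor_inl K A B y"
      unfolding tensor_inl_def
      by (rule pure_tensor_balanced(1)[OF assms _ _ B.one_closed B.one_closed K]) fact+
  qed (simp_all add: tensor_inl_def carr one)
  show "tensor_inr K A B \<in> ring_hom B (tensor_ring K A B)"
  proof (rule ring_hom_memI)
    fix x y assume "x \<in> carrier B" "y \<in> carrier B"
    then show "tensor_inr K A B (x \<otimes>\<^bsub>B\<^esub> y) = tensor_inr K A B x \<otimes>\<^bsub>tensor_ring K A B\<^esub> tensor_inr K A B y"
      using pure_tensor_mult[OF assms, of "\<one>\<^bsub>A\<^esub>" "\<one>\<^bsub>A\<^esub>" x y] by (simp add: tensor_inr_def)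
    show "tensor_inr K A B (x \<oplus>\<^bsub>B\<^esub> y) = tensor_inr K A B x \<oplus>\<^bsub>tensor_ring K A B\<^esub> tensor_inr K A B y"
      unfolding tensor_inr_def
      by (rule pure_tensor_balanced(2)[OF assms A.one_closed A.one_closed _ _ K]) fact+
  qed (simp_all add: tensor_inr_def carr one)
qed

context cring
begin

lemma kill_pair:
  assumes "t \<in> carrier R" "t' \<in> carrier R" "p \<in> carrier R" "q \<in> carrier R"
    and "d \<in> carrier R" "d' \<in> carrier R" "t \<otimes> d = \<zero>" "t' \<otimes> d' = \<zero>"
  shows "t \<otimes> t' \<otimes> (p \<otimes> d \<oplus> q \<otimes> d') = \<zero>"
proof -
  have "t \<otimes> t' \<otimes> (p \<otimes> d \<oplus> q \<otimes> d') = t' \<otimes> p \<otimes> (t \<otimes> d) \<oplus> t \<otimes> q \<otimes> (t' \<otimes> d')"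
    using assms(1-6) by algebra
  then show ?thesis using assms by simp
qed

context
  fixes M
  assumes M: "M \<subseteq> carrier R" "\<one> \<in> M" "\<And>s t. s \<in> M \<Longrightarrow> t \<in> M \<Longrightarrow> s \<otimes> t \<in> M"
begin

lemma frac_rel_equiv: "equiv (carrier R \<times> M) (frac_rel R M)"
proof (rule equivI)
  show "frac_rel R M \<subseteq> (carrier R \<times> M) \<times> (carrier R \<times> M)"
    by (auto simp: frac_rel_def)
  show "refl_on (carrier R \<times> M) (frac_rel R M)"
  proof (rule refl_onI, clarify)
    fix r s assume "r \<in> carrier R" "s \<in> M"
    moreover from this have "\<one> \<otimes> (r \<otimes> s \<ominus> r \<otimes> s) = \<zero>"
      using M(1) by (simp add: minus_eq r_neg subsetD)
    ultimately show "((r, s), r, s) \<in> frac_rel R M"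
      using M(2) unfolding frac_rel_def by blast
  qed
  show "sym (frac_rel R M)"
  proof (rule symI, clarsimp simp: frac_rel_def)
    fix r s r' s' t assume *: "t \<in> M" "r \<in> carrier R" "r' \<in> carrier R" "s \<in> M" "s' \<in> M"
      "t \<otimes> (r \<otimes> s' \<ominus> r' \<otimes> s) = \<zero>"
    then have c: "s \<in> carrier R" "s' \<in> carrier R" "t \<in> carrier R" using M(1) by blast+
    have "t \<otimes> (r' \<otimes> s \<ominus> r \<otimes> s') = \<ominus> (t \<otimes> (r \<otimes> s' \<ominus> r' \<otimes> s))"
      using *(2,3) c by algebra
    then show "\<exists>t\<in>M. t \<otimes> (r' \<otimes> s \<ominus> r \<otimes> s') = \<zero>"
      using *(1,6) by (intro bexI[of _ t]) simp_all
  qed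
  show "trans (frac_rel R M)"
  proof (rule transI, clarsimp simp: frac_rel_def)
    fix r s r' s' r'' s'' t t' assume *: "t \<in> M" "t' \<in> M" "r \<in> carrier R" "r' \<in> carrier R"
      "r'' \<in> carrier R" "s \<in> M" "s' \<in> M" "s'' \<in> M"
      "t \<otimes> (r \<otimes> s' \<ominus> r' \<otimes> s) = \<zero>" "t' \<otimes> (r' \<otimes> s'' \<ominus> r'' \<otimes> s') = \<zero>"
    then have c: "s \<in> carrier R" "s' \<in> carrier R" "s'' \<in> carrier R" "t \<in> carrier R" "t' \<in> carrier R"
      using M(1) by blast+
    have "s' \<otimes> (r \<otimes> s'' \<ominus> r'' \<otimes> s) =
        s'' \<otimes> (r \<otimes> s' \<ominus> r' \<otimes> s) \<oplus> s \<otimes> (r' \<otimes> s'' \<ominus> r'' \<otimes> s')"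
      using *(3-5) c(1-3) by algebra
    then have "t \<otimes> t' \<otimes> (s' \<otimes> (r \<otimes> s'' \<ominus> r'' \<otimes> s)) = \<zero>"
      using kill_pair[OF c(4,5) c(3,1) _ _ *(9,10)] *(3-5) c(1-3) by simp
    then have "t \<otimes> t' \<otimes> s' \<otimes> (r \<otimes> s'' \<ominus> r'' \<otimes> s) = \<zero>"
      using *(3-5) c by (simp add: m_assoc)
    moreover have "t \<otimes> t' \<otimes> s' \<in> M" using M(3) *(1,2,7) by blast
    ultimately show "\<exists>t\<in>M. t \<otimes> (r \<otimes> s'' \<ominus> r'' \<otimes> s) = \<zero>" by blast
  qed
qed

lemma fraction_eq_iff:
  assumes "r \<in> carrier R" "s \<in> M" "r' \<in> carrier R" "s' \<in> M"
  shows "fraction R M r s = fraction R M r' s' \<longleftrightarrow> (\<exists>t\<in>M. t \<otimes> (r \<otimes> s' \<ominus> r' \<otimes> s) = \<zero>)"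
proof -
  have "fraction R M r s = fraction R M r' s' \<longleftrightarrow> ((r, s), (r', s')) \<in> frac_rel R M"
    unfolding fraction_def by (rule eq_equiv_class_iff[OF frac_rel_equiv]) (use assms in simp_all)
  then show ?thesis by (simp add: frac_rel_def assms)
qed

lemma fraction_eqI:
  assumes "r \<in> carrier R" "s \<in> M" "r' \<in> carrier R" "s' \<in> M" "r \<otimes> s' = r' \<otimes> s"
  shows "fraction R M r s = fraction R M r' s'"
proof -
  have "s \<in> carrier R" using assms M by blast
  then have "\<one> \<otimes> (r \<otimes> s' \<ominus> r' \<otimes> s) = \<zero>"
    using assms by (simp add: minus_eq r_neg)
  then show ?thesis
    using assms M(2) by (subst fraction_eq_iff) blast+
qed

lemma mem_fraction:
  assumes "p \<in> fraction R M r s"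
  obtains a b where "p = (a, b)" "a \<in> carrier R" "b \<in> M" "r \<in> carrier R" "s \<in> M"
    "fraction R M a b = fraction R M r s"
proof -
  have "((r, s), p) \<in> frac_rel R M" using assms by (simp add: fraction_def)
  moreover have "frac_rel R M `` {(r, s)} = frac_rel R M `` {p}"
    using equiv_class_eq[OF frac_rel_equiv \<open>((r, s), p) \<in> frac_rel R M\<close>] .
  ultimately show ?thesis
    using that by (cases p) (auto simp: fraction_def frac_rel_def)
qed

lemma fraction_self: "r \<in> carrier R \<Longrightarrow> s \<in> M \<Longrightarrow> (r, s) \<in> fraction R M r s"
  unfolding fraction_def by (rule equiv_class_self[OF frac_rel_equiv]) simp

lemma localization_mult:
  assumes "r \<in> carrier R" "s \<in> M" "r' \<in> carrier R" "s' \<in> M"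
  shows "fraction R M r s \<otimes>\<^bsub>localization R M\<^esub> fraction R M r' s' = fraction R M (r \<otimes> r') (s \<otimes> s')"
proof -
  have "fraction R M (a \<otimes> a') (b \<otimes> b') = fraction R M (r \<otimes> r') (s \<otimes> s')"
    if "(a, b) \<in> fraction R M r s" "(a', b') \<in> fraction R M r' s'" for a b a' b'
  proof -
    have *: "a \<in> carrier R" "a' \<in> carrier R" "b \<in> M" "b' \<in> M"
      and eq: "fraction R M a b = fraction R M r s" "fraction R M a' b' = fraction R M r' s'"
      using that by (auto elim: mem_fraction)
    obtain t t' where t: "t \<in> M" "t' \<in> M"
      "t \<otimes> (a \<otimes> s \<ominus> r \<otimes> b) = \<zero>" "t' \<otimes> (a' \<otimes> s' \<ominus> r' \<otimes> b') = \<zero>"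
      using eq * assms by (auto simp: fraction_eq_iff)
    have c: "b \<in> carrier R" "b' \<in> carrier R" "s \<in> carrier R" "s' \<in> carrier R"
      "t \<in> carrier R" "t' \<in> carrier R" using * assms t(1,2) M(1) by blast+
    have "a \<otimes> a' \<otimes> (s \<otimes> s') \<ominus> r \<otimes> r' \<otimes> (b \<otimes> b') =
        a' \<otimes> s' \<otimes> (a \<otimes> s \<ominus> r \<otimes> b) \<oplus> r \<otimes> b \<otimes> (a' \<otimes> s' \<ominus> r' \<otimes> b')"
      using *(1,2) c(1-4) assms(1,3) by algebra
    then have "t \<otimes> t' \<otimes> (a \<otimes> a' \<otimes> (s \<otimes> s') \<ominus> r \<otimes> r' \<otimes> (b \<otimes> b')) = \<zero>"
      using kill_pair[OF c(5,6) _ _ _ _ t(3,4)] *(1,2) c(1-4) assms(1,3) by simp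
    moreover have "t \<otimes> t' \<in> M" "s \<otimes> s' \<in> M" "b \<otimes> b' \<in> M"
      using M(3) * t(1,2) assms by blast+
    ultimately show ?thesis
      using * assms c by (subst fraction_eq_iff) (simp, simp, simp, simp, blast)
  qed
  then have "(\<Union>(a', b')\<in>fraction R M r' s'. fraction R M (a \<otimes> a') (b \<otimes> b')) = fraction R M (r \<otimes> r') (s \<otimes> s')"
    if "(a, b) \<in> fraction R M r s" for a b
    by (intro UN_constant_eq[OF fraction_self[OF assms(3,4)]]) (use that in auto)
  then have "(\<Union>(a, b)\<in>fraction R M r s. \<Union>(a', b')\<in>fraction R M r' s'. fraction R M (a \<otimes> a') (b \<otimes> b')) = fraction R M (r \<otimes> r') (s \<otimes> s')"
    by (intro UN_constant_eq[OF fraction_self[OF assms(1,2)]]) auto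
  then show ?thesis
    by (simp add: localization_def)
qed

lemma localization_add:
  assumes "r \<in> carrier R" "s \<in> M" "r' \<in> carrier R" "s' \<in> M"
  shows "fraction R M r s \<oplus>\<^bsub>localization R M\<^esub> fraction R M r' s' =
    fraction R M (r \<otimes> s' \<oplus> r' \<otimes> s) (s \<otimes> s')"
proof -
  have "fraction R M (a \<otimes> b' \<oplus> a' \<otimes> b) (b \<otimes> b') = fraction R M (r \<otimes> s' \<oplus> r' \<otimes> s) (s \<otimes> s')"
    if "(a, b) \<in> fraction R M r s" "(a', b') \<in> fraction R M r' s'" for a b a' b'
  proof -
    have *: "a \<in> carrier R" "a' \<in> carrier R" "b \<in> M" "b' \<in> M"
      and eq: "fraction R M a b = fraction R M r s" "fraction R M a' b' = fraction R M r' s'"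
      using that by (auto elim: mem_fraction)
    obtain t t' where t: "t \<in> M" "t' \<in> M"
      "t \<otimes> (a \<otimes> s \<ominus> r \<otimes> b) = \<zero>" "t' \<otimes> (a' \<otimes> s' \<ominus> r' \<otimes> b') = \<zero>"
      using eq * assms by (auto simp: fraction_eq_iff)
    have c: "b \<in> carrier R" "b' \<in> carrier R" "s \<in> carrier R" "s' \<in> carrier R"
      "t \<in> carrier R" "t' \<in> carrier R" using * assms t(1,2) M(1) by blast+
    have "(a \<otimes> b' \<oplus> a' \<otimes> b) \<otimes> (s \<otimes> s') \<ominus> (r \<otimes> s' \<oplus> r' \<otimes> s) \<otimes> (b \<otimes> b') =
        b' \<otimes> s' \<otimes> (a \<otimes> s \<ominus> r \<otimes> b) \<oplus> b \<otimes> s \<otimes> (a' \<otimes> s' \<ominus> r' \<otimes> b')"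
      using *(1,2) c(1-4) assms(1,3) by algebra
    then have "t \<otimes> t' \<otimes> ((a \<otimes> b' \<oplus> a' \<otimes> b) \<otimes> (s \<otimes> s') \<ominus> (r \<otimes> s' \<oplus> r' \<otimes> s) \<otimes> (b \<otimes> b')) = \<zero>"
      using kill_pair[OF c(5,6) _ _ _ _ t(3,4)] *(1,2) c(1-4) assms(1,3) by simp
    moreover have "t \<otimes> t' \<in> M" "s \<otimes> s' \<in> M" "b \<otimes> b' \<in> M"
      using M(3) * t(1,2) assms by blast+
    ultimately show ?thesis
      using * assms c by (subst fraction_eq_iff) (simp, simp, simp, simp, blast)
  qed
  then have "(\<Union>(a', b')\<in>fraction R M r' s'. fraction R M (a \<otimes> b' \<oplus> a' \<otimes> b) (b \<otimes> b')) = fraction R M (r \<otimes> s' \<oplus> r' \<otimes> s) (s \<otimes> s')"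
    if "(a, b) \<in> fraction R M r s" for a b
    by (intro UN_constant_eq[OF fraction_self[OF assms(3,4)]]) (use that in auto)
  then have "(\<Union>(a, b)\<in>fraction R M r s. \<Union>(a', b')\<in>fraction R M r' s'. fraction R M (a \<otimes> b' \<oplus> a' \<otimes> b) (b \<otimes> b')) = fraction R M (r \<otimes> s' \<oplus> r' \<otimes> s) (s \<otimes> s')"
    by (intro UN_constant_eq[OF fraction_self[OF assms(1,2)]]) auto
  then show ?thesis
    by (simp add: localization_def)
qed

lemma localization_carrier:
  "carrier (localization R M) = {fraction R M r s | r s. r \<in> carrier R \<and> s \<in> M}"
  by (auto simp: localization_def quotient_def fraction_def)

lemma localization_cring: "cring (localization R M)"
proof -
  note [simp] = localization_mult localization_add M(2,3) subsetD[OF M(1)]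
  have zero: "\<zero>\<^bsub>localization R M\<^esub> = fraction R M \<zero> \<one>"
    and one: "\<one>\<^bsub>localization R M\<^esub> = fraction R M \<one> \<one>"
    by (simp_all add: localization_def)
  show ?thesis
  proof (rule cringI)
    show "abelian_group (localization R M)"
    proof (rule abelian_groupI)
      fix x assume "x \<in> carrier (localization R M)"
      then obtain r s where x: "x = fraction R M r s" "r \<in> carrier R" "s \<in> M"
        by (auto simp: localization_carrier)
      then have "fraction R M (\<ominus> r) s \<oplus>\<^bsub>localization R M\<^esub> x = \<zero>\<^bsub>localization R M\<^esub>"
        by (simp add: zero) (rule fraction_eqI, auto simp: l_minus l_neg)
      then show "\<exists>y\<in>carrier (localization R M). y \<oplus>\<^bsub>localization R M\<^esub> x = \<zero>\<^bsub>localization R M\<^esub>"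
        using x by (intro bexI[of _ "fraction R M (\<ominus> r) s"]) (auto simp: localization_carrier)
    next
      fix x y assume "x \<in> carrier (localization R M)" "y \<in> carrier (localization R M)"
      then obtain r s r' s' where "x = fraction R M r s" "y = fraction R M r' s'"
        "r \<in> carrier R" "r' \<in> carrier R" "s \<in> M" "s' \<in> M"
        by (auto simp: localization_carrier)
      then have "x \<oplus>\<^bsub>localization R M\<^esub> y = fraction R M (r \<otimes> s' \<oplus> r' \<otimes> s) (s \<otimes> s')"
        "r \<otimes> s' \<oplus> r' \<otimes> s \<in> carrier R" "s \<otimes> s' \<in> M" by simp_all
      then show "x \<oplus>\<^bsub>localization R M\<^esub> y \<in> carrier (localization R M)"
        unfolding localization_carrier by blast
    next
      fix x y assume "x \<in> carrier (localization R M)" "y \<in> carrier (localization R M)"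
      then show "x \<oplus>\<^bsub>localization R M\<^esub> y = y \<oplus>\<^bsub>localization R M\<^esub> x"
        by (auto simp: localization_carrier m_comm a_comm)
    next
      fix x y z assume "x \<in> carrier (localization R M)" "y \<in> carrier (localization R M)"
        "z \<in> carrier (localization R M)"
      then obtain r s r' s' r'' s'' where x: "x = fraction R M r s" "y = fraction R M r' s'"
        "z = fraction R M r'' s''" and c: "r \<in> carrier R" "r' \<in> carrier R" "r'' \<in> carrier R"
        "s \<in> M" "s' \<in> M" "s'' \<in> M" by (auto simp: localization_carrier)
      have c': "s \<in> carrier R" "s' \<in> carrier R" "s'' \<in> carrier R" using c by auto
      show "x \<oplus>\<^bsub>localization R M\<^esub> y \<oplus>\<^bsub>localization R M\<^esub> z =
          x \<oplus>\<^bsub>localization R M\<^esub> (y \<oplus>\<^bsub>localization R M\<^esub> z)"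
      proof -
        have "(r \<otimes> s' \<oplus> r' \<otimes> s) \<otimes> s'' \<oplus> r'' \<otimes> (s \<otimes> s') = r \<otimes> (s' \<otimes> s'') \<oplus> (r' \<otimes> s'' \<oplus> r'' \<otimes> s') \<otimes> s"
          using c(1-3) c' by algebra
        then show ?thesis
          using c c' unfolding x by (simp add: m_assoc)
      qed
    next
      show "\<zero>\<^bsub>localization R M\<^esub> \<in> carrier (localization R M)"
        unfolding localization_carrier zero using M by blast
      fix x assume "x \<in> carrier (localization R M)"
      then obtain r s where "x = fraction R M r s" "r \<in> carrier R" "s \<in> M"
        by (auto simp: localization_carrier)
      then show "\<zero>\<^bsub>localization R M\<^esub> \<oplus>\<^bsub>localization R M\<^esub> x = x"
        by (simp add: zero)
    qed
    show "comm_monoid (localization R M)"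
    proof (rule comm_monoidI)
      fix x y assume "x \<in> carrier (localization R M)" "y \<in> carrier (localization R M)"
      then obtain r s r' s' where x: "x = fraction R M r s" "y = fraction R M r' s'"
        and c: "r \<in> carrier R" "r' \<in> carrier R" "s \<in> M" "s' \<in> M"
        by (auto simp: localization_carrier)
      have "x \<otimes>\<^bsub>localization R M\<^esub> y = fraction R M (r \<otimes> r') (s \<otimes> s')"
        "r \<otimes> r' \<in> carrier R" "s \<otimes> s' \<in> M" using c by (simp_all add: x)
      then show "x \<otimes>\<^bsub>localization R M\<^esub> y \<in> carrier (localization R M)"
        unfolding localization_carrier by blast
      show "x \<otimes>\<^bsub>localization R M\<^esub> y = y \<otimes>\<^bsub>localization R M\<^esub> x"
        using c by (simp add: x m_comm)
    next
      fix x y z assume "x \<in> carrier (localization R M)" "y \<in> carrier (localization R M)"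
        "z \<in> carrier (localization R M)"
      then obtain r s r' s' r'' s'' where "x = fraction R M r s" "y = fraction R M r' s'"
        "z = fraction R M r'' s''" "r \<in> carrier R" "r' \<in> carrier R" "r'' \<in> carrier R"
        "s \<in> M" "s' \<in> M" "s'' \<in> M" by (auto simp: localization_carrier)
      then show "x \<otimes>\<^bsub>localization R M\<^esub> y \<otimes>\<^bsub>localization R M\<^esub> z =
          x \<otimes>\<^bsub>localization R M\<^esub> (y \<otimes>\<^bsub>localization R M\<^esub> z)"
        by (simp add: m_assoc)
    next
      show "\<one>\<^bsub>localization R M\<^esub> \<in> carrier (localization R M)"
        unfolding localization_carrier one using M by blast
      fix x assume "x \<in> carrier (localization R M)"
      then obtain r s where "x = fraction R M r s" "r \<in> carrier R" "s \<in> M"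
        by (auto simp: localization_carrier)
      then show "\<one>\<^bsub>localization R M\<^esub> \<otimes>\<^bsub>localization R M\<^esub> x = x"
        by (simp add: one)
    qed
    fix x y z assume "x \<in> carrier (localization R M)" "y \<in> carrier (localization R M)"
        "z \<in> carrier (localization R M)"
    then obtain r s r' s' r'' s'' where x: "x = fraction R M r s" "y = fraction R M r' s'"
      "z = fraction R M r'' s''" and c: "r \<in> carrier R" "r' \<in> carrier R" "r'' \<in> carrier R"
      "s \<in> M" "s' \<in> M" "s'' \<in> M" by (auto simp: localization_carrier)
    have c': "s \<in> carrier R" "s' \<in> carrier R" "s'' \<in> carrier R" using c by auto
    show "(x \<oplus>\<^bsub>localization R M\<^esub> y) \<otimes>\<^bsub>localization R M\<^esub> z =
        x \<otimes>\<^bsub>localization R M\<^esub> z \<oplus>\<^bsub>localization R M\<^esub> y \<otimes>\<^bsub>localization R M\<^esub> z"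
    proof -
      let ?n = "(r \<otimes> s' \<oplus> r' \<otimes> s) \<otimes> r''" and ?d = "s \<otimes> s' \<otimes> s''"
      have n: "r \<otimes> r'' \<otimes> (s' \<otimes> s'') \<oplus> r' \<otimes> r'' \<otimes> (s \<otimes> s'') = ?n \<otimes> s''"
        using c(1-3) c' by algebra
      have d: "s \<otimes> s'' \<otimes> (s' \<otimes> s'') = ?d \<otimes> s''"
        using c' by algebra
      have "fraction R M ?n ?d = fraction R M (?n \<otimes> s'') (?d \<otimes> s'')"
        by (rule fraction_eqI) (use c c' in \<open>simp_all add: m_ac\<close>)
      then show ?thesis
        using c unfolding x by (simp add: n d)
    qed
  qed
qed

end

end

end

theory Submission
  imports Defs
begin

text \<open>By \<open>rational_symbolic_power_eq\<close>, an element \<open>f\<close> lies in a symbolic power of \<open>I\<close> iff for every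
  associated prime \<open>p\<close> of \<open>A/I\<close> some \<open>s \<notin> p\<close> multiplies \<open>f\<close> into the ideal generated by the ordinary
  rational power. Write \<open>T\<close> for the sum on the right-hand side of the symbolic binomial formula.

  The inclusion of \<open>T\<close> in the symbolic power holds because an associated prime of \<open>R/(I + J)\<close> contracts into
  an associated prime of \<open>A/I\<close> and into one of \<open>B/J\<close> (\<open>associated_prime_contraction\<close>): multipliers for the two
  factors of a product give a multiplier for the product (\<open>symbolic_product_subset\<close>).

  For the other inclusion, the assumed formula says that the rational power of \<open>I + J\<close> is contained in \<open>T\<close>. So
  for \<open>x\<close> in its symbolic power, the ideal \<open>G = T : x\<close> lies in no associated prime of \<open>R/(I + J)\<close>, which means
  that \<open>G\<close> annihilates no nonzero element of \<open>A/I \<otimes> B/J\<close>. It has to be shown that \<open>G\<close> annihilates no nonzero element of \<open>R/T\<close>,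
  for then \<open>x\<close> vanishes there. Since \<open>R\<close> is Noetherian, finitely many weights suffice to
  generate \<open>T\<close>, and filtering by the weights reduces the question to quotients \<open>A/a \<otimes> B/c\<close> with \<open>a\<close> and \<open>c\<close>
  symbolic powers of \<open>I\<close> and \<open>J\<close> (\<open>regular_modulo_binomial_sum\<close>). Symbolic powers are intersections of ideals
  saturated at associated primes \<open>p\<close> of \<open>A/I\<close>, respectively \<open>q\<close> of \<open>B/J\<close>. On \<open>A/p \<otimes> B/q\<close>, which embeds into
  \<open>A/I \<otimes> B/J\<close>, there is nothing to do; and the property spreads from \<open>p\<close> to all \<open>p\<close>-saturated
  ideals by Noetherian induction and Krull's intersection theorem (\<open>regular_modulo_saturated\<close>).

  All of this linear algebra over the field rests on one criterion: an element of \<open>R\<close> lies in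
  \<open>a \<otimes> B + A \<otimes> c\<close> iff all \<open>A\<close>-linear maps \<open>R \<rightarrow> A\<close> that vanish on \<open>c\<close> send it into \<open>a\<close> (\<open>sum_ideal_iff_slices\<close>).
  It makes the exactness of tensor products, their compatibility with infinite intersections and with
  colon ideals immediate. That the symbolic powers decrease with the exponent, which the filtration by weights
  uses, comes from the same property of rational powers (\<open>rational_power_antimono\<close>).\<close>

section \<open>Colon ideals, saturations and associated primes\<close>

definition ideal_colon :: "('r, 'm) ring_scheme \<Rightarrow> 'r set \<Rightarrow> 'r \<Rightarrow> 'r set"
  where "ideal_colon R I y = {r \<in> carrier R. r \<otimes>\<^bsub>R\<^esub> y \<in> I}"

text \<open>The contraction to \<open>R\<close> of the ideal generated by \<open>I\<close> in \<open>R\<^sub>P\<close>; lemma \<open>contr_ext_localization\<close> below.\<close>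

definition prime_saturation :: "('r, 'm) ring_scheme \<Rightarrow> 'r set \<Rightarrow> 'r set \<Rightarrow> 'r set"
  where "prime_saturation R P I = {f \<in> carrier R. \<exists>s\<in>carrier R - P. s \<otimes>\<^bsub>R\<^esub> f \<in> I}"

context cring
begin

lemma ideal_by_closure:
  assumes "I \<subseteq> carrier R" "\<zero> \<in> I"
    and add: "\<And>x y. x \<in> I \<Longrightarrow> y \<in> I \<Longrightarrow> x \<oplus> y \<in> I"
    and mult: "\<And>r x. r \<in> carrier R \<Longrightarrow> x \<in> I \<Longrightarrow> r \<otimes> x \<in> I"
  shows "ideal I R"
proof (rule idealI)
  show "subgroup I (add_monoid R)"
  proof
    fix x assume x: "x \<in> I"
    then have "\<ominus> \<one> \<otimes> x \<in> I" by (intro mult) auto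
    moreover have "\<ominus> \<one> \<otimes> x = \<ominus> x" using x assms(1) by (simp add: l_minus subsetD)
    ultimately show "inv\<^bsub>add_monoid R\<^esub> x \<in> I" by (simp add: a_inv_def)
  qed (use assms in auto)
next
  fix a x assume "a \<in> I" "x \<in> carrier R"
  then show "x \<otimes> a \<in> I" "a \<otimes> x \<in> I" using mult[of x a] assms(1) by (auto simp: m_comm)
qed (rule ring_axioms)

lemma ideal_closed:
  assumes "ideal I R"
  shows "I \<subseteq> carrier R" "\<zero> \<in> I" "x \<in> I \<Longrightarrow> y \<in> I \<Longrightarrow> x \<oplus> y \<in> I"
    "r \<in> carrier R \<Longrightarrow> x \<in> I \<Longrightarrow> r \<otimes> x \<in> I" "x \<in> I \<Longrightarrow> r \<in> carrier R \<Longrightarrow> x \<otimes> r \<in> I"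
    "x \<in> I \<Longrightarrow> \<ominus> x \<in> I" "x \<in> I \<Longrightarrow> y \<in> I \<Longrightarrow> x \<ominus> y \<in> I"
proof -
  interpret I: ideal I R by fact
  show "I \<subseteq> carrier R" "\<zero> \<in> I" "x \<in> I \<Longrightarrow> y \<in> I \<Longrightarrow> x \<oplus> y \<in> I"
    "r \<in> carrier R \<Longrightarrow> x \<in> I \<Longrightarrow> r \<otimes> x \<in> I" "x \<in> I \<Longrightarrow> r \<in> carrier R \<Longrightarrow> x \<otimes> r \<in> I"
    "x \<in> I \<Longrightarrow> \<ominus> x \<in> I" "x \<in> I \<Longrightarrow> y \<in> I \<Longrightarrow> x \<ominus> y \<in> I"
    by (auto simp: I.I_l_closed I.I_r_closed I.a_inv_closed I.a_subset a_minus_def I.Icarr)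
qed

lemma ideal_add_cancel:
  assumes "ideal I R" "x \<oplus> y \<in> I" "y \<in> I" "x \<in> carrier R"
  shows "x \<in> I"
proof -
  note I = ideal_closed[OF assms(1)]
  have y: "y \<in> carrier R" using I(1) assms(3) by blast
  have "x \<oplus> y \<oplus> \<ominus> y \<in> I" using I(3)[OF assms(2) I(6)[OF assms(3)]] .
  then show ?thesis using assms(4) y by (simp add: a_assoc r_neg)
qed

lemma ideal_colon_ideal:
  assumes I: "ideal I R" and y: "y \<in> carrier R"
  shows "ideal (ideal_colon R I y) R"
  by (rule ideal_by_closure)
    (use y ideal_closed[OF I] in \<open>auto simp: ideal_colon_def l_distr m_assoc\<close>)

lemma prime_complement_mult:
  assumes "primeideal P R" "s \<in> carrier R - P" "t \<in> carrier R - P"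
  shows "s \<otimes> t \<in> carrier R - P"
  using primeideal.I_prime[OF assms(1), of s t] assms by auto

lemma prime_complement_one:
  assumes "primeideal P R" shows "\<one> \<in> carrier R - P"
proof -
  interpret P: primeideal P R by fact
  show ?thesis using P.one_imp_carrier P.I_notcarr by auto
qed

lemma prime_saturation_ideal:
  assumes P: "primeideal P R" and I: "ideal I R"
  shows "ideal (prime_saturation R P I) R"
proof (rule ideal_by_closure)
  note I = ideal_closed[OF I]
  show "\<zero> \<in> prime_saturation R P I"
    using prime_complement_one[OF P] I(2) by (auto simp: prime_saturation_def intro!: bexI[of _ \<one>])
  fix x assume "x \<in> prime_saturation R P I"
  then obtain s where x: "x \<in> carrier R" "s \<in> carrier R - P" "s \<otimes> x \<in> I"
    by (auto simp: prime_saturation_def)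
  {
    fix y assume "y \<in> prime_saturation R P I"
    then obtain t where y: "y \<in> carrier R" "t \<in> carrier R - P" "t \<otimes> y \<in> I"
      by (auto simp: prime_saturation_def)
    have "s \<otimes> t \<otimes> (x \<oplus> y) = t \<otimes> (s \<otimes> x) \<oplus> s \<otimes> (t \<otimes> y)"
      using x(1,2) y(1,2) by (simp add: r_distr m_ac)
    then have "s \<otimes> t \<otimes> (x \<oplus> y) \<in> I" using I x y by simp
    then show "x \<oplus> y \<in> prime_saturation R P I"
      using prime_complement_mult[OF P x(2) y(2)] x(1) y(1)
      unfolding prime_saturation_def by blast
  }
  fix r assume r: "r \<in> carrier R"
  have "s \<otimes> (r \<otimes> x) = r \<otimes> (s \<otimes> x)" using r x by (simp add: m_ac)
  then show "r \<otimes> x \<in> prime_saturation R P I"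
    using I(4)[OF r x(3)] r x(1,2) unfolding prime_saturation_def
    by (intro CollectI conjI bexI[of _ s]) simp_all
qed (auto simp: prime_saturation_def)

lemma subset_prime_saturation:
  assumes "primeideal P R" "ideal I R" shows "I \<subseteq> prime_saturation R P I"
  using prime_complement_one[OF assms(1)] ideal_closed(1)[OF assms(2)]
  unfolding prime_saturation_def by (auto intro!: bexI[of _ \<one>] simp: subset_iff)

lemma prime_saturation_saturated:
  assumes "primeideal P R" and "f \<in> carrier R" "s \<in> carrier R - P" "s \<otimes> f \<in> prime_saturation R P I"
  shows "f \<in> prime_saturation R P I"
proof -
  obtain t where t: "t \<in> carrier R - P" "t \<otimes> (s \<otimes> f) \<in> I"
    using assms(4) by (auto simp: prime_saturation_def)
  have "t \<otimes> s \<otimes> f \<in> I" using t assms(2,3) by (simp add: m_assoc)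
  then show ?thesis
    using prime_complement_mult[OF assms(1) t(1) assms(3)] assms(2) unfolding prime_saturation_def by blast
qed

lemma ideal_hom_preimage:
  assumes S: "cring S" and h: "h \<in> ring_hom R S" and L: "ideal L S"
  shows "ideal {r \<in> carrier R. h r \<in> L} R"
proof -
  interpret S: cring S by fact
  interpret h: ring_hom_ring R S h
    by (intro ring_hom_ringI2 ring_axioms S.ring_axioms h)
  show ?thesis
    by (rule ideal_by_closure) (use S.ideal_closed[OF L] in auto)
qed

text \<open>The fractions whose numerator lies in the ideal already form an ideal of \<open>R\<^sub>P\<close>. Hence an element of
  \<open>R\<close> becomes a member of the extended ideal only if some multiple of it by an \<open>s \<notin> P\<close> lies in the
  ideal itself, and localizations disappear from the rest of the argument.\<close>

lemma contr_ext_localization: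
  assumes P: "primeideal P R" and E: "E \<subseteq> carrier R"
  shows "ideal_contr R (localize_map R P) (ideal_ext (localize_prime R P) (localize_map R P) E)
    = prime_saturation R P (Idl E)"
proof -
  let ?M = "carrier R - P" and ?h = "localize_map R P" and ?L = "localization R (carrier R - P)"
  have M: "?M \<subseteq> carrier R" "\<one> \<in> ?M" "\<And>s t. s \<in> ?M \<Longrightarrow> t \<in> ?M \<Longrightarrow> s \<otimes> t \<in> ?M"
    using prime_complement_one[OF P] prime_complement_mult[OF P] by auto
  have car: "carrier ?L = {fraction R ?M r s | r s. r \<in> carrier R \<and> s \<in> ?M}"
    by (rule localization_carrier) (use M in auto)
  have lmult: "fraction R ?M r s \<otimes>\<^bsub>?L\<^esub> fraction R ?M r' s' = fraction R ?M (r \<otimes> r') (s \<otimes> s')"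
    and ladd: "fraction R ?M r s \<oplus>\<^bsub>?L\<^esub> fraction R ?M r' s' = fraction R ?M (r \<otimes> s' \<oplus> r' \<otimes> s) (s \<otimes> s')"
    and feq: "fraction R ?M r s = fraction R ?M r' s' \<longleftrightarrow> (\<exists>t\<in>?M. t \<otimes> (r \<otimes> s' \<ominus> r' \<otimes> s) = \<zero>)"
    if "r \<in> carrier R" "s \<in> ?M" "r' \<in> carrier R" "s' \<in> ?M" for r s r' s'
    by ((rule localization_mult localization_add fraction_eq_iff; use that M in blast)+)
  interpret L: cring ?L by (rule localization_cring) (use M in auto)
  have I: "ideal (Idl E) R" using E by (rule genideal_ideal)
  note Icl = ideal_closed[OF I]
  have h: "?h \<in> ring_hom R ?L"
  proof (rule ring_hom_memI)
    show "?h \<one> = \<one>\<^bsub>?L\<^esub>" by (simp add: localize_map_def localization_def)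
    show "?h x \<in> carrier ?L" if "x \<in> carrier R" for x
      unfolding localize_map_def using that M(2) by (subst car) blast
    fix x y assume xy: "x \<in> carrier R" "y \<in> carrier R"
    show "?h (x \<otimes> y) = ?h x \<otimes>\<^bsub>?L\<^esub> ?h y"
      unfolding localize_map_def lmult[OF xy(1) M(2) xy(2) M(2)] by simp
    show "?h (x \<oplus> y) = ?h x \<oplus>\<^bsub>?L\<^esub> ?h y"
      unfolding localize_map_def ladd[OF xy(1) M(2) xy(2) M(2)] using xy by simp
  qed
  have hX: "?h ` E \<subseteq> carrier ?L" using E h by (auto simp: ring_hom_def)
  note ext = L.ideal_closed[OF L.genideal_ideal[OF hX]]
  show ?thesis
  proof (intro equalityI subsetI)
    fix f assume "f \<in> ideal_contr R ?h (ideal_ext (localize_prime R P) ?h E)"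
    then have f: "f \<in> carrier R" "?h f \<in> Idl\<^bsub>?L\<^esub> (?h ` E)"
      by (auto simp: ideal_contr_def ideal_ext_def localize_prime_def)
    define N where "N = {fraction R ?M r s | r s. r \<in> Idl E \<and> s \<in> ?M}"
    have memN: "fraction R ?M r s \<in> N" if "r \<in> Idl E" "s \<in> ?M" for r s
      using that by (auto simp: N_def)
    have "ideal N ?L"
    proof (rule L.ideal_by_closure)
      show "N \<subseteq> carrier ?L" using Icl(1) by (auto simp: N_def car)
      show "\<zero>\<^bsub>?L\<^esub> \<in> N" using memN[OF Icl(2) M(2)] by (simp add: localization_def)
      fix x assume "x \<in> N"
      then obtain r s where x: "x = fraction R ?M r s" "r \<in> Idl E" "s \<in> ?M" by (auto simp: N_def)
      have r: "r \<in> carrier R" using x Icl(1) by blast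
      show "x \<oplus>\<^bsub>?L\<^esub> y \<in> N" if yN: "y \<in> N" for y
      proof -
        obtain r' s' where y: "y = fraction R ?M r' s'" "r' \<in> Idl E" "s' \<in> ?M"
          using yN by (auto simp: N_def)
        have r': "r' \<in> carrier R" using y Icl(1) by blast
        have "r \<otimes> s' \<oplus> r' \<otimes> s \<in> Idl E" using Icl x y by simp
        then show ?thesis
          using memN M(3) x(3) y(3) by (simp only: x(1) y(1) ladd[OF r x(3) r' y(3)])
      qed
      show "y \<otimes>\<^bsub>?L\<^esub> x \<in> N" if yL: "y \<in> carrier ?L" for y
      proof -
        obtain r' s' where y: "y = fraction R ?M r' s'" "r' \<in> carrier R" "s' \<in> ?M"
          using yL by (auto simp: car)
        have "r' \<otimes> r \<in> Idl E" using Icl x y by simp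
        then show ?thesis
          using memN M(3) x(3) y(3) by (simp only: x(1) y(1) lmult[OF y(2,3) r x(3)])
      qed
    qed
    moreover have "?h ` E \<subseteq> N"
      using memN[OF _ M(2)] genideal_self[OF E] by (auto simp: localize_map_def)
    ultimately have "?h f \<in> N" using f(2) L.genideal_minimal by blast
    then obtain r s where rs: "fraction R ?M f \<one> = fraction R ?M r s" "r \<in> Idl E" "s \<in> ?M"
      by (auto simp: N_def localize_map_def)
    have r: "r \<in> carrier R" using rs Icl(1) by blast
    obtain t where t: "t \<in> ?M" "t \<otimes> (f \<otimes> s \<ominus> r \<otimes> \<one>) = \<zero>"
      using rs(1) feq[OF f(1) M(2) r rs(3)] by blast
    have "s \<in> carrier R" "t \<in> carrier R" using t rs by auto
    then have "t \<otimes> s \<otimes> f = t \<otimes> (f \<otimes> s \<ominus> r \<otimes> \<one>) \<oplus> t \<otimes> r"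
      using r f(1) by algebra
    then have "t \<otimes> s \<otimes> f \<in> Idl E" using t rs r Icl by simp
    then show "f \<in> prime_saturation R P (Idl E)"
      using M(3)[OF t(1) rs(3)] f(1) unfolding prime_saturation_def by blast
  next
    fix f assume "f \<in> prime_saturation R P (Idl E)"
    then obtain s where f: "f \<in> carrier R" "s \<in> ?M" "s \<otimes> f \<in> Idl E"
      by (auto simp: prime_saturation_def)
    have "Idl E \<subseteq> {r \<in> carrier R. ?h r \<in> Idl\<^bsub>?L\<^esub> (?h ` E)}"
      by (rule genideal_minimal[OF ideal_hom_preimage[OF L.cring_axioms h L.genideal_ideal[OF hX]]])
        (use E L.genideal_self[OF hX] in auto)
    then have "?h (s \<otimes> f) \<in> Idl\<^bsub>?L\<^esub> (?h ` E)" using f(3) by blast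
    moreover have "fraction R ?M \<one> s \<in> carrier ?L" using f(2) by (auto simp: car)
    ultimately have "fraction R ?M \<one> s \<otimes>\<^bsub>?L\<^esub> ?h (s \<otimes> f) \<in> Idl\<^bsub>?L\<^esub> (?h ` E)"
      by (rule ext(4)[rotated])
    moreover have "fraction R ?M \<one> s \<otimes>\<^bsub>?L\<^esub> ?h (s \<otimes> f) = fraction R ?M (s \<otimes> f) s"
      using f M(2) by (simp add: localize_map_def lmult)
    moreover have "fraction R ?M (s \<otimes> f) s = ?h f"
      unfolding localize_map_def
      by (rule fraction_eqI) (use f M in \<open>auto simp: m_ac\<close>)
    ultimately show "f \<in> ideal_contr R ?h (ideal_ext (localize_prime R P) ?h E)"
      using f(1) by (simp add: ideal_contr_def ideal_ext_def localize_prime_def)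
  qed
qed

lemma associated_primes_quot_module:
  assumes I: "ideal I R"
  shows "associated_primes R (quot_module R I)
    = {P. primeideal P R \<and> (\<exists>y\<in>carrier R. P = ideal_colon R I y)}"
proof -
  interpret I: ideal I R by fact
  have car: "carrier (quot_module R I) = {I +> y | y. y \<in> carrier R}"
    by (auto simp: quot_module_def FactRing_def A_RCOSETS_def')
  have "(r \<odot>\<^bsub>quot_module R I\<^esub> (I +> y) = \<zero>\<^bsub>quot_module R I\<^esub>) = (r \<otimes> y \<in> I)"
    if "r \<in> carrier R" "y \<in> carrier R" for r y
  proof -
    have "r \<odot>\<^bsub>quot_module R I\<^esub> (I +> y) = I +> (r \<otimes> y)"
      using that by (simp add: quot_module_def FactRing_def I.rcoset_mult_add)
    moreover have "\<zero>\<^bsub>quot_module R I\<^esub> = I" by (simp add: quot_module_def FactRing_def)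
    moreover have "I +> (r \<otimes> y) = I \<longleftrightarrow> r \<otimes> y \<in> I"
      using that a_coset_join1[of I "r \<otimes> y"] I.a_rcos_const[of "r \<otimes> y"] I.a_rcos_self[of "r \<otimes> y"]
      by auto
    ultimately show ?thesis by simp
  qed
  then have "{r \<in> carrier R. r \<odot>\<^bsub>quot_module R I\<^esub> (I +> y) = \<zero>\<^bsub>quot_module R I\<^esub>} = ideal_colon R I y"
    if "y \<in> carrier R" for y
    using that by (auto simp: ideal_colon_def)
  then show ?thesis
    unfolding associated_primes_def car by blast
qed

lemma mem_saturation_add_principal:
  assumes a: "ideal a R" and y: "y \<in> carrier R"
  shows "x \<in> prime_saturation R P (a <+> PIdl y)
    \<longleftrightarrow> x \<in> carrier R \<and> (\<exists>t\<in>carrier R - P. \<exists>r\<in>carrier R. t \<otimes> x \<ominus> r \<otimes> y \<in> a)"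
proof -
  note acl = ideal_closed[OF a]
  have "v \<in> a <+> PIdl y \<longleftrightarrow> (\<exists>r\<in>carrier R. v \<ominus> r \<otimes> y \<in> a)" if v: "v \<in> carrier R" for v
  proof
    assume "v \<in> a <+> PIdl y"
    then obtain z r where z: "v = z \<oplus> r \<otimes> y" "z \<in> a" "r \<in> carrier R"
      by (auto simp: set_add_def' cgenideal_def)
    have "v \<ominus> r \<otimes> y = z" using z acl y by (auto simp: minus_eq a_assoc r_neg subset_iff)
    then show "\<exists>r\<in>carrier R. v \<ominus> r \<otimes> y \<in> a" using z(2,3) by (intro bexI[of _ r]) simp_all
  next
    assume "\<exists>r\<in>carrier R. v \<ominus> r \<otimes> y \<in> a"
    then obtain r where r: "r \<in> carrier R" "v \<ominus> r \<otimes> y \<in> a" by blast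
    have "v = (v \<ominus> r \<otimes> y) \<oplus> r \<otimes> y" using v r(1) y by algebra
    then show "v \<in> a <+> PIdl y" using r unfolding set_add_def' cgenideal_def by blast
  qed
  then show ?thesis
    unfolding prime_saturation_def mem_Collect_eq
    by (intro conj_cong bex_cong refl) simp
qed

end

locale noetherian_cring = cring + noetherian_ring

context noetherian_cring
begin

lemma maximal_ideal_in_family:
  assumes "F \<noteq> {}" "\<And>I. I \<in> F \<Longrightarrow> ideal I R"
  obtains M where "M \<in> F" "\<And>I. I \<in> F \<Longrightarrow> M \<subseteq> I \<Longrightarrow> I = M"
proof -
  have "\<exists>M\<in>F. \<forall>E\<in>F. M \<subseteq> E \<longrightarrow> E = M"
  proof (rule subset_Zorn)
    fix C assume C: "subset.chain F C"
    show "\<exists>U\<in>F. \<forall>E\<in>C. E \<subseteq> U"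
    proof (cases "C = {}")
      case False
      have "subset.chain {I. ideal I R} C" using C assms(2) by (auto simp: pred_on.chain_def)
      then have "\<Union>C \<in> C" by (rule ideal_chain_is_trivial[OF False])
      then show ?thesis using C by (auto simp: pred_on.chain_def intro!: bexI[of _ "\<Union>C"])
    qed (use assms(1) in auto)
  qed
  then show ?thesis using that by blast
qed

lemma ideal_noetherian_induct [consumes 1, case_names step]:
  assumes "ideal I R"
    and "\<And>I. ideal I R \<Longrightarrow> (\<And>J. ideal J R \<Longrightarrow> I \<subset> J \<Longrightarrow> Q J) \<Longrightarrow> Q I"
  shows "Q I"
proof (rule ccontr)
  assume "\<not> Q I"
  then have "{I. ideal I R \<and> \<not> Q I} \<noteq> {}" using assms(1) by blast
  then obtain M where "M \<in> {I. ideal I R \<and> \<not> Q I}"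
    "\<And>I. I \<in> {I. ideal I R \<and> \<not> Q I} \<Longrightarrow> M \<subseteq> I \<Longrightarrow> I = M"
    using maximal_ideal_in_family[of "{I. ideal I R \<and> \<not> Q I}"] by blast
  then show False using assms(2)[of M] by blast
qed

text \<open>Among the proper colon ideals \<open>I : r y\<close> a maximal one is prime.\<close>

lemma associated_prime_above_colon:
  assumes I: "ideal I R" and y: "y \<in> carrier R" "y \<notin> I"
  obtains P where "P \<in> associated_primes R (quot_module R I)" "ideal_colon R I y \<subseteq> P"
proof -
  note Icl = ideal_closed[OF I]
  define F where "F = {ideal_colon R I (r \<otimes> y) | r. r \<in> carrier R \<and> r \<otimes> y \<notin> I}"
  have "ideal_colon R I (\<one> \<otimes> y) \<in> F" using y by (auto simp: F_def intro!: exI[of _ \<one>])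
  then have ne: "F \<noteq> {}" by blast
  have id: "ideal L R" if "L \<in> F" for L
    using that y ideal_colon_ideal[OF I] by (auto simp: F_def)
  obtain P where P: "P \<in> F" "\<And>L. L \<in> F \<Longrightarrow> P \<subseteq> L \<Longrightarrow> L = P"
    using maximal_ideal_in_family[OF ne id] by blast
  obtain r where r: "r \<in> carrier R" "r \<otimes> y \<notin> I" "P = ideal_colon R I (r \<otimes> y)"
    using P(1) by (auto simp: F_def)
  have "primeideal P R"
  proof (rule primeidealI[OF id[OF P(1)] cring_axioms])
    have "\<one> \<notin> P" using r y by (simp add: ideal_colon_def)
    then show "carrier R \<noteq> P" using one_closed by blast
    fix a b assume ab: "a \<in> carrier R" "b \<in> carrier R" "a \<otimes> b \<in> P"
    show "a \<in> P \<or> b \<in> P"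
    proof (cases "b \<in> P")
      case False
      then have "b \<otimes> r \<otimes> y \<notin> I" using ab r y by (simp add: ideal_colon_def m_assoc)
      then have "ideal_colon R I (b \<otimes> r \<otimes> y) \<in> F" using ab r by (auto simp: F_def)
      moreover have "P \<subseteq> ideal_colon R I (b \<otimes> r \<otimes> y)"
      proof
        fix x assume "x \<in> P"
        then have x: "x \<in> carrier R" "x \<otimes> (r \<otimes> y) \<in> I" using r(3) by (auto simp: ideal_colon_def)
        have "x \<otimes> (b \<otimes> r \<otimes> y) = b \<otimes> (x \<otimes> (r \<otimes> y))" using x(1) ab r(1) y(1) by (simp add: m_ac)
        then show "x \<in> ideal_colon R I (b \<otimes> r \<otimes> y)" using x Icl ab by (simp add: ideal_colon_def)
      qed
      ultimately have "ideal_colon R I (b \<otimes> r \<otimes> y) = P" by (rule P(2))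
      moreover have "a \<otimes> (b \<otimes> r \<otimes> y) \<in> I"
        using ab r y by (simp add: ideal_colon_def m_assoc)
      ultimately show ?thesis using ab(1) by (auto simp: ideal_colon_def)
    qed simp
  qed
  moreover have "ideal_colon R I y \<subseteq> P"
  proof
    fix x assume "x \<in> ideal_colon R I y"
    then have x: "x \<in> carrier R" "x \<otimes> y \<in> I" by (auto simp: ideal_colon_def)
    have "x \<otimes> (r \<otimes> y) = r \<otimes> (x \<otimes> y)" using x(1) r(1) y(1) by (simp add: m_ac)
    then show "x \<in> P" using x r Icl by (simp add: ideal_colon_def)
  qed
  ultimately show ?thesis
    using that[of P] r y by (auto simp: associated_primes_quot_module[OF I])
qed

text \<open>Krull's intersection theorem for the powers of a single element \<open>f\<close> that is regular modulo \<open>a\<close>.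
  Locally at \<open>P\<close> write \<open>m = f\<^sup>n y\<^sub>n\<close> modulo \<open>a\<close>. Cancelling \<open>f\<^sup>n\<close> gives \<open>y\<^sub>n = f y\<^bsub>n+1\<^esub>\<close>, so the local ideals
  \<open>a + (y\<^sub>n)\<close> increase. Once they are stationary, \<open>y\<^bsub>n+1\<^esub>\<close> is a multiple of \<open>f y\<^bsub>n+1\<^esub>\<close>; since \<open>f \<in> P\<close>,
  it is locally zero, and so is \<open>m\<close>.\<close>

lemma krull_intersection_saturated:
  assumes P: "primeideal P R" and a: "ideal a R"
    and sat: "\<And>s x. s \<in> carrier R - P \<Longrightarrow> x \<in> carrier R \<Longrightarrow> s \<otimes> x \<in> a \<Longrightarrow> x \<in> a"
    and f: "f \<in> P" and reg: "\<And>x. x \<in> carrier R \<Longrightarrow> f \<otimes> x \<in> a \<Longrightarrow> x \<in> a"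
    and m: "\<And>n::nat. m \<in> prime_saturation R P (a <+> PIdl (f [^] n))"
  shows "m \<in> a"
proof -
  note acl = ideal_closed[OF a]
  note Pcl = ideal_closed[OF primeideal.axioms(1)[OF P]]
  have fc: "f \<in> carrier R" using f Pcl by blast
  have mc: "m \<in> carrier R" using m[of 0] by (simp add: prime_saturation_def)
  obtain s y where sy: "\<And>n::nat. s n \<in> carrier R - P" "\<And>n. y n \<in> carrier R"
    "\<And>n. s n \<otimes> m \<ominus> y n \<otimes> f [^] n \<in> a"
    using m[unfolded mem_saturation_add_principal[OF a nat_pow_closed[OF fc]]] by metis
  have s [simp]: "s n \<in> carrier R" and y [simp]: "y n \<in> carrier R" for n using sy by auto
  have regn: "x \<in> a" if "x \<in> carrier R" "f [^] n \<otimes> x \<in> a" for x and n :: nat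
    using that
  proof (induction n arbitrary: x)
    case (Suc n)
    have "f [^] n \<otimes> (f \<otimes> x) \<in> a" using Suc.prems fc by (simp add: m_assoc)
    then have "f \<otimes> x \<in> a" using Suc.IH[of "f \<otimes> x"] Suc.prems(1) fc by blast
    then show ?case using reg Suc.prems(1) by blast
  qed simp
  have step: "s (Suc n) \<otimes> y n \<ominus> s n \<otimes> f \<otimes> y (Suc n) \<in> a" for n
  proof (rule regn[of _ n])
    have "s n \<otimes> (s (Suc n) \<otimes> m \<ominus> y (Suc n) \<otimes> f [^] Suc n) \<ominus> s (Suc n) \<otimes> (s n \<otimes> m \<ominus> y n \<otimes> f [^] n) \<in> a"
      using sy(3)[of n] sy(3)[of "Suc n"] acl by simp
    moreover have "s n \<otimes> (s (Suc n) \<otimes> m \<ominus> y (Suc n) \<otimes> (g \<otimes> f)) \<ominus> s (Suc n) \<otimes> (s n \<otimes> m \<ominus> y n \<otimes> g)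
      = g \<otimes> (s (Suc n) \<otimes> y n \<ominus> s n \<otimes> f \<otimes> y (Suc n))" if "g \<in> carrier R" for g
      using that fc mc s[of n] s[of "Suc n"] y[of n] y[of "Suc n"] by algebra
    ultimately show "f [^] n \<otimes> (s (Suc n) \<otimes> y n \<ominus> s n \<otimes> f \<otimes> y (Suc n)) \<in> a"
      using fc by simp
  qed (use fc in simp)
  define Y where "Y n = prime_saturation R P (a <+> PIdl (y n))" for n
  note memY = mem_saturation_add_principal[OF a y, where P = P, folded Y_def]
  have Yid: "ideal (Y n) R" for n
    unfolding Y_def by (intro prime_saturation_ideal[OF P] add_ideals a cgenideal_ideal y)
  have "Y n \<subseteq> Y (Suc n)" for n
  proof
    fix x assume "x \<in> Y n"
    then obtain t r where x: "x \<in> carrier R" "t \<in> carrier R - P" "r \<in> carrier R" "t \<otimes> x \<ominus> r \<otimes> y n \<in> a"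
      unfolding memY by blast
    have t: "t \<in> carrier R" using x by auto
    have "s (Suc n) \<otimes> (t \<otimes> x \<ominus> r \<otimes> y n) \<oplus> r \<otimes> (s (Suc n) \<otimes> y n \<ominus> s n \<otimes> f \<otimes> y (Suc n))
       = s (Suc n) \<otimes> t \<otimes> x \<ominus> (r \<otimes> s n \<otimes> f) \<otimes> y (Suc n)"
      using t x(1,3) fc s[of n] s[of "Suc n"] y[of n] y[of "Suc n"] by algebra
    moreover have "s (Suc n) \<otimes> (t \<otimes> x \<ominus> r \<otimes> y n) \<oplus> r \<otimes> (s (Suc n) \<otimes> y n \<ominus> s n \<otimes> f \<otimes> y (Suc n)) \<in> a"
      using x(3,4) step[of n] acl by simp
    ultimately have "s (Suc n) \<otimes> t \<otimes> x \<ominus> (r \<otimes> s n \<otimes> f) \<otimes> y (Suc n) \<in> a" by simp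
    moreover have "r \<otimes> s n \<otimes> f \<in> carrier R" using x fc by simp
    ultimately show "x \<in> Y (Suc n)"
      using x(1) prime_complement_mult[OF P sy(1)[of "Suc n"] x(2)] unfolding memY by blast
  qed
  moreover obtain N where "\<And>n. Y N \<subseteq> Y n \<Longrightarrow> Y n = Y N"
  proof (rule maximal_ideal_in_family[of "range Y"])
    show "ideal L R" if "L \<in> range Y" for L using that Yid by auto
    fix L assume "L \<in> range Y" and max: "\<And>L'. L' \<in> range Y \<Longrightarrow> L \<subseteq> L' \<Longrightarrow> L' = L"
    then obtain n where "L = Y n" by blast
    then show thesis using max that[of n] by simp
  qed simp
  ultimately have stat: "Y (Suc N) = Y N" by simp
  have "y (Suc N) \<in> Y (Suc N)"
    unfolding memY using prime_complement_one[OF P] acl(2)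
    by (intro conjI bexI[of _ \<one>]) (auto simp: minus_eq r_neg)
  then obtain t r where x: "t \<in> carrier R - P" "r \<in> carrier R" "t \<otimes> y (Suc N) \<ominus> r \<otimes> y N \<in> a"
    unfolding stat memY by blast
  have t: "t \<in> carrier R" using x by auto
  have "s (Suc N) \<otimes> (t \<otimes> y (Suc N) \<ominus> r \<otimes> y N) \<oplus> r \<otimes> (s (Suc N) \<otimes> y N \<ominus> s N \<otimes> f \<otimes> y (Suc N))
     = (s (Suc N) \<otimes> t \<ominus> r \<otimes> s N \<otimes> f) \<otimes> y (Suc N)"
    using t x(2) fc s[of N] s[of "Suc N"] y[of N] y[of "Suc N"] by algebra
  moreover have "s (Suc N) \<otimes> (t \<otimes> y (Suc N) \<ominus> r \<otimes> y N) \<oplus> r \<otimes> (s (Suc N) \<otimes> y N \<ominus> s N \<otimes> f \<otimes> y (Suc N)) \<in> a"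
    using x(2,3) step[of N] acl by simp
  ultimately have *: "(s (Suc N) \<otimes> t \<ominus> r \<otimes> s N \<otimes> f) \<otimes> y (Suc N) \<in> a" by simp
  have "s (Suc N) \<otimes> t \<ominus> r \<otimes> s N \<otimes> f \<notin> P"
  proof
    assume "s (Suc N) \<otimes> t \<ominus> r \<otimes> s N \<otimes> f \<in> P"
    moreover have "r \<otimes> s N \<otimes> f \<in> P" using Pcl f x by simp
    ultimately have "(s (Suc N) \<otimes> t \<ominus> r \<otimes> s N \<otimes> f) \<oplus> r \<otimes> s N \<otimes> f \<in> P" using Pcl by simp
    moreover have "(s (Suc N) \<otimes> t \<ominus> r \<otimes> s N \<otimes> f) \<oplus> r \<otimes> s N \<otimes> f = s (Suc N) \<otimes> t"
      using t x(2) fc s[of N] s[of "Suc N"] by algebra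
    ultimately show False
      using prime_complement_mult[OF P sy(1)[of "Suc N"] x(1)] by simp
  qed
  then have "y (Suc N) \<in> a"
    using sat[OF _ _ *] t x(2) fc by simp
  then have "(s (Suc N) \<otimes> m \<ominus> y (Suc N) \<otimes> f [^] Suc N) \<oplus> y (Suc N) \<otimes> f [^] Suc N \<in> a"
    using sy(3)[of "Suc N"] acl(3,5) fc by simp
  moreover have "(s (Suc N) \<otimes> m \<ominus> y (Suc N) \<otimes> g) \<oplus> y (Suc N) \<otimes> g = s (Suc N) \<otimes> m" if "g \<in> carrier R" for g
    using that mc s[of "Suc N"] y[of "Suc N"] by algebra
  ultimately have "s (Suc N) \<otimes> m \<in> a" using fc nat_pow_closed by metis
  then show ?thesis using sat sy(1) mc by blast
qed

end

section \<open>Rational powers and rational symbolic powers\<close>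

context cring
begin

abbreviation ideal_pow :: "'a set \<Rightarrow> nat \<Rightarrow> 'a set"
  where "ideal_pow I n \<equiv> I [^]\<^bsub>ideals_set R\<^esub> n"

lemma ideal_pow_ideal:
  assumes "ideal I R" shows "ideal (ideal_pow I n) R"
proof -
  interpret M: comm_monoid "ideals_set R" by (rule ideals_set_is_comm_monoid)
  have "I \<in> carrier (ideals_set R)" using assms by (simp add: ideals_set_def)
  then have "ideal_pow I n \<in> carrier (ideals_set R)" by (rule M.nat_pow_closed)
  then show ?thesis by (simp add: ideals_set_def)
qed

lemma ideal_pow_add:
  assumes "ideal I R" shows "ideal_pow I (m + n) = ideal_pow I m \<cdot> ideal_pow I n"
proof -
  interpret M: comm_monoid "ideals_set R" by (rule ideals_set_is_comm_monoid)
  have "I \<in> carrier (ideals_set R)" using assms by (simp add: ideals_set_def)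
  from M.nat_pow_mult[OF this, of m n] show ?thesis by (simp add: ideals_set_def)
qed

lemma ideal_pow_pow:
  assumes "ideal I R" shows "ideal_pow (ideal_pow I m) n = ideal_pow I (m * n)"
proof -
  interpret M: comm_monoid "ideals_set R" by (rule ideals_set_is_comm_monoid)
  have "I \<in> carrier (ideals_set R)" using assms by (simp add: ideals_set_def)
  then show ?thesis by (rule M.nat_pow_pow)
qed

lemma ideal_pow_mult_mem:
  assumes "ideal I R" "a \<in> ideal_pow I m" "b \<in> ideal_pow I n"
  shows "a \<otimes> b \<in> ideal_pow I (m + n)"
  unfolding ideal_pow_add[OF assms(1)] by (rule ideal_prod.prod) (rule assms)+

lemma ideal_pow_antimono:
  assumes "ideal I R" "m \<le> n" shows "ideal_pow I n \<subseteq> ideal_pow I m"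
  using ideal_prod_inter[OF ideal_pow_ideal[OF assms(1), of m] ideal_pow_ideal[OF assms(1), of "n - m"]]
    ideal_pow_add[OF assms(1), of m "n - m"] assms(2) by auto

lemma ideal_finsum_closed:
  assumes I: "ideal I R" and "finite S" "\<And>i. i \<in> S \<Longrightarrow> g i \<in> I"
  shows "(\<Oplus>i\<in>S. g i) \<in> I"
  using assms(2,3)
proof (induction S rule: finite_induct)
  case (insert x S)
  have "g \<in> S \<rightarrow> carrier R" "g x \<in> carrier R" using insert.prems ideal_closed(1)[OF I] by auto
  then show ?case using insert ideal_closed(3)[OF I] by (simp add: finsum_insert)
qed (simp add: ideal_closed(2)[OF I])

text \<open>An equation of integral dependence of degree \<open>n\<close> trades powers of \<open>f\<close> for powers of \<open>L\<close> with a
  bounded loss in the exponent: substitute it repeatedly into \<open>f\<^bsup>n+k\<^esup>\<close>.\<close>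

lemma integral_closure_high_powers:
  assumes L: "ideal L R" and f: "f \<in> integral_closure R L"
  obtains n where "\<And>k. f [^] (n + k :: nat) \<in> ideal_pow L (Suc k)"
proof -
  obtain n c where fc: "f \<in> carrier R" and c: "\<And>i. i \<in> {1..n} \<Longrightarrow> c i \<in> ideal_pow L i"
    and eq: "f [^] n \<oplus> (\<Oplus>i\<in>{1..n}. c i \<otimes> f [^] (n - i)) = \<zero>"
    using f unfolding integral_closure_def by blast
  have cc: "c i \<in> carrier R" if "i \<in> {1..n}" for i
    using c[OF that] ideal_closed(1)[OF ideal_pow_ideal[OF L]] by blast
  have mem: "(\<lambda>i. c i \<otimes> f [^] (n - i)) \<in> {1..n} \<rightarrow> carrier R" using cc fc by auto
  have "f [^] (n + k) \<in> ideal_pow L (Suc k)" for k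
  proof (induction k rule: less_induct)
    case (less k)
    note Lk = ideal_closed[OF ideal_pow_ideal[OF L, of "Suc k"]]
    have "(c i \<otimes> f [^] (n - i)) \<otimes> f [^] k \<in> ideal_pow L (Suc k)" if i: "i \<in> {1..n}" for i
    proof (cases "i \<le> k")
      case True
      have "n - i + k = n + (k - i)" using True i by auto
      then have "(c i \<otimes> f [^] (n - i)) \<otimes> f [^] k = c i \<otimes> f [^] (n + (k - i))"
        using cc[OF i] fc by (simp add: m_assoc nat_pow_mult)
      moreover have "f [^] (n + (k - i)) \<in> ideal_pow L (Suc (k - i))"
        by (rule less) (use i True in auto)
      moreover have "i + Suc (k - i) = Suc k" using True by simp
      ultimately show ?thesis using ideal_pow_mult_mem[OF L c[OF i], of _ "Suc (k - i)"] by auto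
    next
      case False
      then have "c i \<in> ideal_pow L (Suc k)" using ideal_pow_antimono[OF L, of "Suc k" i] c[OF i] by auto
      then show ?thesis using Lk(5) fc by simp
    qed
    then have "(\<Oplus>i\<in>{1..n}. (c i \<otimes> f [^] (n - i)) \<otimes> f [^] k) \<in> ideal_pow L (Suc k)"
      by (intro ideal_finsum_closed[OF ideal_pow_ideal[OF L]]) auto
    then have *: "(\<Oplus>i\<in>{1..n}. c i \<otimes> f [^] (n - i)) \<otimes> f [^] k \<in> ideal_pow L (Suc k)"
      using mem fc by (simp add: finsum_ldistr)
    define s where "s = (\<Oplus>i\<in>{1..n}. c i \<otimes> f [^] (n - i))"
    have s: "s \<in> carrier R" unfolding s_def using mem by (rule finsum_closed)
    have "f [^] (n + k) \<oplus> s \<otimes> f [^] k = (f [^] n \<oplus> s) \<otimes> f [^] k"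
      using fc s by (simp add: l_distr nat_pow_mult)
    also have "\<dots> = \<zero>" using eq fc by (simp add: s_def)
    finally have "f [^] (n + k) \<oplus> s \<otimes> f [^] k \<in> ideal_pow L (Suc k)" using Lk(2) by simp
    then show ?case
      using ideal_add_cancel[OF ideal_pow_ideal[OF L] _ *[folded s_def]] fc by simp
  qed
  then show ?thesis using that by blast
qed

text \<open>The converse trade: \<open>f\<close> is a root of \<open>Y\<^sup>N - f\<^sup>N\<close>, whose constant term lies in \<open>L\<^sup>N\<close>.\<close>

lemma integral_closure_of_power:
  assumes L: "ideal L R" and f: "f \<in> carrier R" "0 < N" "f [^] N \<in> ideal_pow L N"
  shows "f \<in> integral_closure R L"
proof -
  let ?c = "\<lambda>i. if N = i then \<ominus> (f [^] N) else \<zero>"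
  have "(\<Oplus>i\<in>{1..N}. ?c i \<otimes> f [^] (N - i)) = (\<Oplus>i\<in>{1..N}. if N = i then \<ominus> (f [^] N) \<otimes> f [^] (N - i) else \<zero>)"
    using f(1) by (intro finsum_cong') auto
  also have "\<dots> = \<ominus> (f [^] N) \<otimes> f [^] (N - N)"
    using f by (intro add.finprod_singleton) auto
  finally have "f [^] N \<oplus> (\<Oplus>i\<in>{1..N}. ?c i \<otimes> f [^] (N - i)) = \<zero>"
    using f(1) by (simp add: r_neg)
  moreover have "?c i \<in> ideal_pow L i" for i
    using ideal_closed[OF ideal_pow_ideal[OF L, of i]] f(3) by auto
  ultimately show ?thesis
    unfolding integral_closure_def using f(1,2)
    by (intro CollectI conjI exI[of _ N] exI[of _ ?c] ballI) simp_all
qed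

lemma rational_power_positive:
  assumes "0 < u"
  obtains p q :: nat where "0 < q" "u = of_nat p / of_nat q"
    "rational_power R I u = {f \<in> carrier R. f [^] q \<in> integral_closure R (ideal_pow I p)}"
proof -
  obtain a b where ab: "quotient_of u = (a, b)" by fastforce
  have "0 < b" "u = of_int a / of_int b"
    using quotient_of_denom_pos[OF ab] quotient_of_div[OF ab] by auto
  moreover from this have "0 < a" using assms by (simp add: zero_less_divide_iff)
  ultimately show ?thesis
    using assms ab by (intro that[of "nat b" "nat a"]) (auto simp: rational_power_def)
qed

lemma rational_power_subset: "rational_power R I u \<subseteq> carrier R"
  by (auto simp: rational_power_def Let_def)

text \<open>For \<open>w < w'\<close> the loss in \<open>integral_closure_high_powers\<close> is constant, while the gap between the
  exponents grows with the power taken; a high enough power of \<open>f\<close> therefore satisfies the pure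
  equation \<open>Y\<^sup>N = c\<close> needed for the exponent \<open>w\<close>.\<close>

lemma rational_power_antimono:
  assumes I: "ideal I R" and w: "0 \<le> w" "w \<le> w'"
  shows "rational_power R I w' \<subseteq> rational_power R I w"
proof (cases "w = 0 \<or> w = w'")
  case True
  then show ?thesis using rational_power_subset by (auto simp: rational_power_def)
next
  case False
  then have w: "0 < w" "w < w'" "0 < w'" using w by auto
  obtain p q where pq: "0 < q" "w = of_nat p / of_nat q"
    "rational_power R I w = {f \<in> carrier R. f [^] q \<in> integral_closure R (ideal_pow I p)}"
    by (rule rational_power_positive[OF w(1)])
  obtain p' q' where pq': "0 < q'" "w' = of_nat p' / of_nat q'"
    "rational_power R I w' = {f \<in> carrier R. f [^] q' \<in> integral_closure R (ideal_pow I p')}"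
    by (rule rational_power_positive[OF w(3)])
  have "of_nat p / of_nat q < (of_nat p' / of_nat q' :: rat)" using w(2) pq(2) pq'(2) by simp
  then have "(of_nat p * of_nat q' :: rat) < of_nat p' * of_nat q"
    using pq(1) pq'(1) by (simp add: field_simps)
  then have "(of_nat (p * q') :: rat) < of_nat (p' * q)" unfolding of_nat_mult .
  then have gap: "p * q' + 1 \<le> p' * q" unfolding of_nat_less_iff by simp
  show ?thesis
  proof
    fix f assume "f \<in> rational_power R I w'"
    then have f: "f \<in> carrier R" "f [^] q' \<in> integral_closure R (ideal_pow I p')"
      using pq'(3) by auto
    obtain n where n: "\<And>k. (f [^] q') [^] (n + k) \<in> ideal_pow (ideal_pow I p') (Suc k)"
      using integral_closure_high_powers[OF ideal_pow_ideal[OF I] f(2)] by metis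
    \<comment> \<open>The gap contributes at least \<open>r\<close> to the exponent and the loss costs at most \<open>p' n\<close>;
      the summand \<open>n + 1\<close> makes \<open>q r\<close> at least \<open>n\<close> and \<open>r\<close> positive.\<close>
    define r where "r = p' * n + n + 1"
    define k where "k = q * r - n"
    have "1 * r \<le> q * r" by (rule mult_le_mono1) (use pq(1) in simp)
    then have "n \<le> q * r" by (simp add: r_def)
    then have k: "n + k = q * r" by (simp add: k_def)
    have "(p * q' + 1) * r \<le> (p' * q) * r" using gap by (rule mult_le_mono1)
    then have "p * (q' * r) + r \<le> p' * n + p' * k"
      using k by (simp add: add_mult_distrib mult.assoc flip: add_mult_distrib2)
    moreover have "p' * n \<le> r" by (simp add: r_def)
    ultimately have le: "p * (q' * r) \<le> p' * Suc k" by simp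
    have "(f [^] q) [^] (q' * r) = (f [^] q') [^] (n + k)"
      using f(1) by (simp add: nat_pow_pow k) (simp add: mult_ac)
    also have "\<dots> \<in> ideal_pow I (p' * Suc k)" using n[of k] unfolding ideal_pow_pow[OF I] .
    also have "ideal_pow I (p' * Suc k) \<subseteq> ideal_pow (ideal_pow I p) (q' * r)"
      using ideal_pow_antimono[OF I le] unfolding ideal_pow_pow[OF I] .
    finally have "f [^] q \<in> integral_closure R (ideal_pow I p)"
      using f(1) pq'(1) by (intro integral_closure_of_power[OF ideal_pow_ideal[OF I]]) (auto simp: r_def)
    then show "f \<in> rational_power R I w" using pq(3) f(1) by simp
  qed
qed

text \<open>The formula also covers \<open>u = 0\<close>, where every saturation is the whole ring.\<close>

lemma rational_symbolic_power_eq: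
  assumes I: "ideal I R"
  shows "rational_symbolic_power R I u = {f \<in> carrier R.
    \<forall>P\<in>associated_primes R (quot_module R I). f \<in> prime_saturation R P (Idl (rational_power R I u))}"
proof -
  have prime: "primeideal P R" if "P \<in> associated_primes R (quot_module R I)" for P
    using that by (simp add: associated_primes_def)
  have *: "ideal_contr R (localize_map R P)
      (ideal_ext (localize_prime R P) (localize_map R P) (rational_power R I u))
    = prime_saturation R P (Idl (rational_power R I u))"
    if "P \<in> associated_primes R (quot_module R I)" for P
    by (rule contr_ext_localization[OF prime[OF that] rational_power_subset])
  show ?thesis
  proof (cases "u = 0")
    case True
    have "Idl (carrier R) = carrier R"
      using genideal_self[of "carrier R"] ideal_closed(1)[OF genideal_ideal[of "carrier R"]] by auto
    moreover have "prime_saturation R P (carrier R) = carrier R"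
      if "P \<in> associated_primes R (quot_module R I)" for P
      using subset_prime_saturation[OF prime[OF that] oneideal] by (auto simp: prime_saturation_def)
    ultimately show ?thesis
      using True by (auto simp: rational_symbolic_power_def rational_power_def)
  next
    case False
    then show ?thesis by (auto simp: rational_symbolic_power_def *)
  qed
qed

lemma rational_symbolic_power_ideal:
  assumes I: "ideal I R" shows "ideal (rational_symbolic_power R I u) R"
proof -
  let ?S = "\<lambda>P. prime_saturation R P (Idl (rational_power R I u))"
  have S: "ideal (?S P) R" if "P \<in> associated_primes R (quot_module R I)" for P
    using that prime_saturation_ideal[OF _ genideal_ideal[OF rational_power_subset]]
    by (simp add: associated_primes_def)
  show ?thesis
    unfolding rational_symbolic_power_eq[OF I]
    by (rule ideal_by_closure) (use ideal_closed(2-4)[OF S] in auto)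
qed

lemma rational_power_subset_symbolic:
  assumes I: "ideal I R" shows "rational_power R I u \<subseteq> rational_symbolic_power R I u"
proof
  fix f assume f: "f \<in> rational_power R I u"
  have "f \<in> prime_saturation R P (Idl (rational_power R I u))"
    if "P \<in> associated_primes R (quot_module R I)" for P
    using that f subset_prime_saturation[OF _ genideal_ideal[OF rational_power_subset]]
      genideal_self[OF rational_power_subset, of I u]
    by (fastforce simp: associated_primes_def)
  then show "f \<in> rational_symbolic_power R I u"
    unfolding rational_symbolic_power_eq[OF I] using f rational_power_subset[of I u] by blast
qed

lemma rational_symbolic_power_antimono:
  assumes I: "ideal I R" and w: "0 \<le> w" "w \<le> w'"
  shows "rational_symbolic_power R I w' \<subseteq> rational_symbolic_power R I w"
proof -
  have "Idl (rational_power R I w') \<subseteq> Idl (rational_power R I w)"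
    by (rule subset_Idl_subset[OF rational_power_subset rational_power_antimono[OF I w]])
  then show ?thesis
    unfolding rational_symbolic_power_eq[OF I] prime_saturation_def by blast
qed

text \<open>Saturating twice at the same prime changes nothing, so a symbolic power is the intersection of its
  own saturations at the associated primes. This is what allows regularity modulo symbolic powers to
  be checked one associated prime at a time.\<close>

lemma rational_symbolic_power_saturated:
  assumes I: "ideal I R" and f: "f \<in> carrier R"
    and "\<And>P. P \<in> associated_primes R (quot_module R I)
      \<Longrightarrow> f \<in> prime_saturation R P (rational_symbolic_power R I u)"
  shows "f \<in> rational_symbolic_power R I u"
  unfolding rational_symbolic_power_eq[OF I]
proof (intro CollectI conjI ballI f)
  fix P assume P: "P \<in> associated_primes R (quot_module R I)"
  obtain s where s: "s \<in> carrier R - P" "s \<otimes> f \<in> rational_symbolic_power R I u"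
    using assms(3)[OF P] by (auto simp: prime_saturation_def)
  then have "s \<otimes> f \<in> prime_saturation R P (Idl (rational_power R I u))"
    using P unfolding rational_symbolic_power_eq[OF I] by blast
  then show "f \<in> prime_saturation R P (Idl (rational_power R I u))"
    using prime_saturation_saturated[OF _ f s(1)] P by (simp add: associated_primes_def)
qed

end

section \<open>Additive spans\<close>

text \<open>Summands are added one at a time, so that induction on membership peels off a single generator.\<close>

inductive_set additive_span :: "('r, 'm) ring_scheme \<Rightarrow> 'r set \<Rightarrow> 'r set" for R S
  where
    zero: "\<zero>\<^bsub>R\<^esub> \<in> additive_span R S"
  | add: "s \<in> S \<Longrightarrow> x \<in> additive_span R S \<Longrightarrow> s \<oplus>\<^bsub>R\<^esub> x \<in> additive_span R S"

lemma additive_span_least: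
  assumes "\<zero>\<^bsub>R\<^esub> \<in> T" "S \<subseteq> T" "\<And>x y. x \<in> T \<Longrightarrow> y \<in> T \<Longrightarrow> x \<oplus>\<^bsub>R\<^esub> y \<in> T"
  shows "additive_span R S \<subseteq> T"
proof
  fix x assume "x \<in> additive_span R S"
  then show "x \<in> T" by induction (use assms in auto)
qed

lemma additive_span_mono: "S \<subseteq> T \<Longrightarrow> additive_span R S \<subseteq> additive_span R T"
proof
  fix x assume "S \<subseteq> T" "x \<in> additive_span R S"
  from this(2) show "x \<in> additive_span R T"
    by induction (use \<open>S \<subseteq> T\<close> in \<open>auto intro: additive_span.intros\<close>)
qed

context cring
begin

lemma additive_span_closed: "S \<subseteq> carrier R \<Longrightarrow> additive_span R S \<subseteq> carrier R"
  by (rule additive_span_least) auto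

lemma additive_span_superset: "S \<subseteq> carrier R \<Longrightarrow> S \<subseteq> additive_span R S"
  using additive_span.add[OF _ additive_span.zero, of _ S R] by fastforce

lemma additive_span_add:
  assumes S: "S \<subseteq> carrier R" and "x \<in> additive_span R S" and y: "y \<in> additive_span R S"
  shows "x \<oplus> y \<in> additive_span R S"
  using assms(2)
proof induction
  case (add s x)
  then have "x \<in> carrier R" "s \<in> carrier R" "y \<in> carrier R"
    using S y additive_span_closed[OF S] by auto
  then show ?case using additive_span.add[OF add(1,3)] by (simp add: a_assoc)
qed (use y additive_span_closed[OF S] in auto)

lemma additive_span_ideal:
  assumes S: "S \<subseteq> carrier R" and G: "G \<subseteq> carrier R" "carrier R \<subseteq> additive_span R G"
    and mult: "\<And>g s. g \<in> G \<Longrightarrow> s \<in> S \<Longrightarrow> g \<otimes> s \<in> S"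
  shows "ideal (additive_span R S) R"
proof (rule ideal_by_closure)
  note cl = additive_span_closed[OF S]
  fix r x assume r: "r \<in> carrier R" and x: "x \<in> additive_span R S"
  have g: "g \<otimes> x \<in> additive_span R S" if g: "g \<in> G" for g
    using x
  proof induction
    case (add s x)
    have "s \<in> carrier R" "x \<in> carrier R" "g \<in> carrier R" using add S G g cl by auto
    then show ?case using additive_span.add[OF mult[OF g add(1)] add(3)] by (simp add: r_distr)
  next
    case zero
    have "g \<otimes> \<zero> = \<zero>" using g G by auto
    then show ?case by (simp add: additive_span.zero)
  qed
  have "r \<in> additive_span R G" using r G by blast
  then show "r \<otimes> x \<in> additive_span R S"
  proof induction
    case zero
    show ?case using x cl additive_span.zero[of R S] by (metis l_null subsetD)
  next
    case (add s r)
    have "s \<in> carrier R" "x \<in> carrier R" "r \<in> carrier R"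
      using add G x cl additive_span_closed[OF G(1)] by auto
    then show ?case using additive_span_add[OF S g[OF add(1)] add(3)] by (simp add: l_distr)
  qed
qed (use additive_span_closed[OF S] additive_span_add[OF S] in \<open>auto intro: additive_span.zero\<close>)

end

lemma (in module) submodule_adjoin:
  assumes c: "submodule c R M" and n: "n \<in> carrier M"
  shows "submodule {w \<oplus>\<^bsub>M\<^esub> k \<odot>\<^bsub>M\<^esub> n | w k. w \<in> c \<and> k \<in> carrier R} R M" (is "submodule ?c R M")
proof -
  note cl = submoduleE[OF c]
  have sub: "w \<in> carrier M" if "w \<in> c" for w using cl(1) that by auto
  have z: "\<zero>\<^bsub>M\<^esub> \<in> c" using subgroup.one_closed[OF submodule.axioms(1)[OF c]] by simp
  show ?thesis
  proof (rule submoduleI)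
    show "?c \<subseteq> carrier M" using sub n by auto
    show "\<zero>\<^bsub>M\<^esub> \<in> ?c"
      using z n by (intro CollectI exI[of _ "\<zero>\<^bsub>M\<^esub>"] exI[of _ "\<zero>\<^bsub>R\<^esub>"]) auto
    fix x assume "x \<in> ?c"
    then obtain w k where x: "x = w \<oplus>\<^bsub>M\<^esub> k \<odot>\<^bsub>M\<^esub> n" "w \<in> c" "k \<in> carrier R" by blast
    have "\<ominus>\<^bsub>M\<^esub> x = \<ominus>\<^bsub>M\<^esub> w \<oplus>\<^bsub>M\<^esub> (\<ominus>\<^bsub>R\<^esub> k) \<odot>\<^bsub>M\<^esub> n"
      using x sub n by (simp add: M.minus_add smult_l_minus)
    then show "\<ominus>\<^bsub>M\<^esub> x \<in> ?c" using x cl(3) by (auto intro!: exI[of _ "\<ominus>\<^bsub>M\<^esub> w"] exI[of _ "\<ominus>\<^bsub>R\<^esub> k"])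
    show "r \<odot>\<^bsub>M\<^esub> x \<in> ?c" if r: "r \<in> carrier R" for r
    proof -
      have "r \<odot>\<^bsub>M\<^esub> x = r \<odot>\<^bsub>M\<^esub> w \<oplus>\<^bsub>M\<^esub> (r \<otimes>\<^bsub>R\<^esub> k) \<odot>\<^bsub>M\<^esub> n"
        using x sub n r by (simp add: smult_r_distr smult_assoc1)
      then show ?thesis
        using x r cl(4) by (auto intro!: exI[of _ "r \<odot>\<^bsub>M\<^esub> w"] exI[of _ "r \<otimes>\<^bsub>R\<^esub> k"])
    qed
    show "x \<oplus>\<^bsub>M\<^esub> y \<in> ?c" if y: "y \<in> ?c" for y
    proof -
      obtain w' k' where y: "y = w' \<oplus>\<^bsub>M\<^esub> k' \<odot>\<^bsub>M\<^esub> n" "w' \<in> c" "k' \<in> carrier R" using y by blast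
      have "x \<oplus>\<^bsub>M\<^esub> y = (w \<oplus>\<^bsub>M\<^esub> w') \<oplus>\<^bsub>M\<^esub> (k \<oplus>\<^bsub>R\<^esub> k') \<odot>\<^bsub>M\<^esub> n"
        using x y sub n by (simp add: smult_l_distr M.a_ac)
      then show ?thesis
        using x y cl(5) by (auto intro!: exI[of _ "w \<oplus>\<^bsub>M\<^esub> w'"] exI[of _ "k \<oplus>\<^bsub>R\<^esub> k'"])
    qed
  qed
qed

section \<open>Tensor products through their slice maps\<close>

text \<open>The \<open>A\<close>-linear maps \<open>R \<rightarrow> A\<close> that vanish on the image of \<open>W\<close>. For \<open>R = A \<otimes> B\<close> they include the maps
  \<open>id \<otimes> \<phi>\<close> with \<open>\<phi>\<close> a linear functional on \<open>B\<close> that vanishes on \<open>W\<close>.\<close>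

definition slices ::
  "('a, 'm) ring_scheme \<Rightarrow> ('r, 'n) ring_scheme \<Rightarrow> ('a \<Rightarrow> 'r) \<Rightarrow> ('b \<Rightarrow> 'r) \<Rightarrow> 'b set \<Rightarrow> ('r \<Rightarrow> 'a) set"
  where "slices A R f g W = {\<sigma>.
    (\<forall>x\<in>carrier R. \<sigma> x \<in> carrier A) \<and>
    (\<forall>x\<in>carrier R. \<forall>y\<in>carrier R. \<sigma> (x \<oplus>\<^bsub>R\<^esub> y) = \<sigma> x \<oplus>\<^bsub>A\<^esub> \<sigma> y) \<and>
    (\<forall>a\<in>carrier A. \<forall>x\<in>carrier R. \<sigma> (f a \<otimes>\<^bsub>R\<^esub> x) = a \<otimes>\<^bsub>A\<^esub> \<sigma> x) \<and>
    (\<forall>w\<in>W. \<sigma> (g w) = \<zero>\<^bsub>A\<^esub>)}"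

definition elementary_tensors ::
  "('r, 'n) ring_scheme \<Rightarrow> ('a \<Rightarrow> 'r) \<Rightarrow> ('b \<Rightarrow> 'r) \<Rightarrow> 'a set \<Rightarrow> 'b set \<Rightarrow> 'r set"
  where "elementary_tensors R f g U V = {f m \<otimes>\<^bsub>R\<^esub> g n | m n. m \<in> U \<and> n \<in> V}"

text \<open>What the proof needs to know about \<open>A \<otimes>\<^sub>K B\<close>: it is spanned by the products of the two factors, and
  for each factor the slices separate a subspace from a vector outside it. The conditions are symmetric in
  the two factors, so that every statement about the left factor can be transferred to the right one
  through \<open>swapped\<close>.\<close>

locale tensor_frame =
  fixes K :: "('k, 'l) ring_scheme" and A :: "('k, 'a, 'm) module_scheme"
    and B :: "('k, 'b, 'n) module_scheme" and R :: "('r, 'o) ring_scheme" (structure)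
    and inl :: "'a \<Rightarrow> 'r" and inr :: "'b \<Rightarrow> 'r"
  assumes algebra_left: "algebra K A" and algebra_right: "algebra K B" and cring_R: "cring R"
    and inl_hom: "inl \<in> ring_hom A R" and inr_hom: "inr \<in> ring_hom B R"
    and balanced: "k \<in> carrier K \<Longrightarrow> inl (k \<odot>\<^bsub>A\<^esub> \<one>\<^bsub>A\<^esub>) = inr (k \<odot>\<^bsub>B\<^esub> \<one>\<^bsub>B\<^esub>)"
    and spanned: "carrier R \<subseteq> additive_span R (elementary_tensors R inl inr (carrier A) (carrier B))"
    and separated_right: "submodule W K B \<Longrightarrow> n \<in> carrier B - W
      \<Longrightarrow> \<exists>\<sigma>\<in>slices A R inl inr W. \<sigma> (inr n) = \<one>\<^bsub>A\<^esub>"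
    and separated_left: "submodule V K A \<Longrightarrow> m \<in> carrier A - V
      \<Longrightarrow> \<exists>\<sigma>\<in>slices B R inr inl V. \<sigma> (inl m) = \<one>\<^bsub>B\<^esub>"
begin

sublocale R: cring R by (rule cring_R)
sublocale A: cring A using algebra_left by (simp add: algebra_def)
sublocale B: cring B using algebra_right by (simp add: algebra_def)
sublocale l: ring_hom_cring A R inl by unfold_locales (rule inl_hom)
sublocale r: ring_hom_cring B R inr by unfold_locales (rule inr_hom)

lemma elementary_tensors_swap:
  assumes "U \<subseteq> carrier A" "V \<subseteq> carrier B"
  shows "elementary_tensors R inr inl V U = elementary_tensors R inl inr U V"
proof -
  have *: "inr n \<otimes> inl m = inl m \<otimes> inr n" if "m \<in> U" "n \<in> V" for m n
    using that assms by (intro R.m_comm) auto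
  show ?thesis
  proof (intro equalityI subsetI)
    fix x assume "x \<in> elementary_tensors R inr inl V U"
    then obtain m n where "x = inr n \<otimes> inl m" "m \<in> U" "n \<in> V" unfolding elementary_tensors_def by blast
    then show "x \<in> elementary_tensors R inl inr U V"
      unfolding elementary_tensors_def using *[of m n] by (intro CollectI exI[of _ m] exI[of _ n]) simp
  next
    fix x assume "x \<in> elementary_tensors R inl inr U V"
    then obtain m n where "x = inl m \<otimes> inr n" "m \<in> U" "n \<in> V" unfolding elementary_tensors_def by blast
    then show "x \<in> elementary_tensors R inr inl V U"
      unfolding elementary_tensors_def using *[of m n] by (intro CollectI exI[of _ n] exI[of _ m]) simp
  qed
qed

lemma swapped: "tensor_frame K B A R inr inl"
proof (rule tensor_frame.intro)
  show "carrier R \<subseteq> additive_span R (elementary_tensors R inr inl (carrier B) (carrier A))"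
    using spanned by (simp add: elementary_tensors_swap)
qed (fact algebra_left algebra_right cring_R inl_hom inr_hom balanced[symmetric] separated_left separated_right)+

abbreviation tensors :: "'a set \<Rightarrow> 'b set \<Rightarrow> 'r set" where "tensors \<equiv> elementary_tensors R inl inr"

abbreviation right_slices :: "'b set \<Rightarrow> ('r \<Rightarrow> 'a) set" where "right_slices \<equiv> slices A R inl inr"

lemma tensors_closed: "U \<subseteq> carrier A \<Longrightarrow> V \<subseteq> carrier B \<Longrightarrow> tensors U V \<subseteq> carrier R"
  by (auto simp: elementary_tensors_def subset_iff)

lemma tensors_mem: "m \<in> U \<Longrightarrow> n \<in> V \<Longrightarrow> inl m \<otimes> inr n \<in> tensors U V"
  by (auto simp: elementary_tensors_def)

lemma slice_zero:
  assumes "\<sigma> \<in> right_slices W" shows "\<sigma> \<zero> = \<zero>\<^bsub>A\<^esub>"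
proof -
  have "\<sigma> \<zero> \<in> carrier A" and "\<sigma> (inl \<zero>\<^bsub>A\<^esub> \<otimes> \<zero>) = \<zero>\<^bsub>A\<^esub> \<otimes>\<^bsub>A\<^esub> \<sigma> \<zero>"
    using assms R.zero_closed A.zero_closed unfolding slices_def by blast+
  then show ?thesis by simp
qed

lemma slice_closed: "\<sigma> \<in> right_slices W \<Longrightarrow> x \<in> carrier R \<Longrightarrow> \<sigma> x \<in> carrier A"
  by (simp add: slices_def)

lemma slice_add:
  "\<sigma> \<in> right_slices W \<Longrightarrow> x \<in> carrier R \<Longrightarrow> y \<in> carrier R \<Longrightarrow> \<sigma> (x \<oplus> y) = \<sigma> x \<oplus>\<^bsub>A\<^esub> \<sigma> y"
  by (simp add: slices_def)

lemma slice_linear: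
  "\<sigma> \<in> right_slices W \<Longrightarrow> a \<in> carrier A \<Longrightarrow> x \<in> carrier R \<Longrightarrow> \<sigma> (inl a \<otimes> x) = a \<otimes>\<^bsub>A\<^esub> \<sigma> x"
  by (simp add: slices_def)

lemma slice_kills: "\<sigma> \<in> right_slices W \<Longrightarrow> w \<in> W \<Longrightarrow> \<sigma> (inr w) = \<zero>\<^bsub>A\<^esub>"
  by (simp add: slices_def)

lemma slice_tensors:
  assumes "\<sigma> \<in> right_slices W" "U \<subseteq> carrier A" "ideal a A" "U \<subseteq> a \<or> V \<subseteq> W" "V \<subseteq> carrier B"
    and "x \<in> tensors U V"
  shows "\<sigma> x \<in> a"
proof -
  obtain m n where x: "x = inl m \<otimes> inr n" "m \<in> U" "n \<in> V" using assms(6) by (auto simp: elementary_tensors_def)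
  then have mn: "m \<in> carrier A" "n \<in> carrier B" using assms by auto
  then have eq: "\<sigma> x = m \<otimes>\<^bsub>A\<^esub> \<sigma> (inr n)" using x slice_linear[OF assms(1)] by simp
  show ?thesis
  proof (cases "U \<subseteq> a")
    case True
    then show ?thesis
      using eq mn x(2) A.ideal_closed(5)[OF assms(3), of m "\<sigma> (inr n)"] slice_closed[OF assms(1)] by auto
  next
    case False
    then have "\<sigma> (inr n) = \<zero>\<^bsub>A\<^esub>" using assms(4) x(3) slice_kills[OF assms(1)] by auto
    then show ?thesis using eq mn A.ideal_closed(2)[OF assms(3)] by simp
  qed
qed

lemma slice_span:
  assumes \<sigma>: "\<sigma> \<in> right_slices W" and S: "S \<subseteq> carrier R" and a: "ideal a A"
    and "\<And>s. s \<in> S \<Longrightarrow> \<sigma> s \<in> a" and "x \<in> additive_span R S"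
  shows "\<sigma> x \<in> a"
  using assms(5)
proof induction
  case (add s x)
  then have "s \<in> carrier R" "x \<in> carrier R" using S R.additive_span_closed[OF S] by auto
  then show ?case using add assms(4) slice_add[OF \<sigma>] A.ideal_closed(3)[OF a] by simp
qed (simp add: slice_zero[OF \<sigma>] A.ideal_closed(2)[OF a])

lemma ideal_submodule:
  assumes c: "ideal c B" shows "submodule c K B"
proof -
  interpret KB: algebra K B by (rule algebra_right)
  note cl = B.ideal_closed[OF c]
  show ?thesis
  proof (rule KB.submoduleI)
    fix k x assume k: "k \<in> carrier K" and x: "x \<in> c"
    then have "k \<odot>\<^bsub>B\<^esub> x = (k \<odot>\<^bsub>B\<^esub> \<one>\<^bsub>B\<^esub>) \<otimes>\<^bsub>B\<^esub> x"
      using cl(1) KB.smult_assoc2[of k "\<one>\<^bsub>B\<^esub>" x] by auto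
    then show "k \<odot>\<^bsub>B\<^esub> x \<in> c" using cl(4) k x by simp
  qed (use cl in auto)
qed

lemma scalar_across:
  assumes "k \<in> carrier K" "m \<in> carrier A" "n \<in> carrier B"
  shows "inl m \<otimes> inr (k \<odot>\<^bsub>B\<^esub> n) = inl (k \<odot>\<^bsub>A\<^esub> m) \<otimes> inr n"
proof -
  interpret KA: algebra K A by (rule algebra_left)
  interpret KB: algebra K B by (rule algebra_right)
  have "k \<odot>\<^bsub>B\<^esub> n = (k \<odot>\<^bsub>B\<^esub> \<one>\<^bsub>B\<^esub>) \<otimes>\<^bsub>B\<^esub> n" "k \<odot>\<^bsub>A\<^esub> m = (k \<odot>\<^bsub>A\<^esub> \<one>\<^bsub>A\<^esub>) \<otimes>\<^bsub>A\<^esub> m"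
    using assms KA.smult_assoc2[of k "\<one>\<^bsub>A\<^esub>" m] KB.smult_assoc2[of k "\<one>\<^bsub>B\<^esub>" n] by simp_all
  then have "inr (k \<odot>\<^bsub>B\<^esub> n) = inr (k \<odot>\<^bsub>B\<^esub> \<one>\<^bsub>B\<^esub>) \<otimes> inr n"
    "inl (k \<odot>\<^bsub>A\<^esub> m) = inl (k \<odot>\<^bsub>A\<^esub> \<one>\<^bsub>A\<^esub>) \<otimes> inl m"
    using assms by simp_all
  then show ?thesis using assms balanced[OF assms(1)] by (simp add: R.m_ac)
qed

text \<open>Induction on the number of tensors in \<open>x\<close>. Let \<open>m \<otimes> n\<close> be the first one. If \<open>n \<in> c\<close>, no slice
  sees it. Otherwise adjoin the line of \<open>n\<close> to \<open>c\<close>: the induction hypothesis puts the remaining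
  sum into the span for this larger subspace, so that \<open>x\<close> is an element of the desired span plus one
  tensor \<open>v \<otimes> n\<close>. The slice that takes \<open>n\<close> to \<open>1\<close> and vanishes on \<open>c\<close> shows \<open>v \<in> a\<close>. Keeping track
  of the ideal \<open>U\<close> of left factors gives the exactness statement
  \<open>U \<otimes> B \<inter> (a \<otimes> B + A \<otimes> c) = (a \<inter> U) \<otimes> B + U \<otimes> c\<close>.\<close>

lemma span_by_slices:
  assumes U: "ideal U A" and a: "ideal a A" and c: "submodule c K B"
    and x: "x \<in> additive_span R (tensors U (carrier B))"
    and sl: "\<And>\<sigma>. \<sigma> \<in> right_slices c \<Longrightarrow> \<sigma> x \<in> a"
  shows "x \<in> additive_span R (tensors (a \<inter> U) (carrier B) \<union> tensors U c)"
  using x c sl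
proof (induction arbitrary: c)
  case (add s x)
  interpret KA: algebra K A by (rule algebra_left)
  interpret KB: algebra K B by (rule algebra_right)
  note Ucl = A.ideal_closed[OF U] and acl = A.ideal_closed[OF a]
  have ccl: "c \<subseteq> carrier B" by (rule KB.submoduleE(1)[OF add.prems(1)])
  let ?H = "\<lambda>c. additive_span R (tensors (a \<inter> U) (carrier B) \<union> tensors U c)"
  have H: "tensors (a \<inter> U) (carrier B) \<union> tensors U c \<subseteq> carrier R" if "c \<subseteq> carrier B" for c
    using tensors_closed[of "a \<inter> U" "carrier B"] tensors_closed[of U c] that Ucl(1) by auto
  have xR: "x \<in> carrier R"
    using add.hyps(2) R.additive_span_closed[OF tensors_closed[OF Ucl(1) subset_refl]] by auto
  obtain m n where s: "s = inl m \<otimes> inr n" "m \<in> U" "n \<in> carrier B"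
    using add.hyps(1) by (auto simp: elementary_tensors_def)
  have mA: "m \<in> carrier A" using s Ucl by auto
  have sR: "s \<in> carrier R" using s mA by simp
  show ?case
  proof (cases "n \<in> c")
    case True
    have "\<sigma> x \<in> a" if \<sigma>: "\<sigma> \<in> right_slices c" for \<sigma>
    proof -
      have "\<sigma> s = \<zero>\<^bsub>A\<^esub>" using s mA slice_linear[OF \<sigma>] slice_kills[OF \<sigma> True] by simp
      then show ?thesis
        using add.prems(2)[OF \<sigma>] slice_add[OF \<sigma> sR xR] slice_closed[OF \<sigma> xR] by simp
    qed
    then have "x \<in> ?H c" by (rule add.IH[OF add.prems(1)])
    moreover have "s \<in> tensors U c" using s True by (auto simp: elementary_tensors_def)
    ultimately show ?thesis by (auto intro: additive_span.add)
  next
    case False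
    define c' where "c' = {w \<oplus>\<^bsub>B\<^esub> k \<odot>\<^bsub>B\<^esub> n | w k. w \<in> c \<and> k \<in> carrier K}"
    have c': "submodule c' K B" unfolding c'_def by (rule KB.submodule_adjoin[OF add.prems(1) s(3)])
    have z: "\<zero>\<^bsub>B\<^esub> \<in> c"
      using subgroup.one_closed[OF submodule.axioms(1)[OF add.prems(1)]] by simp
    have nc': "n \<in> c'" unfolding c'_def
      using z s(3) by (intro CollectI exI[of _ "\<zero>\<^bsub>B\<^esub>"] exI[of _ "\<one>\<^bsub>K\<^esub>"]) auto
    have "c \<subseteq> c'"
    proof
      fix w assume "w \<in> c"
      then show "w \<in> c'" unfolding c'_def
        using ccl s(3) by (intro CollectI exI[of _ w] exI[of _ "\<zero>\<^bsub>K\<^esub>"]) auto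
    qed
    then have sub: "right_slices c' \<subseteq> right_slices c" by (auto simp: slices_def)
    have "\<sigma> x \<in> a" if \<sigma>: "\<sigma> \<in> right_slices c'" for \<sigma>
    proof -
      have "\<sigma> s = \<zero>\<^bsub>A\<^esub>" using s mA slice_linear[OF \<sigma>] slice_kills[OF \<sigma> nc'] by simp
      moreover have "\<sigma> \<in> right_slices c" using \<sigma> sub by blast
      ultimately show ?thesis
        using add.prems(2)[of \<sigma>] slice_add[OF \<sigma> sR xR] slice_closed[OF \<sigma> xR] by simp
    qed
    then have "x \<in> ?H c'" by (rule add.IH[OF c'])
    moreover have "?H c' \<subseteq> {y \<oplus> inl v \<otimes> inr n | y v. y \<in> ?H c \<and> v \<in> U}" (is "_ \<subseteq> ?T")
    proof (rule additive_span_least)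
      have lift: "y \<in> ?T" if "y \<in> ?H c" for y
        using that Ucl(2) s(3) R.additive_span_closed[OF H[OF ccl]]
        by (intro CollectI exI[of _ y] exI[of _ "\<zero>\<^bsub>A\<^esub>"]) auto
      show "\<zero> \<in> ?T" by (rule lift) (rule additive_span.zero)
      show "tensors (a \<inter> U) (carrier B) \<union> tensors U c' \<subseteq> ?T"
      proof
        fix y assume "y \<in> tensors (a \<inter> U) (carrier B) \<union> tensors U c'"
        then show "y \<in> ?T"
        proof
          assume "y \<in> tensors (a \<inter> U) (carrier B)"
          then show ?thesis using R.additive_span_superset[OF H[OF ccl]] by (intro lift) auto
        next
          assume "y \<in> tensors U c'"
          then obtain v w k where y: "y = inl v \<otimes> inr (w \<oplus>\<^bsub>B\<^esub> k \<odot>\<^bsub>B\<^esub> n)" "v \<in> U" "w \<in> c" "k \<in> carrier K"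
            by (auto simp: elementary_tensors_def c'_def)
          have v: "v \<in> carrier A" and w: "w \<in> carrier B" using y Ucl ccl by auto
          have "y = inl v \<otimes> inr w \<oplus> inl v \<otimes> inr (k \<odot>\<^bsub>B\<^esub> n)"
            using y(1,4) v w s(3) by (simp add: R.r_distr)
          also have "inl v \<otimes> inr (k \<odot>\<^bsub>B\<^esub> n) = inl (k \<odot>\<^bsub>A\<^esub> v) \<otimes> inr n"
            using scalar_across y(4) v s(3) by blast
          finally have "y = inl v \<otimes> inr w \<oplus> inl (k \<odot>\<^bsub>A\<^esub> v) \<otimes> inr n" .
          moreover have "k \<odot>\<^bsub>A\<^esub> v \<in> U"
            using KA.smult_assoc2[of k "\<one>\<^bsub>A\<^esub>" v] y v Ucl(4)[of "k \<odot>\<^bsub>A\<^esub> \<one>\<^bsub>A\<^esub>" v] by simp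
          moreover have "inl v \<otimes> inr w \<in> ?H c"
            using R.additive_span_superset[OF H[OF ccl]] tensors_mem[OF y(2,3)] by auto
          ultimately show ?thesis by blast
        qed
      qed
      fix y y' assume "y \<in> ?T" "y' \<in> ?T"
      then obtain z v z' v' where y: "y = z \<oplus> inl v \<otimes> inr n" "z \<in> ?H c" "v \<in> U"
        "y' = z' \<oplus> inl v' \<otimes> inr n" "z' \<in> ?H c" "v' \<in> U" by blast
      have car: "z \<in> carrier R" "z' \<in> carrier R" "v \<in> carrier A" "v' \<in> carrier A"
        using y R.additive_span_closed[OF H[OF ccl]] Ucl by auto
      have "y \<oplus> y' = (z \<oplus> z') \<oplus> inl (v \<oplus>\<^bsub>A\<^esub> v') \<otimes> inr n"
        using y(1,4) car s(3) by (simp add: R.l_distr R.a_ac)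
      then show "y \<oplus> y' \<in> ?T"
        using R.additive_span_add[OF H[OF ccl] y(2,5)] Ucl(3)[OF y(3,6)] by blast
    qed
    ultimately obtain y v where y: "x = y \<oplus> inl v \<otimes> inr n" "y \<in> ?H c" "v \<in> U" by blast
    have yR: "y \<in> carrier R" and vA: "v \<in> carrier A"
      using y R.additive_span_closed[OF H[OF ccl]] Ucl by auto
    have eq: "s \<oplus> x = inl (m \<oplus>\<^bsub>A\<^esub> v) \<otimes> inr n \<oplus> y"
      unfolding y(1) s(1) using yR vA mA s(3) by (simp add: R.l_distr R.a_ac)
    obtain \<sigma> where \<sigma>: "\<sigma> \<in> right_slices c" "\<sigma> (inr n) = \<one>\<^bsub>A\<^esub>"
      using separated_right[OF add.prems(1)] False s(3) by blast
    have "\<sigma> y \<in> a"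
    proof (rule slice_span[OF \<sigma>(1) H[OF ccl] a _ y(2)])
      fix t assume "t \<in> tensors (a \<inter> U) (carrier B) \<union> tensors U c"
      then show "\<sigma> t \<in> a"
        using slice_tensors[OF \<sigma>(1) _ a _ _, of "a \<inter> U" "carrier B" t]
          slice_tensors[OF \<sigma>(1) Ucl(1) a _ ccl, of t] Ucl(1) by auto
    qed
    moreover have "\<sigma> (s \<oplus> x) = (m \<oplus>\<^bsub>A\<^esub> v) \<oplus>\<^bsub>A\<^esub> \<sigma> y"
      unfolding eq
      using slice_add[OF \<sigma>(1), of "inl (m \<oplus>\<^bsub>A\<^esub> v) \<otimes> inr n" y]
        slice_linear[OF \<sigma>(1), of "m \<oplus>\<^bsub>A\<^esub> v" "inr n"] \<sigma>(2) mA vA yR s(3)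
      by (simp del: l.hom_add)
    moreover have "\<sigma> (s \<oplus> x) \<in> a" by (rule add.prems(2)[OF \<sigma>(1)])
    ultimately have "m \<oplus>\<^bsub>A\<^esub> v \<in> a"
      using A.ideal_add_cancel[OF a, of "m \<oplus>\<^bsub>A\<^esub> v" "\<sigma> y"] mA vA by simp
    then have "inl (m \<oplus>\<^bsub>A\<^esub> v) \<otimes> inr n \<in> tensors (a \<inter> U) (carrier B)"
      using Ucl(3)[OF s(2) y(3)] s(3) by (auto simp: elementary_tensors_def)
    then show ?thesis unfolding eq using y(2) by (auto intro: additive_span.add)
  qed
qed (rule additive_span.zero)

text \<open>The ideal \<open>a R + c R\<close>, that is \<open>a \<otimes> B + A \<otimes> c\<close>, in a form that is symmetric in both factors.\<close>

definition sum_ideal :: "'a set \<Rightarrow> 'b set \<Rightarrow> 'r set"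
  where "sum_ideal a c = additive_span R (tensors a (carrier B) \<union> tensors (carrier A) c)"

lemma sum_ideal_gens_closed:
  assumes "a \<subseteq> carrier A" "c \<subseteq> carrier B"
  shows "tensors a (carrier B) \<union> tensors (carrier A) c \<subseteq> carrier R"
  using tensors_closed[of a "carrier B"] tensors_closed[of "carrier A" c] assms by auto

lemma tensors_mult:
  assumes "U \<subseteq> carrier A" "V \<subseteq> carrier B"
    and "\<And>a m. a \<in> carrier A \<Longrightarrow> m \<in> U \<Longrightarrow> a \<otimes>\<^bsub>A\<^esub> m \<in> U" "\<And>b n. b \<in> carrier B \<Longrightarrow> n \<in> V \<Longrightarrow> b \<otimes>\<^bsub>B\<^esub> n \<in> V"
    and "g \<in> tensors (carrier A) (carrier B)" "s \<in> tensors U V"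
  shows "g \<otimes> s \<in> tensors U V"
proof -
  obtain a b m n where *: "g = inl a \<otimes> inr b" "s = inl m \<otimes> inr n" "a \<in> carrier A" "b \<in> carrier B" "m \<in> U" "n \<in> V"
    using assms(5,6) by (auto simp: elementary_tensors_def)
  have "m \<in> carrier A" "n \<in> carrier B" using * assms by auto
  then have "g \<otimes> s = inl (a \<otimes>\<^bsub>A\<^esub> m) \<otimes> inr (b \<otimes>\<^bsub>B\<^esub> n)"
    unfolding *(1,2) using *(3,4) by (simp add: R.m_ac)
  then show ?thesis using assms(3,4) * tensors_mem by metis
qed

lemma sum_ideal_ideal:
  assumes a: "ideal a A" and c: "ideal c B"
  shows "ideal (sum_ideal a c) R"
  unfolding sum_ideal_def
proof (rule R.additive_span_ideal[OF sum_ideal_gens_closed tensors_closed spanned])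
  fix g s assume "g \<in> tensors (carrier A) (carrier B)" "s \<in> tensors a (carrier B) \<union> tensors (carrier A) c"
  then show "g \<otimes> s \<in> tensors a (carrier B) \<union> tensors (carrier A) c"
    using tensors_mult[of a "carrier B" g s] tensors_mult[of "carrier A" c g s]
      A.ideal_closed[OF a] B.ideal_closed[OF c] by auto
qed (use A.ideal_closed[OF a] B.ideal_closed[OF c] in auto)

lemma sum_ideal_mem:
  assumes "ideal a A" "ideal c B" "m \<in> carrier A" "n \<in> carrier B" "m \<in> a \<or> n \<in> c"
  shows "inl m \<otimes> inr n \<in> sum_ideal a c"
  using R.additive_span_superset[OF sum_ideal_gens_closed, of a c] assms
    A.ideal_closed(1)[of a] B.ideal_closed(1)[of c] tensors_mem
  unfolding sum_ideal_def by blast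

lemma sum_ideal_mono: "a \<subseteq> a' \<Longrightarrow> c \<subseteq> c' \<Longrightarrow> sum_ideal a c \<subseteq> sum_ideal a' c'"
  unfolding sum_ideal_def by (rule additive_span_mono) (auto simp: elementary_tensors_def)

lemma sum_ideal_swap:
  assumes "a \<subseteq> carrier A" "c \<subseteq> carrier B"
  shows "tensor_frame.sum_ideal B A R inr inl c a = sum_ideal a c"
  unfolding sum_ideal_def tensor_frame.sum_ideal_def[OF swapped]
  using elementary_tensors_swap[of a "carrier B"] elementary_tensors_swap[of "carrier A" c] assms by (simp add: Un_commute)

lemma sum_ideal_iff_slices:
  assumes a: "ideal a A" and c: "ideal c B" and x: "x \<in> carrier R"
  shows "x \<in> sum_ideal a c \<longleftrightarrow> (\<forall>\<sigma>\<in>right_slices c. \<sigma> x \<in> a)"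
proof
  note acl = A.ideal_closed(1)[OF a] and ccl = B.ideal_closed(1)[OF c]
  assume x: "x \<in> sum_ideal a c"
  show "\<forall>\<sigma>\<in>right_slices c. \<sigma> x \<in> a"
  proof
    fix \<sigma> assume \<sigma>: "\<sigma> \<in> right_slices c"
    show "\<sigma> x \<in> a"
    proof (rule slice_span[OF \<sigma> sum_ideal_gens_closed[OF acl ccl] a _ x[unfolded sum_ideal_def]])
      fix s assume "s \<in> tensors a (carrier B) \<union> tensors (carrier A) c"
      then show "\<sigma> s \<in> a"
        using slice_tensors[OF \<sigma> acl a, of "carrier B" s] slice_tensors[OF \<sigma> _ a _ ccl, of "carrier A" s]
        by auto
    qed
  qed
next
  assume "\<forall>\<sigma>\<in>right_slices c. \<sigma> x \<in> a"
  then have "x \<in> additive_span R (tensors (a \<inter> carrier A) (carrier B) \<union> tensors (carrier A) c)"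
    using span_by_slices[OF A.oneideal a ideal_submodule[OF c]] spanned x by blast
  then show "x \<in> sum_ideal a c"
    using A.ideal_closed(1)[OF a] by (simp add: sum_ideal_def Int_absorb2)
qed

text \<open>Slices commute with multiplication by elements of \<open>A\<close>.\<close>

lemma sum_ideal_colon:
  assumes a: "ideal a A" and c: "ideal c B" and s: "s \<in> carrier A" and x: "x \<in> carrier R"
  shows "inl s \<otimes> x \<in> sum_ideal a c \<longleftrightarrow> x \<in> sum_ideal (ideal_colon A a s) c"
proof -
  have "\<sigma> (inl s \<otimes> x) \<in> a \<longleftrightarrow> \<sigma> x \<in> ideal_colon A a s" if \<sigma>: "\<sigma> \<in> right_slices c" for \<sigma>
    using slice_linear[OF \<sigma> s x] slice_closed[OF \<sigma> x] s by (simp add: ideal_colon_def A.m_comm)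
  then show ?thesis
    using x s sum_ideal_iff_slices[OF a c] sum_ideal_iff_slices[OF A.ideal_colon_ideal[OF a s] c] by simp
qed

lemma sum_ideal_Inter:
  assumes a: "ideal a A" "\<And>i. i \<in> S \<Longrightarrow> ideal (a' i) A" and c: "ideal c B" and x: "x \<in> carrier R"
    and "\<And>f. f \<in> carrier A \<Longrightarrow> (\<And>i. i \<in> S \<Longrightarrow> f \<in> a' i) \<Longrightarrow> f \<in> a"
    and "\<And>i. i \<in> S \<Longrightarrow> x \<in> sum_ideal (a' i) c"
  shows "x \<in> sum_ideal a c"
  unfolding sum_ideal_iff_slices[OF a(1) c x]
  using assms(5,6) sum_ideal_iff_slices[OF a(2) c x] slice_closed[OF _ x] by blast

end

section \<open>Regularity modulo a sum of extended ideals\<close>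

text \<open>No nonzero element of \<open>R/L\<close> is annihilated by all of \<open>G\<close>. The set \<open>G\<close> takes the place of a single
  nonzerodivisor: one can work with it without producing, by prime avoidance, one element of \<open>G\<close>
  outside all associated primes.\<close>

definition regular_modulo :: "('r, 'm) ring_scheme \<Rightarrow> 'r set \<Rightarrow> 'r set \<Rightarrow> bool"
  where "regular_modulo R G L \<longleftrightarrow> (\<forall>x\<in>carrier R. (\<forall>g\<in>G. g \<otimes>\<^bsub>R\<^esub> x \<in> L) \<longrightarrow> x \<in> L)"

lemma regular_moduloD:
  "regular_modulo R G L \<Longrightarrow> x \<in> carrier R \<Longrightarrow> (\<And>g. g \<in> G \<Longrightarrow> g \<otimes>\<^bsub>R\<^esub> x \<in> L) \<Longrightarrow> x \<in> L"
  by (simp add: regular_modulo_def)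

lemma (in noetherian_cring) regular_modulo_if_avoids_associated_primes:
  assumes I: "ideal I R" and G: "G \<subseteq> carrier R"
    and "\<And>P. P \<in> associated_primes R (quot_module R I) \<Longrightarrow> \<not> G \<subseteq> P"
  shows "regular_modulo R G I"
  unfolding regular_modulo_def
proof (intro ballI impI, rule ccontr)
  fix x assume x: "x \<in> carrier R" "\<forall>g\<in>G. g \<otimes> x \<in> I" "x \<notin> I"
  obtain P where "P \<in> associated_primes R (quot_module R I)" "ideal_colon R I x \<subseteq> P"
    by (rule associated_prime_above_colon[OF I x(1,3)])
  moreover have "G \<subseteq> ideal_colon R I x" using x(2) G by (auto simp: ideal_colon_def)
  ultimately show False using assms(3) by blast
qed

lemma (in cring) additive_span_split:
  assumes S: "S \<subseteq> carrier R" and T: "ideal T R" and S': "S' \<subseteq> T"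
    and "x \<in> additive_span R (S \<union> S')"
  obtains y t where "x = y \<oplus> t" "y \<in> additive_span R S" "t \<in> T"
proof -
  note Tcl = ideal_closed[OF T] and cl = additive_span_closed[OF S]
  have "additive_span R (S \<union> S') \<subseteq> {y \<oplus> t | y t. y \<in> additive_span R S \<and> t \<in> T}" (is "_ \<subseteq> ?Z")
  proof (rule additive_span_least)
    show "\<zero> \<in> ?Z"
      using additive_span.zero[of R S] Tcl(2) by (intro CollectI exI[of _ \<zero>]) auto
    show "S \<union> S' \<subseteq> ?Z"
    proof
      fix s assume "s \<in> S \<union> S'"
      then show "s \<in> ?Z"
      proof
        assume "s \<in> S"
        then show ?thesis
          using additive_span_superset[OF S] Tcl(2) S by (intro CollectI exI[of _ s] exI[of _ \<zero>]) auto
      next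
        assume "s \<in> S'"
        then show ?thesis
          using additive_span.zero[of R S] Tcl(1) S' by (intro CollectI exI[of _ \<zero>] exI[of _ s]) auto
      qed
    qed
    fix v w assume "v \<in> ?Z" "w \<in> ?Z"
    then obtain y t y' t' where v: "v = y \<oplus> t" "y \<in> additive_span R S" "t \<in> T"
      "w = y' \<oplus> t'" "y' \<in> additive_span R S" "t' \<in> T" by blast
    then have "y \<in> carrier R" "y' \<in> carrier R" "t \<in> carrier R" "t' \<in> carrier R" using cl Tcl(1) by auto
    then have "v \<oplus> w = (y \<oplus> y') \<oplus> (t \<oplus> t')" using v(1,4) by (simp add: a_ac)
    then show "v \<oplus> w \<in> ?Z" using additive_span_add[OF S v(2,5)] Tcl(3)[OF v(3,6)] by blast
  qed
  then show ?thesis using assms(4) that by blast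
qed

context tensor_frame
begin

text \<open>Locally at \<open>p\<close>, an element of \<open>(a + (f)) \<otimes> B + A \<otimes> c\<close> is a multiple of \<open>f\<close> modulo \<open>a \<otimes> B + A \<otimes> c\<close>: clear the
  denominators of the finitely many tensors involved.\<close>

lemma sum_ideal_saturation_principal:
  assumes a: "ideal a A" and c: "ideal c B" and p: "primeideal p A" and f: "f \<in> carrier A"
    and x: "x \<in> sum_ideal (prime_saturation A p (a <+>\<^bsub>A\<^esub> PIdl\<^bsub>A\<^esub> f)) c"
  obtains s y where "s \<in> carrier A - p" "y \<in> carrier R" "inl s \<otimes> x \<ominus> inl f \<otimes> y \<in> sum_ideal a c"
proof -
  let ?a = "prime_saturation A p (a <+>\<^bsub>A\<^esub> PIdl\<^bsub>A\<^esub> f)"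
  have "ideal ?a A"
    by (intro A.prime_saturation_ideal[OF p] A.add_ideals a A.cgenideal_ideal f)
  note acl = A.ideal_closed[OF this] and ccl = B.ideal_closed[OF c]
  note Z = R.ideal_closed[OF sum_ideal_ideal[OF a c]]
  have gens: "tensors ?a (carrier B) \<union> tensors (carrier A) c \<subseteq> carrier R"
    by (rule sum_ideal_gens_closed[OF acl(1) ccl(1)])
  have one: "\<one>\<^bsub>A\<^esub> \<in> carrier A - p" by (rule A.prime_complement_one[OF p])
  have "\<exists>s\<in>carrier A - p. \<exists>y\<in>carrier R. inl s \<otimes> x \<ominus> inl f \<otimes> y \<in> sum_ideal a c"
    using x unfolding sum_ideal_def[of ?a]
  proof induction
    case zero
    show ?case using one Z(2) f by (intro bexI[of _ "\<one>\<^bsub>A\<^esub>"] bexI[of _ \<zero>]) (auto simp: R.minus_eq)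
  next
    case (add g x)
    then obtain s y where y: "s \<in> carrier A - p" "y \<in> carrier R" "inl s \<otimes> x \<ominus> inl f \<otimes> y \<in> sum_ideal a c"
      by blast
    have xg: "g \<in> carrier R" "x \<in> carrier R"
      using add gens R.additive_span_closed[OF gens] by auto
    have "\<exists>s\<in>carrier A - p. \<exists>y\<in>carrier R. inl s \<otimes> g \<ominus> inl f \<otimes> y \<in> sum_ideal a c"
      using add.hyps(1)
    proof
      assume "g \<in> tensors ?a (carrier B)"
      then obtain m n where g: "g = inl m \<otimes> inr n" "m \<in> ?a" "n \<in> carrier B" by (auto simp: elementary_tensors_def)
      obtain t r where t: "m \<in> carrier A" "t \<in> carrier A - p" "r \<in> carrier A"
        "t \<otimes>\<^bsub>A\<^esub> m \<ominus>\<^bsub>A\<^esub> r \<otimes>\<^bsub>A\<^esub> f \<in> a"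
        using g(2) unfolding A.mem_saturation_add_principal[OF a f] by blast
      have tA: "t \<in> carrier A" using t by auto
      have "inl (t \<otimes>\<^bsub>A\<^esub> m \<ominus>\<^bsub>A\<^esub> r \<otimes>\<^bsub>A\<^esub> f) \<otimes> inr n \<in> sum_ideal a c"
        by (rule sum_ideal_mem[OF a c]) (use t tA f g in auto)
      moreover have "inl (t \<otimes>\<^bsub>A\<^esub> m \<ominus>\<^bsub>A\<^esub> r \<otimes>\<^bsub>A\<^esub> f) = inl t \<otimes> inl m \<ominus> inl r \<otimes> inl f"
        using t tA f by (simp add: A.minus_eq R.minus_eq)
      moreover have "(inl t \<otimes> inl m \<ominus> inl r \<otimes> inl f) \<otimes> inr n
          = inl t \<otimes> (inl m \<otimes> inr n) \<ominus> inl f \<otimes> (inl r \<otimes> inr n)"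
        using l.hom_closed[OF tA] l.hom_closed[OF t(1)] l.hom_closed[OF t(3)] l.hom_closed[OF f]
          r.hom_closed[OF g(3)] by algebra
      ultimately have "inl t \<otimes> g \<ominus> inl f \<otimes> (inl r \<otimes> inr n) \<in> sum_ideal a c" using g(1) by simp
      moreover have "inl r \<otimes> inr n \<in> carrier R" using t g by simp
      ultimately show ?thesis using t(2) by blast
    next
      assume "g \<in> tensors (carrier A) c"
      then obtain m n where g: "g = inl m \<otimes> inr n" "m \<in> carrier A" "n \<in> c" by (auto simp: elementary_tensors_def)
      have "g \<in> sum_ideal a c"
        unfolding g(1) by (rule sum_ideal_mem[OF a c]) (use g ccl in auto)
      then show ?thesis
        using one xg f by (intro bexI[of _ "\<one>\<^bsub>A\<^esub>"] bexI[of _ \<zero>]) (auto simp: R.minus_eq)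
    qed
    then obtain s' y' where y': "s' \<in> carrier A - p" "y' \<in> carrier R" "inl s' \<otimes> g \<ominus> inl f \<otimes> y' \<in> sum_ideal a c"
      by blast
    have sA: "s \<in> carrier A" "s' \<in> carrier A" using y(1) y'(1) by auto
    have car: "inl s \<in> carrier R" "inl s' \<in> carrier R" "inl f \<in> carrier R" using sA f by auto
    have "inl s \<otimes> (inl s' \<otimes> g \<ominus> inl f \<otimes> y') \<oplus> inl s' \<otimes> (inl s \<otimes> x \<ominus> inl f \<otimes> y) \<in> sum_ideal a c"
      using Z(3) Z(4) car y(3) y'(3) by blast
    also have "inl s \<otimes> (inl s' \<otimes> g \<ominus> inl f \<otimes> y') \<oplus> inl s' \<otimes> (inl s \<otimes> x \<ominus> inl f \<otimes> y)
        = (inl s \<otimes> inl s') \<otimes> (g \<oplus> x) \<ominus> inl f \<otimes> (inl s \<otimes> y' \<oplus> inl s' \<otimes> y)"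
      using car xg y(2) y'(2) by algebra
    also have "inl s \<otimes> inl s' = inl (s \<otimes>\<^bsub>A\<^esub> s')" using sA by simp
    finally have "inl (s \<otimes>\<^bsub>A\<^esub> s') \<otimes> (g \<oplus> x) \<ominus> inl f \<otimes> (inl s \<otimes> y' \<oplus> inl s' \<otimes> y) \<in> sum_ideal a c" .
    moreover have "inl s \<otimes> y' \<oplus> inl s' \<otimes> y \<in> carrier R" using car y(2) y'(2) by simp
    ultimately show ?case using A.prime_complement_mult[OF p y(1) y'(1)] by blast
  qed
  then show ?thesis using that by blast
qed

text \<open>Noetherian induction on \<open>a\<close>. A \<open>p\<close>-saturated proper ideal \<open>a \<noteq> p\<close> lies strictly inside \<open>p\<close>; pick
  \<open>f \<in> p\<close> outside \<open>a\<close>. If \<open>f\<close> is a zero divisor modulo \<open>a\<close>, the claim holds for the larger ideals \<open>a : f\<close>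
  and the saturation of \<open>a + (f)\<close>, and the sequence \<open>A/(a : f) \<rightarrow> A/a \<rightarrow> A/(a + (f))\<close>, whose first map is
  multiplication by \<open>f\<close>, transports it to \<open>a\<close>. If \<open>f\<close> is regular modulo \<open>a\<close>, the claim holds for the saturations of all
  \<open>a + (f\<^sup>n)\<close>, which are strictly larger than \<open>a\<close>, and their intersection is \<open>a\<close> by Krull's theorem.
  Tensoring with \<open>B/c\<close> preserves such intersections, since membership is tested on slices.\<close>

lemma regular_modulo_saturated:
  assumes noeth: "noetherian_ring A" and p: "primeideal p A" and c: "ideal c B" and G: "G \<subseteq> carrier R"
    and regp: "regular_modulo R G (sum_ideal p c)"
    and a: "ideal a A"
    and sat: "\<And>s f. s \<in> carrier A - p \<Longrightarrow> f \<in> carrier A \<Longrightarrow> s \<otimes>\<^bsub>A\<^esub> f \<in> a \<Longrightarrow> f \<in> a"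
  shows "regular_modulo R G (sum_ideal a c)"
proof -
  interpret NA: noetherian_cring A
    using noeth A.cring_axioms by (simp add: noetherian_cring_def)
  note pcl = A.ideal_closed[OF primeideal.axioms(1)[OF p]]
  show ?thesis
    using a sat
  proof (induction a rule: NA.ideal_noetherian_induct)
    case (step a)
    note a = step.hyps and sat = step.prems
    note acl = A.ideal_closed[OF a]
    have larger: "regular_modulo R G (sum_ideal b c)"
      if "ideal b A" "a \<subset> b" "\<And>s f. s \<in> carrier A - p \<Longrightarrow> f \<in> carrier A \<Longrightarrow> s \<otimes>\<^bsub>A\<^esub> f \<in> b \<Longrightarrow> f \<in> b" for b
      using step.IH that by blast
    have adjoin: "regular_modulo R G (sum_ideal (prime_saturation A p (a <+>\<^bsub>A\<^esub> PIdl\<^bsub>A\<^esub> f)) c)"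
      if f: "f \<in> carrier A" "f \<notin> a" for f
    proof (rule larger)
      let ?L = "a <+>\<^bsub>A\<^esub> PIdl\<^bsub>A\<^esub> f"
      have L: "ideal ?L A" by (intro A.add_ideals a A.cgenideal_ideal f)
      show "ideal (prime_saturation A p ?L) A" by (rule A.prime_saturation_ideal[OF p L])
      have "x \<in> prime_saturation A p ?L" if "x \<in> a" for x
        unfolding A.mem_saturation_add_principal[OF a f(1)]
        using that acl f A.prime_complement_one[OF p]
        by (intro conjI bexI[of _ "\<one>\<^bsub>A\<^esub>"] bexI[of _ "\<zero>\<^bsub>A\<^esub>"]) (auto simp: A.minus_eq subset_iff)
      moreover have "f \<in> prime_saturation A p ?L"
        unfolding A.mem_saturation_add_principal[OF a f(1)]
        using acl f A.prime_complement_one[OF p]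
        by (intro conjI bexI[of _ "\<one>\<^bsub>A\<^esub>"]) (auto simp: A.minus_eq A.r_neg)
      ultimately show "a \<subset> prime_saturation A p ?L" using f(2) by blast
    qed (rule A.prime_saturation_saturated[OF p])
    show ?case
    proof (cases "a = carrier A")
      case True
      have "carrier R \<subseteq> sum_ideal a c"
        unfolding sum_ideal_def True using spanned
          additive_span_mono[of "tensors (carrier A) (carrier B)" "tensors (carrier A) (carrier B) \<union> tensors (carrier A) c" R]
        by blast
      then show ?thesis by (auto simp: regular_modulo_def)
    next
      case False
      then have one: "\<one>\<^bsub>A\<^esub> \<notin> a" using ideal.one_imp_carrier[OF a] by blast
      have "a \<subseteq> p"
      proof
        fix s assume s: "s \<in> a"
        show "s \<in> p"
        proof (rule ccontr)
          assume "s \<notin> p"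
          then show False using sat[of s "\<one>\<^bsub>A\<^esub>"] s acl(1) one by (auto simp: subset_iff)
        qed
      qed
      show ?thesis
      proof (cases "a = p")
        case True
        then show ?thesis using regp by simp
      next
        case False
        then obtain f where f: "f \<in> p" "f \<notin> a" using \<open>a \<subseteq> p\<close> by blast
        have fA: "f \<in> carrier A" using f pcl(1) by blast
        note Z = R.ideal_closed[OF sum_ideal_ideal[OF a c]]
        show ?thesis
          unfolding regular_modulo_def
        proof (intro ballI impI)
          fix x assume x: "x \<in> carrier R" "\<forall>g\<in>G. g \<otimes> x \<in> sum_ideal a c"
          show "x \<in> sum_ideal a c"
          proof (cases "\<forall>h\<in>carrier A. f \<otimes>\<^bsub>A\<^esub> h \<in> a \<longrightarrow> h \<in> a")
            case True
            \<comment> \<open>\<open>f\<close> is regular modulo \<open>a\<close>: pass to the ideals \<open>a + (f\<^sup>n)\<close> and apply Krull's theorem.\<close>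
            define b where "b n = prime_saturation A p (a <+>\<^bsub>A\<^esub> PIdl\<^bsub>A\<^esub> (f [^]\<^bsub>A\<^esub> n))" for n :: nat
            have fn: "f [^]\<^bsub>A\<^esub> n \<notin> a" for n :: nat
            proof (induction n)
              case (Suc n)
              have "f [^]\<^bsub>A\<^esub> Suc n = f \<otimes>\<^bsub>A\<^esub> f [^]\<^bsub>A\<^esub> n" using fA by (simp add: A.m_comm)
              then show ?case using True Suc fA by auto
            qed (use one in simp)
            have bid: "ideal (b n) A" for n
              unfolding b_def
              by (intro A.prime_saturation_ideal[OF p] A.add_ideals a A.cgenideal_ideal A.nat_pow_closed fA)
            have sub: "a \<subseteq> b n" for n
            proof
              fix z assume "z \<in> a"
              then show "z \<in> b n"
                unfolding b_def A.mem_saturation_add_principal[OF a A.nat_pow_closed[OF fA]]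
                using acl fA A.prime_complement_one[OF p]
                by (intro conjI bexI[of _ "\<one>\<^bsub>A\<^esub>"] bexI[of _ "\<zero>\<^bsub>A\<^esub>"]) (auto simp: A.minus_eq subset_iff)
            qed
            have "x \<in> sum_ideal (b n) c" for n
            proof (rule regular_moduloD[OF adjoin[OF A.nat_pow_closed[OF fA] fn, folded b_def] x(1)])
              show "g \<otimes> x \<in> sum_ideal (b n) c" if "g \<in> G" for g
                using x(2) that sum_ideal_mono[OF sub[of n], of c c] by blast
            qed
            moreover have "h \<in> a" if "h \<in> carrier A" "\<And>n. h \<in> b n" for h
              by (rule NA.krull_intersection_saturated[OF p a sat f(1)])
                (use True that in \<open>auto simp: b_def\<close>)
            ultimately show ?thesis
              by (intro sum_ideal_Inter[where S = UNIV and a' = b, OF a bid c x(1)]) auto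
          next
            case False
            define d where "d = ideal_colon A a f"
            have d: "ideal d A" unfolding d_def by (rule A.ideal_colon_ideal[OF a fA])
            \<comment> \<open>Modulo \<open>a\<close>, the element \<open>x\<close> is locally \<open>f y\<close>, and \<open>y\<close> is annihilated by \<open>G\<close> modulo \<open>d\<close>.\<close>
            have regd: "regular_modulo R G (sum_ideal d c)"
            proof (rule larger[OF d])
              have "a \<subseteq> d" using acl fA by (auto simp: d_def ideal_colon_def)
              moreover have "\<exists>h\<in>d. h \<notin> a" using False fA by (auto simp: d_def ideal_colon_def A.m_comm)
              ultimately show "a \<subset> d" by blast
              show "h \<in> d" if "s \<in> carrier A - p" "h \<in> carrier A" "s \<otimes>\<^bsub>A\<^esub> h \<in> d" for s h
                using that fA sat[of s "h \<otimes>\<^bsub>A\<^esub> f"] by (auto simp: d_def ideal_colon_def A.m_assoc)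
            qed
            have "x \<in> sum_ideal (prime_saturation A p (a <+>\<^bsub>A\<^esub> PIdl\<^bsub>A\<^esub> f)) c"
            proof (rule regular_moduloD[OF adjoin[OF fA f(2)] x(1)])
              have "a \<subseteq> prime_saturation A p (a <+>\<^bsub>A\<^esub> PIdl\<^bsub>A\<^esub> f)"
              proof
                fix z assume "z \<in> a"
                then show "z \<in> prime_saturation A p (a <+>\<^bsub>A\<^esub> PIdl\<^bsub>A\<^esub> f)"
                  unfolding A.mem_saturation_add_principal[OF a fA]
                  using acl fA A.prime_complement_one[OF p]
                  by (intro conjI bexI[of _ "\<one>\<^bsub>A\<^esub>"] bexI[of _ "\<zero>\<^bsub>A\<^esub>"]) (auto simp: A.minus_eq subset_iff)
              qed
              then show "g \<otimes> x \<in> sum_ideal (prime_saturation A p (a <+>\<^bsub>A\<^esub> PIdl\<^bsub>A\<^esub> f)) c" if "g \<in> G" for g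
                using x(2) that sum_ideal_mono[of a _ c c] by blast
            qed
            then obtain s y where sy: "s \<in> carrier A - p" "y \<in> carrier R"
              "inl s \<otimes> x \<ominus> inl f \<otimes> y \<in> sum_ideal a c"
              using sum_ideal_saturation_principal[OF a c p fA] by blast
            have sA: "s \<in> carrier A" using sy by auto
            have car: "inl s \<in> carrier R" "inl f \<in> carrier R" using sA fA by auto
            have "y \<in> sum_ideal d c"
            proof (rule regular_moduloD[OF regd sy(2)])
              fix g assume g: "g \<in> G"
              then have gR: "g \<in> carrier R" using G by blast
              have "inl s \<otimes> (g \<otimes> x) \<ominus> g \<otimes> (inl s \<otimes> x \<ominus> inl f \<otimes> y) \<in> sum_ideal a c"
                using Z(4,7) x(2) g gR car sy(3) by blast
              also have "inl s \<otimes> (g \<otimes> x) \<ominus> g \<otimes> (inl s \<otimes> x \<ominus> inl f \<otimes> y) = inl f \<otimes> (g \<otimes> y)"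
                using car gR x(1) sy(2) by algebra
              finally show "g \<otimes> y \<in> sum_ideal d c"
                unfolding d_def using sum_ideal_colon[OF a c fA] gR sy(2) by simp
            qed
            then have "inl f \<otimes> y \<in> sum_ideal a c"
              unfolding d_def using sum_ideal_colon[OF a c fA sy(2)] by simp
            then have "(inl s \<otimes> x \<ominus> inl f \<otimes> y) \<oplus> inl f \<otimes> y \<in> sum_ideal a c" using Z(3) sy(3) by blast
            moreover have "(inl s \<otimes> x \<ominus> inl f \<otimes> y) \<oplus> inl f \<otimes> y = inl s \<otimes> x"
              using car x(1) sy(2) by algebra
            ultimately have "x \<in> sum_ideal (ideal_colon A a s) c"
              using sum_ideal_colon[OF a c sA x(1)] by simp
            moreover have "ideal_colon A a s \<subseteq> a"
              using sat[OF sy(1)] sA by (auto simp: ideal_colon_def A.m_comm)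
            ultimately show ?thesis using sum_ideal_mono[of _ a c c] by blast
          qed
        qed
      qed
    qed
  qed
qed

lemma prime_saturation_regular:
  assumes "noetherian_ring A" "primeideal p A" "ideal c B" "G \<subseteq> carrier R"
    "regular_modulo R G (sum_ideal p c)" "ideal a A"
  shows "regular_modulo R G (sum_ideal (prime_saturation A p a) c)"
  by (rule regular_modulo_saturated[OF assms(1-5)])
    (use assms A.prime_saturation_ideal A.prime_saturation_saturated in auto)

text \<open>Multiplication by \<open>\<alpha>\<close> embeds \<open>A/(I : \<alpha>)\<close> into \<open>A/I\<close>, likewise for \<open>\<beta>\<close>, and over a field the tensor
  product of the two embeddings is again injective. For associated primes \<open>I : \<alpha>\<close> and \<open>J : \<beta>\<close> this carries
  regularity from \<open>A/I \<otimes> B/J\<close> to \<open>A/p \<otimes> B/q\<close>.\<close>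

lemma regular_modulo_colon:
  assumes I: "ideal I A" and J: "ideal J B" and \<alpha>: "\<alpha> \<in> carrier A" and \<beta>: "\<beta> \<in> carrier B"
    and G: "G \<subseteq> carrier R" and reg: "regular_modulo R G (sum_ideal I J)"
  shows "regular_modulo R G (sum_ideal (ideal_colon A I \<alpha>) (ideal_colon B J \<beta>))"
proof -
  interpret swap: tensor_frame K B A R inr inl by (rule swapped)
  note I' = A.ideal_colon_ideal[OF I \<alpha>] and J' = B.ideal_colon_ideal[OF J \<beta>]
  have iff: "inr \<beta> \<otimes> (inl \<alpha> \<otimes> x) \<in> sum_ideal I J
      \<longleftrightarrow> x \<in> sum_ideal (ideal_colon A I \<alpha>) (ideal_colon B J \<beta>)" if x: "x \<in> carrier R" for x
  proof -
    have "inr \<beta> \<otimes> (inl \<alpha> \<otimes> x) \<in> sum_ideal I J \<longleftrightarrow> inl \<alpha> \<otimes> x \<in> sum_ideal I (ideal_colon B J \<beta>)"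
      using swap.sum_ideal_colon[OF J I \<beta>, of "inl \<alpha> \<otimes> x"] x \<alpha>
        sum_ideal_swap[of I J] sum_ideal_swap[of I "ideal_colon B J \<beta>"]
        A.ideal_closed(1)[OF I] B.ideal_closed(1)[OF J] B.ideal_closed(1)[OF J'] by simp
    then show ?thesis using sum_ideal_colon[OF I J' \<alpha> x] by simp
  qed
  show ?thesis
    unfolding regular_modulo_def
  proof (intro ballI impI)
    fix x assume x: "x \<in> carrier R" "\<forall>g\<in>G. g \<otimes> x \<in> sum_ideal (ideal_colon A I \<alpha>) (ideal_colon B J \<beta>)"
    have "inr \<beta> \<otimes> (inl \<alpha> \<otimes> x) \<in> sum_ideal I J"
    proof (rule regular_moduloD[OF reg])
      fix g assume g: "g \<in> G"
      then have gR: "g \<in> carrier R" using G by blast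
      have "inr \<beta> \<otimes> (inl \<alpha> \<otimes> (g \<otimes> x)) \<in> sum_ideal I J" using iff[of "g \<otimes> x"] x g gR by simp
      also have "inr \<beta> \<otimes> (inl \<alpha> \<otimes> (g \<otimes> x)) = g \<otimes> (inr \<beta> \<otimes> (inl \<alpha> \<otimes> x))"
        using gR \<alpha> \<beta> x(1) by (simp add: R.m_ac)
      finally show "g \<otimes> (inr \<beta> \<otimes> (inl \<alpha> \<otimes> x)) \<in> sum_ideal I J" .
    qed (use x \<alpha> \<beta> in simp)
    then show "x \<in> sum_ideal (ideal_colon A I \<alpha>) (ideal_colon B J \<beta>)" using iff[OF x(1)] by simp
  qed
qed

text \<open>Change the left factor from \<open>p\<close> to the saturation of \<open>a\<close> at \<open>p\<close>, then the right one from \<open>q\<close> to the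
  saturation of \<open>c\<close> at \<open>q\<close>; intersecting over all \<open>p\<close> and \<open>q\<close> recovers \<open>a\<close> and \<open>c\<close>.\<close>

lemma regular_modulo_locally_saturated:
  assumes noeth: "noetherian_ring A" "noetherian_ring B"
    and I: "ideal I A" and J: "ideal J B" and G: "G \<subseteq> carrier R"
    and reg: "regular_modulo R G (sum_ideal I J)"
    and a: "ideal a A" "\<And>f. f \<in> carrier A \<Longrightarrow>
      (\<And>p. p \<in> associated_primes A (quot_module A I) \<Longrightarrow> f \<in> prime_saturation A p a) \<Longrightarrow> f \<in> a"
    and c: "ideal c B" "\<And>f. f \<in> carrier B \<Longrightarrow>
      (\<And>q. q \<in> associated_primes B (quot_module B J) \<Longrightarrow> f \<in> prime_saturation B q c) \<Longrightarrow> f \<in> c"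
  shows "regular_modulo R G (sum_ideal a c)"
  unfolding regular_modulo_def
proof (intro ballI impI)
  interpret swap: tensor_frame K B A R inr inl by (rule swapped)
  note swap_eq = sum_ideal_swap[OF A.ideal_closed(1) B.ideal_closed(1)]
  let ?P = "associated_primes A (quot_module A I)" and ?Q = "associated_primes B (quot_module B J)"
  have P: "ideal (prime_saturation A p a) A" if "p \<in> ?P" for p
    using that A.prime_saturation_ideal[OF _ a(1)] by (simp add: associated_primes_def)
  have Q: "ideal (prime_saturation B q c) B" if "q \<in> ?Q" for q
    using that B.prime_saturation_ideal[OF _ c(1)] by (simp add: associated_primes_def)
  fix x assume x: "x \<in> carrier R" "\<forall>g\<in>G. g \<otimes> x \<in> sum_ideal a c"
  have pq: "x \<in> sum_ideal (prime_saturation A p a) (prime_saturation B q c)" if p: "p \<in> ?P" and q: "q \<in> ?Q" for p q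
  proof -
    obtain \<alpha> where \<alpha>: "primeideal p A" "\<alpha> \<in> carrier A" "p = ideal_colon A I \<alpha>"
      using p by (auto simp: A.associated_primes_quot_module[OF I])
    obtain \<beta> where \<beta>: "primeideal q B" "\<beta> \<in> carrier B" "q = ideal_colon B J \<beta>"
      using q by (auto simp: B.associated_primes_quot_module[OF J])
    have qid: "ideal q B" by (rule primeideal.axioms(1)[OF \<beta>(1)])
    have "regular_modulo R G (sum_ideal p q)"
      unfolding \<alpha>(3) \<beta>(3) by (rule regular_modulo_colon[OF I J \<alpha>(2) \<beta>(2) G reg])
    then have "regular_modulo R G (sum_ideal (prime_saturation A p a) q)"
      by (rule prime_saturation_regular[OF noeth(1) \<alpha>(1) qid G _ a(1)])
    then have "regular_modulo R G (sum_ideal (prime_saturation A p a) (prime_saturation B q c))"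
      using swap.prime_saturation_regular[OF noeth(2) \<beta>(1) P[OF p] G _ c(1)]
      by (simp add: swap_eq[OF P[OF p] qid] swap_eq[OF P[OF p] Q[OF q]])
    then show ?thesis
    proof (rule regular_moduloD[OF _ x(1)])
      have "sum_ideal a c \<subseteq> sum_ideal (prime_saturation A p a) (prime_saturation B q c)"
        by (rule sum_ideal_mono[OF A.subset_prime_saturation[OF \<alpha>(1) a(1)] B.subset_prime_saturation[OF \<beta>(1) c(1)]])
      then show "g \<otimes> x \<in> sum_ideal (prime_saturation A p a) (prime_saturation B q c)" if "g \<in> G" for g
        using x(2) that by blast
    qed
  qed
  have "x \<in> sum_ideal a (prime_saturation B q c)" if q: "q \<in> ?Q" for q
    by (rule sum_ideal_Inter[OF a(1) P Q[OF q] x(1) a(2) pq[OF _ q]])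
  then have "x \<in> swap.sum_ideal (prime_saturation B q c) a" if "q \<in> ?Q" for q
    using that by (simp add: swap_eq[OF a(1) Q])
  then have "x \<in> swap.sum_ideal c a"
    by (intro swap.sum_ideal_Inter[OF c(1) Q a(1) x(1) c(2)])
  then show "x \<in> sum_ideal a c" by (simp add: swap_eq[OF a(1) c(1)])
qed

text \<open>An associated prime of \<open>R/(I + J)\<close> is the annihilator of some \<open>y\<close>. A slice of \<open>y\<close> that falls outside \<open>I\<close>
  is annihilated modulo \<open>I\<close> by the contraction of the prime to \<open>A\<close>, and every such annihilator is contained
  in an associated prime of \<open>A/I\<close>.\<close>

lemma associated_prime_contraction:
  assumes noeth: "noetherian_ring A" and I: "ideal I A" and J: "ideal J B"
    and P: "P \<in> associated_primes R (quot_module R (sum_ideal I J))"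
  obtains p where "p \<in> associated_primes A (quot_module A I)" "{s \<in> carrier A. inl s \<in> P} \<subseteq> p"
proof -
  interpret NA: noetherian_cring A
    using noeth A.cring_axioms by (simp add: noetherian_cring_def)
  note S = sum_ideal_ideal[OF I J]
  obtain y where y: "primeideal P R" "y \<in> carrier R" "P = ideal_colon R (sum_ideal I J) y"
    using P by (auto simp: R.associated_primes_quot_module[OF S])
  have "\<one> \<notin> P" using R.prime_complement_one[OF y(1)] by simp
  then have "y \<notin> sum_ideal I J" using y(2,3) by (simp add: ideal_colon_def)
  then obtain \<sigma> where \<sigma>: "\<sigma> \<in> right_slices J" "\<sigma> y \<notin> I"
    using sum_ideal_iff_slices[OF I J y(2)] by blast
  obtain p where p: "p \<in> associated_primes A (quot_module A I)" "ideal_colon A I (\<sigma> y) \<subseteq> p"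
    by (rule NA.associated_prime_above_colon[OF I slice_closed[OF \<sigma>(1) y(2)] \<sigma>(2)])
  have "s \<in> p" if s: "s \<in> carrier A" "inl s \<in> P" for s
  proof -
    have "inl s \<otimes> y \<in> sum_ideal I J" using s(2) y(3) by (simp add: ideal_colon_def)
    then have "\<sigma> (inl s \<otimes> y) \<in> I"
      using sum_ideal_iff_slices[OF I J, of "inl s \<otimes> y"] \<sigma>(1) s(1) y(2) by auto
    then show ?thesis using p(2) s(1) slice_linear[OF \<sigma>(1) s(1) y(2)] by (auto simp: ideal_colon_def)
  qed
  then show ?thesis using that p(1) by blast
qed

end

section \<open>Binomial sums of saturated filtrations\<close>

text \<open>Two decreasing families of ideals indexed by nonnegative rationals, such as the rational symbolic
  powers of \<open>I\<close> and \<open>J\<close>.\<close>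

locale binomial_filtration = tensor_frame K A B R inl inr
  for K :: "('k, 'l) ring_scheme" and A :: "('k, 'a, 'm) module_scheme"
    and B :: "('k, 'b, 'n) module_scheme" and R :: "('r, 'o) ring_scheme" (structure) and inl inr +
  fixes as :: "rat \<Rightarrow> 'a set" and bs :: "rat \<Rightarrow> 'b set" and u :: rat
  assumes as_ideal: "ideal (as w) A" and bs_ideal: "ideal (bs w) B"
    and as_antimono: "0 \<le> w \<Longrightarrow> w \<le> w' \<Longrightarrow> as w' \<subseteq> as w"
    and bs_antimono: "0 \<le> w \<Longrightarrow> w \<le> w' \<Longrightarrow> bs w' \<subseteq> bs w"
    and as_zero: "as 0 = carrier A" and bs_zero: "bs 0 = carrier B"
    and u: "0 < u"
begin

definition binomial_sum :: "rat set \<Rightarrow> 'r set"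
  where "binomial_sum W = Idl (\<Union>w\<in>W. tensors (as w) (bs (u - w)))"

lemma binomial_gens_closed: "(\<Union>w\<in>W. tensors (as w) (bs (u - w))) \<subseteq> carrier R"
  using tensors_closed[OF A.ideal_closed(1)[OF as_ideal] B.ideal_closed(1)[OF bs_ideal]] by blast

lemma binomial_sum_ideal: "ideal (binomial_sum W) R"
  unfolding binomial_sum_def by (rule R.genideal_ideal[OF binomial_gens_closed])

lemma binomial_sum_mem: "w \<in> W \<Longrightarrow> tensors (as w) (bs (u - w)) \<subseteq> binomial_sum W"
  using R.genideal_self[OF binomial_gens_closed] unfolding binomial_sum_def by blast

lemma binomial_sum_least:
  assumes "ideal T R" "\<And>w. w \<in> W \<Longrightarrow> tensors (as w) (bs (u - w)) \<subseteq> T"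
  shows "binomial_sum W \<subseteq> T"
  unfolding binomial_sum_def by (rule R.genideal_minimal) (use assms in auto)

text \<open>A maximal element among the finite partial sums is the whole sum, because adding one more weight
  cannot enlarge it.\<close>

lemma binomial_sum_finite:
  assumes "noetherian_ring R"
  obtains W where "finite W" "{0, u} \<subseteq> W" "W \<subseteq> {w. 0 \<le> w \<and> w \<le> u}"
    "binomial_sum W = binomial_sum {w. 0 \<le> w \<and> w \<le> u}"
proof -
  interpret NR: noetherian_cring R
    using assms R.cring_axioms by (simp add: noetherian_cring_def)
  let ?I = "{w. 0 \<le> w \<and> w \<le> u}"
  define F where "F = {binomial_sum W | W. finite W \<and> {0, u} \<subseteq> W \<and> W \<subseteq> ?I}"
  have "binomial_sum {0, u} \<in> F" using u by (auto simp: F_def)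
  then have "F \<noteq> {}" by blast
  moreover have "ideal L R" if "L \<in> F" for L using that binomial_sum_ideal by (auto simp: F_def)
  ultimately obtain M where M: "M \<in> F" "\<And>L. L \<in> F \<Longrightarrow> M \<subseteq> L \<Longrightarrow> L = M"
    using NR.maximal_ideal_in_family[of F] by metis
  obtain W where W: "M = binomial_sum W" "finite W" "{0, u} \<subseteq> W" "W \<subseteq> ?I"
    using M(1) by (auto simp: F_def)
  have "tensors (as w) (bs (u - w)) \<subseteq> binomial_sum W" if w: "w \<in> ?I" for w
  proof -
    have "binomial_sum (insert w W) \<in> F" using w W(2-4) by (auto simp: F_def)
    moreover have "M \<subseteq> binomial_sum (insert w W)"
      unfolding W(1) by (rule binomial_sum_least[OF binomial_sum_ideal binomial_sum_mem]) simp
    ultimately have "binomial_sum (insert w W) = M" by (rule M(2))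
    then show ?thesis using binomial_sum_mem[of w "insert w W"] W(1) by simp
  qed
  then have "binomial_sum ?I \<subseteq> binomial_sum W" by (rule binomial_sum_least[OF binomial_sum_ideal])
  moreover have "binomial_sum W \<subseteq> binomial_sum ?I"
    by (rule binomial_sum_least[OF binomial_sum_ideal binomial_sum_mem]) (use W(4) in blast)
  ultimately show ?thesis using that W by blast
qed

text \<open>Let \<open>G\<close> annihilate \<open>x\<close> modulo the sum \<open>T\<close>, taken over a finite set of weights. Going up through the
  weights, \<open>x\<close> is moved modulo \<open>T\<close> into \<open>as w \<otimes> B\<close>, starting with \<open>as 0 = A\<close>. If \<open>v\<close> precedes \<open>w\<close>, every term
  of \<open>T\<close> has weight at most \<open>v\<close> or at least \<open>w\<close>, so \<open>T\<close> is contained in \<open>as w \<otimes> B + A \<otimes> bs (u - v)\<close>. Regularity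
  modulo that ideal puts \<open>x\<close> there, and being in \<open>as v \<otimes> B\<close> as well, \<open>x\<close> lies in
  \<open>as w \<otimes> B + as v \<otimes> bs (u - v)\<close> by \<open>span_by_slices\<close>; the second term is part of \<open>T\<close>. At the last weight
  \<open>as u \<otimes> B = as u \<otimes> bs 0\<close> is contained in \<open>T\<close>.\<close>

lemma regular_modulo_binomial_sum:
  assumes noeth: "noetherian_ring R" and G: "G \<subseteq> carrier R"
    and reg: "\<And>w w'. 0 \<le> w \<Longrightarrow> 0 \<le> w' \<Longrightarrow> regular_modulo R G (sum_ideal (as w) (bs w'))"
  shows "regular_modulo R G (binomial_sum {w. 0 \<le> w \<and> w \<le> u})"
proof -
  obtain W where W: "finite W" "{0, u} \<subseteq> W" "W \<subseteq> {w. 0 \<le> w \<and> w \<le> u}"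
    and W_eq: "binomial_sum W = binomial_sum {w. 0 \<le> w \<and> w \<le> u}"
    by (rule binomial_sum_finite[OF noeth])
  let ?T = "binomial_sum W"
  note T = binomial_sum_ideal[of W]
  note Tcl = R.ideal_closed[OF T]
  have asA: "as w \<subseteq> carrier A" and bsB: "bs w \<subseteq> carrier B" for w
    using A.ideal_closed(1)[OF as_ideal] B.ideal_closed(1)[OF bs_ideal] by auto
  have rkc: "tensors (as w) (carrier B) \<subseteq> carrier R" for w by (rule tensors_closed[OF asA subset_refl])
  have "regular_modulo R G ?T"
    unfolding regular_modulo_def
  proof (intro ballI impI)
    fix x assume x: "x \<in> carrier R" "\<forall>g\<in>G. g \<otimes> x \<in> ?T"
    have "\<exists>y\<in>additive_span R (tensors (as w) (carrier B)). \<exists>t\<in>?T. x = y \<oplus> t" if "w \<in> W" for w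
      using that
    proof (induction "card {v \<in> W. v < w}" arbitrary: w rule: less_induct)
      case less
      have w0: "0 \<le> w" "w \<le> u" using less.prems W(3) by auto
      show ?case
      proof (cases "w = 0")
        case True
        then show ?thesis
          using spanned x(1) Tcl(2) as_zero by (intro bexI[of _ x] bexI[of _ \<zero>]) auto
      next
        case False
        define V where "V = {v \<in> W. v < w}"
        define v where "v = Max V"
        have V: "finite V" "V \<noteq> {}" using W(1,2) w0 False by (auto simp: V_def)
        have "v \<in> V" unfolding v_def by (rule Max_in[OF V])
        then have v: "v \<in> W" "v < w" "0 \<le> v" "v \<le> u" using W(3) by (auto simp: V_def)
        have between: "v' \<le> v" if "v' \<in> W" "v' < w" for v'
          unfolding v_def using that V(1) by (intro Max_ge) (auto simp: V_def)
        have "{v' \<in> W. v' < v} \<subset> {v' \<in> W. v' < w}" using v by auto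
        then have "card {v' \<in> W. v' < v} < card {v' \<in> W. v' < w}"
          using W(1) by (intro psubset_card_mono) auto
        from less.hyps[OF this v(1)] obtain y t where
          y: "y \<in> additive_span R (tensors (as v) (carrier B))" "t \<in> ?T" "x = y \<oplus> t" by blast
        have car: "y \<in> carrier R" "t \<in> carrier R"
          using y R.additive_span_closed[OF rkc] Tcl(1) by auto
        have T_le: "?T \<subseteq> sum_ideal (as w) (bs (u - v))"
        proof (rule binomial_sum_least[OF sum_ideal_ideal[OF as_ideal bs_ideal]], rule subsetI)
          fix v' z assume v': "v' \<in> W" and "z \<in> tensors (as v') (bs (u - v'))"
          then obtain m n where z: "z = inl m \<otimes> inr n" "m \<in> as v'" "n \<in> bs (u - v')"
            by (auto simp: elementary_tensors_def)
          show "z \<in> sum_ideal (as w) (bs (u - v))"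
            unfolding z(1)
          proof (rule sum_ideal_mem[OF as_ideal bs_ideal])
            show "m \<in> as w \<or> n \<in> bs (u - v)"
            proof (cases "v' < w")
              case True
              then have "bs (u - v') \<subseteq> bs (u - v)"
                using between[OF v'] v(4) by (intro bs_antimono) auto
              then show ?thesis using z(3) by blast
            next
              case False
              then show ?thesis using as_antimono[of w v'] w0 z(2) by auto
            qed
          qed (use z asA bsB in auto)
        qed
        have "g \<otimes> y \<in> ?T" if g: "g \<in> G" for g
        proof -
          have gR: "g \<in> carrier R" using g G by blast
          have "g \<otimes> x \<ominus> g \<otimes> t \<in> ?T" using x(2) g gR y(2) Tcl(4,7) by blast
          moreover have "g \<otimes> x \<ominus> g \<otimes> t = g \<otimes> y" unfolding y(3) using gR car by algebra
          ultimately show ?thesis by simp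
        qed
        then have "y \<in> sum_ideal (as w) (bs (u - v))"
          using regular_moduloD[OF reg[of w "u - v"] car(1)] w0 v(4) T_le by auto
        then have "\<sigma> y \<in> as w" if "\<sigma> \<in> right_slices (bs (u - v))" for \<sigma>
          using that sum_ideal_iff_slices[OF as_ideal bs_ideal car(1)] by blast
        then have "y \<in> additive_span R (tensors (as w \<inter> as v) (carrier B) \<union> tensors (as v) (bs (u - v)))"
          using span_by_slices[OF as_ideal as_ideal ideal_submodule[OF bs_ideal] y(1)] by blast
        moreover have "as w \<inter> as v = as w" using as_antimono[of v w] v by auto
        ultimately have "y \<in> additive_span R (tensors (as w) (carrier B) \<union> tensors (as v) (bs (u - v)))" by simp
        then obtain y' t' where y': "y = y' \<oplus> t'" "y' \<in> additive_span R (tensors (as w) (carrier B))" "t' \<in> ?T"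
          by (rule R.additive_span_split[OF rkc T binomial_sum_mem[OF v(1)]])
        have "y' \<in> carrier R" "t' \<in> carrier R" using y' R.additive_span_closed[OF rkc] Tcl(1) by auto
        then have "x = y' \<oplus> (t' \<oplus> t)" unfolding y(3) y'(1) using car(2) by (simp add: R.a_assoc)
        then show ?thesis using y'(2) Tcl(3)[OF y'(3) y(2)] by blast
      qed
    qed
    from this[of u] obtain y t where y: "y \<in> additive_span R (tensors (as u) (carrier B))" "t \<in> ?T" "x = y \<oplus> t"
      using W(2) by auto
    have "tensors (as u) (carrier B) \<subseteq> ?T" using binomial_sum_mem[of u W] W(2) bs_zero by simp
    then have "additive_span R (tensors (as u) (carrier B)) \<subseteq> ?T"
      by (intro additive_span_least) (use Tcl in auto)
    then show "x \<in> ?T" using y Tcl(3) by blast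
  qed
  then show ?thesis by (simp add: W_eq)
qed

end

section \<open>The tensor product has enough slices\<close>

text \<open>By Zorn's lemma there is a subspace \<open>D\<close> containing \<open>W\<close> that is maximal among those without \<open>n\<close>.
  Then \<open>M\<close> is the direct sum of \<open>D\<close> and the line of \<open>n\<close>, and the coordinate along that line is the
  functional.\<close>

lemma linear_functional_separating:
  assumes K: "field K" and M: "module K M" and W: "submodule W K M" and n: "n \<in> carrier M - W"
  obtains \<phi> where "\<And>b. b \<in> carrier M \<Longrightarrow> \<phi> b \<in> carrier K"
    "\<And>b b'. b \<in> carrier M \<Longrightarrow> b' \<in> carrier M \<Longrightarrow> \<phi> (b \<oplus>\<^bsub>M\<^esub> b') = \<phi> b \<oplus>\<^bsub>K\<^esub> \<phi> b'"
    "\<And>k b. k \<in> carrier K \<Longrightarrow> b \<in> carrier M \<Longrightarrow> \<phi> (k \<odot>\<^bsub>M\<^esub> b) = k \<otimes>\<^bsub>K\<^esub> \<phi> b"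
    "\<And>w. w \<in> W \<Longrightarrow> \<phi> w = \<zero>\<^bsub>K\<^esub>" "\<phi> n = \<one>\<^bsub>K\<^esub>"
proof -
  interpret K: field K by fact
  interpret M: module K M by fact
  have nM: "n \<in> carrier M" using n by blast
  define F where "F = {D. submodule D K M \<and> W \<subseteq> D \<and> n \<notin> D}"
  have "\<exists>D\<in>F. \<forall>E\<in>F. D \<subseteq> E \<longrightarrow> E = D"
  proof (rule subset_Zorn)
    fix C assume C: "subset.chain F C"
    show "\<exists>U\<in>F. \<forall>E\<in>C. E \<subseteq> U"
    proof (cases "C = {}")
      case True
      then show ?thesis using W n by (auto simp: F_def)
    next
      case False
      have CF: "\<And>E. E \<in> C \<Longrightarrow> submodule E K M \<and> W \<subseteq> E \<and> n \<notin> E"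
        using C by (auto simp: pred_on.chain_def F_def)
      have "submodule (\<Union>C) K M"
      proof (rule M.submoduleI)
        show "\<Union>C \<subseteq> carrier M" using CF M.submoduleE(1) by blast
        show "\<zero>\<^bsub>M\<^esub> \<in> \<Union>C"
          using False CF subgroup.one_closed[OF submodule.axioms(1)] by fastforce
        show "\<ominus>\<^bsub>M\<^esub> a \<in> \<Union>C" if "a \<in> \<Union>C" for a using that CF M.submoduleE(3) by blast
        show "k \<odot>\<^bsub>M\<^esub> a \<in> \<Union>C" if "k \<in> carrier K" "a \<in> \<Union>C" for k a
          using that CF M.submoduleE(4) by blast
        fix a b assume "a \<in> \<Union>C" "b \<in> \<Union>C"
        then obtain E E' where E: "a \<in> E" "E \<in> C" "b \<in> E'" "E' \<in> C" by blast
        then have "E \<subseteq> E' \<or> E' \<subseteq> E" using C by (auto simp: pred_on.chain_def)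
        then obtain E'' where "E'' \<in> C" "a \<in> E''" "b \<in> E''" using E by blast
        then show "a \<oplus>\<^bsub>M\<^esub> b \<in> \<Union>C" using M.submoduleE(5) CF by blast
      qed
      then have "\<Union>C \<in> F" using CF False by (auto simp: F_def)
      then show ?thesis by blast
    qed
  qed
  then obtain D where DF: "D \<in> F" and maxF: "\<And>E. E \<in> F \<Longrightarrow> D \<subseteq> E \<Longrightarrow> E = D" by metis
  have D: "submodule D K M" "W \<subseteq> D" "n \<notin> D" using DF by (auto simp: F_def)
  have max: "E = D" if "submodule E K M" "D \<subseteq> E" "n \<notin> E" for E
    using maxF[of E] that D(2) by (auto simp: F_def)
  note Dcl = M.submoduleE[OF D(1)]
  have DM: "w \<in> carrier M" if "w \<in> D" for w using that Dcl(1) by blast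
  have zD: "\<zero>\<^bsub>M\<^esub> \<in> D" using subgroup.one_closed[OF submodule.axioms(1)[OF D(1)]] by simp
  have mult_n: "k = \<zero>\<^bsub>K\<^esub>" if k: "k \<in> carrier K" "k \<odot>\<^bsub>M\<^esub> n \<in> D" for k
  proof (rule ccontr)
    assume "k \<noteq> \<zero>\<^bsub>K\<^esub>"
    then have u: "k \<in> Units K" using k(1) K.field_Units by blast
    have "inv\<^bsub>K\<^esub> k \<odot>\<^bsub>M\<^esub> (k \<odot>\<^bsub>M\<^esub> n) \<in> D" using Dcl(4) k u by blast
    moreover have "inv\<^bsub>K\<^esub> k \<odot>\<^bsub>M\<^esub> (k \<odot>\<^bsub>M\<^esub> n) = n"
      using k(1) u nM M.smult_assoc1[of "inv\<^bsub>K\<^esub> k" k n] by simp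
    ultimately show False using D(3) by simp
  qed
  have ex: "\<exists>k\<in>carrier K. \<exists>w\<in>D. b = w \<oplus>\<^bsub>M\<^esub> k \<odot>\<^bsub>M\<^esub> n" if b: "b \<in> carrier M" for b
  proof (cases "b \<in> D")
    case True
    then show ?thesis using nM b by (intro bexI[of _ "\<zero>\<^bsub>K\<^esub>"] bexI[of _ b]) auto
  next
    case False
    let ?E = "{w \<oplus>\<^bsub>M\<^esub> k \<odot>\<^bsub>M\<^esub> b | w k. w \<in> D \<and> k \<in> carrier K}"
    have E: "submodule ?E K M" by (rule M.submodule_adjoin[OF D(1) b])
    have "D \<subseteq> ?E"
    proof
      fix w assume "w \<in> D"
      then show "w \<in> ?E" using b DM by (intro CollectI exI[of _ w] exI[of _ "\<zero>\<^bsub>K\<^esub>"]) auto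
    qed
    moreover have "b \<in> ?E"
      using b zD by (intro CollectI exI[of _ "\<zero>\<^bsub>M\<^esub>"] exI[of _ "\<one>\<^bsub>K\<^esub>"]) auto
    ultimately have "n \<in> ?E" using max[OF E] False by blast
    then obtain w k where w: "n = w \<oplus>\<^bsub>M\<^esub> k \<odot>\<^bsub>M\<^esub> b" "w \<in> D" "k \<in> carrier K" by blast
    have "k \<noteq> \<zero>\<^bsub>K\<^esub>" using w b DM D(3) by auto
    then have u: "k \<in> Units K" using w(3) K.field_Units by blast
    then have ik: "inv\<^bsub>K\<^esub> k \<in> carrier K" by simp
    have "inv\<^bsub>K\<^esub> k \<odot>\<^bsub>M\<^esub> n = inv\<^bsub>K\<^esub> k \<odot>\<^bsub>M\<^esub> w \<oplus>\<^bsub>M\<^esub> inv\<^bsub>K\<^esub> k \<odot>\<^bsub>M\<^esub> (k \<odot>\<^bsub>M\<^esub> b)"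
      unfolding w(1) using ik w b DM by (simp add: M.smult_r_distr)
    also have "inv\<^bsub>K\<^esub> k \<odot>\<^bsub>M\<^esub> (k \<odot>\<^bsub>M\<^esub> b) = b"
      using w(3) u b M.smult_assoc1[of "inv\<^bsub>K\<^esub> k" k b] by simp
    finally have "b = \<ominus>\<^bsub>M\<^esub> (inv\<^bsub>K\<^esub> k \<odot>\<^bsub>M\<^esub> w) \<oplus>\<^bsub>M\<^esub> inv\<^bsub>K\<^esub> k \<odot>\<^bsub>M\<^esub> n"
      using ik w b DM by (simp add: M.M.r_neg1)
    moreover have "\<ominus>\<^bsub>M\<^esub> (inv\<^bsub>K\<^esub> k \<odot>\<^bsub>M\<^esub> w) \<in> D" using Dcl(3,4) ik w(2) by blast
    ultimately show ?thesis using ik by blast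
  qed
  define \<phi> where "\<phi> b = (SOME k. k \<in> carrier K \<and> (\<exists>w\<in>D. b = w \<oplus>\<^bsub>M\<^esub> k \<odot>\<^bsub>M\<^esub> n))" for b
  have \<phi>: "\<phi> b \<in> carrier K \<and> (\<exists>w\<in>D. b = w \<oplus>\<^bsub>M\<^esub> \<phi> b \<odot>\<^bsub>M\<^esub> n)" if "b \<in> carrier M" for b
    unfolding \<phi>_def by (rule someI_ex) (use ex[OF that] in blast)
  have uniq: "\<phi> b = k" if b: "b = w \<oplus>\<^bsub>M\<^esub> k \<odot>\<^bsub>M\<^esub> n" "w \<in> D" "k \<in> carrier K" for b w k
  proof -
    have "b \<in> carrier M" using b DM nM by simp
    then obtain w' where w': "w' \<in> D" "b = w' \<oplus>\<^bsub>M\<^esub> \<phi> b \<odot>\<^bsub>M\<^esub> n" and pk: "\<phi> b \<in> carrier K"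
      using \<phi> by blast
    have c: "w \<in> carrier M" "w' \<in> carrier M" using b w' DM by auto
    define p where "p = \<phi> b"
    have p: "p \<in> carrier K" "w \<oplus>\<^bsub>M\<^esub> k \<odot>\<^bsub>M\<^esub> n = w' \<oplus>\<^bsub>M\<^esub> p \<odot>\<^bsub>M\<^esub> n"
      using w'(2) b(1) pk by (auto simp: p_def)
    have "(p \<ominus>\<^bsub>K\<^esub> k) \<odot>\<^bsub>M\<^esub> n = p \<odot>\<^bsub>M\<^esub> n \<oplus>\<^bsub>M\<^esub> \<ominus>\<^bsub>M\<^esub> (k \<odot>\<^bsub>M\<^esub> n)"
      using p(1) b(3) nM by (simp add: a_minus_def M.smult_l_distr M.smult_l_minus)
    also have "\<dots> = \<ominus>\<^bsub>M\<^esub> w' \<oplus>\<^bsub>M\<^esub> (w' \<oplus>\<^bsub>M\<^esub> p \<odot>\<^bsub>M\<^esub> n) \<oplus>\<^bsub>M\<^esub> \<ominus>\<^bsub>M\<^esub> (k \<odot>\<^bsub>M\<^esub> n)"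
      using c p(1) nM by (simp add: M.M.r_neg1)
    also have "\<dots> = \<ominus>\<^bsub>M\<^esub> w' \<oplus>\<^bsub>M\<^esub> w"
      unfolding p(2)[symmetric] using c b(3) nM by (simp add: M.a_assoc M.M.r_neg)
    finally have "(p \<ominus>\<^bsub>K\<^esub> k) \<odot>\<^bsub>M\<^esub> n \<in> D" using Dcl(3,5) b(2) w'(1) by simp
    then have "p \<ominus>\<^bsub>K\<^esub> k = \<zero>\<^bsub>K\<^esub>" using mult_n[of "p \<ominus>\<^bsub>K\<^esub> k"] p(1) b(3) by simp
    then show ?thesis unfolding p_def[symmetric] using p(1) b(3) K.r_right_minus_eq by blast
  qed
  show ?thesis
  proof (rule that)
    show "\<phi> b \<in> carrier K" if "b \<in> carrier M" for b using \<phi>[OF that] by blast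
    fix b assume b: "b \<in> carrier M"
    obtain w where w: "w \<in> D" "b = w \<oplus>\<^bsub>M\<^esub> \<phi> b \<odot>\<^bsub>M\<^esub> n" and pk: "\<phi> b \<in> carrier K"
      using \<phi>[OF b] by blast
    define p where "p = \<phi> b"
    have wp: "b = w \<oplus>\<^bsub>M\<^esub> p \<odot>\<^bsub>M\<^esub> n" "p \<in> carrier K" "w \<in> carrier M" using w pk DM by (auto simp: p_def)
    show "\<phi> (b \<oplus>\<^bsub>M\<^esub> b') = \<phi> b \<oplus>\<^bsub>K\<^esub> \<phi> b'" if b': "b' \<in> carrier M" for b'
    proof -
      obtain w' where w': "w' \<in> D" "b' = w' \<oplus>\<^bsub>M\<^esub> \<phi> b' \<odot>\<^bsub>M\<^esub> n" and pk': "\<phi> b' \<in> carrier K"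
        using \<phi>[OF b'] by blast
      define p' where "p' = \<phi> b'"
      have wp': "b' = w' \<oplus>\<^bsub>M\<^esub> p' \<odot>\<^bsub>M\<^esub> n" "p' \<in> carrier K" "w' \<in> carrier M"
        using w' pk' DM by (auto simp: p'_def)
      have "b \<oplus>\<^bsub>M\<^esub> b' = (w \<oplus>\<^bsub>M\<^esub> w') \<oplus>\<^bsub>M\<^esub> (p \<oplus>\<^bsub>K\<^esub> p') \<odot>\<^bsub>M\<^esub> n"
        unfolding wp(1) wp'(1) using wp(2,3) wp'(2,3) nM by (simp add: M.smult_l_distr M.M.a_ac)
      then show ?thesis
        unfolding p_def[symmetric] p'_def[symmetric]
        using uniq[of _ "w \<oplus>\<^bsub>M\<^esub> w'" "p \<oplus>\<^bsub>K\<^esub> p'"] Dcl(5) w(1) w'(1) wp(2) wp'(2) by simp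
    qed
    show "\<phi> (k \<odot>\<^bsub>M\<^esub> b) = k \<otimes>\<^bsub>K\<^esub> \<phi> b" if k: "k \<in> carrier K" for k
    proof -
      have "k \<odot>\<^bsub>M\<^esub> b = k \<odot>\<^bsub>M\<^esub> w \<oplus>\<^bsub>M\<^esub> (k \<otimes>\<^bsub>K\<^esub> p) \<odot>\<^bsub>M\<^esub> n"
        unfolding wp(1) using wp(2,3) k nM by (simp add: M.smult_r_distr M.smult_assoc1)
      then show ?thesis
        unfolding p_def[symmetric] using uniq[of _ "k \<odot>\<^bsub>M\<^esub> w" "k \<otimes>\<^bsub>K\<^esub> p"] Dcl(4) w(1) wp(2) k by simp
    qed
  next
    show "\<phi> w = \<zero>\<^bsub>K\<^esub>" if "w \<in> W" for w
      using that D(2) DM nM by (intro uniq[of _ w]) auto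
    show "\<phi> n = \<one>\<^bsub>K\<^esub>" using zD nM by (intro uniq[of _ "\<zero>\<^bsub>M\<^esub>"]) auto
  qed
qed

text \<open>A balanced biadditive map extends to the free abelian group on pairs, and the extension kills the
  relators.\<close>

lemma tensor_ring_universal:
  assumes alg: "algebra K A" "algebra K B" and C: "abelian_group C"
    and \<beta>: "\<And>a b. a \<in> carrier A \<Longrightarrow> b \<in> carrier B \<Longrightarrow> \<beta> a b \<in> carrier C"
    and add_left: "\<And>a a' b. a \<in> carrier A \<Longrightarrow> a' \<in> carrier A \<Longrightarrow> b \<in> carrier B
      \<Longrightarrow> \<beta> (a \<oplus>\<^bsub>A\<^esub> a') b = \<beta> a b \<oplus>\<^bsub>C\<^esub> \<beta> a' b"
    and add_right: "\<And>a b b'. a \<in> carrier A \<Longrightarrow> b \<in> carrier B \<Longrightarrow> b' \<in> carrier B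
      \<Longrightarrow> \<beta> a (b \<oplus>\<^bsub>B\<^esub> b') = \<beta> a b \<oplus>\<^bsub>C\<^esub> \<beta> a b'"
    and scalar: "\<And>k a b. k \<in> carrier K \<Longrightarrow> a \<in> carrier A \<Longrightarrow> b \<in> carrier B
      \<Longrightarrow> \<beta> (k \<odot>\<^bsub>A\<^esub> a) b = \<beta> a (k \<odot>\<^bsub>B\<^esub> b)"
  obtains h where "\<And>x. x \<in> carrier (tensor_ring K A B) \<Longrightarrow> h x \<in> carrier C"
    "\<And>x y. x \<in> carrier (tensor_ring K A B) \<Longrightarrow> y \<in> carrier (tensor_ring K A B)
      \<Longrightarrow> h (x \<oplus>\<^bsub>tensor_ring K A B\<^esub> y) = h x \<oplus>\<^bsub>C\<^esub> h y"
    "\<And>a b. a \<in> carrier A \<Longrightarrow> b \<in> carrier B \<Longrightarrow> h (pure_tensor K A B a b) = \<beta> a b"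
proof -
  interpret C: abelian_group C by fact
  interpret KA: algebra K A by fact
  interpret KB: algebra K B by fact
  let ?P = "pre_tensor_ring A B" and ?N = "tensor_kernel K A B" and ?S = "carrier A \<times> carrier B"
  interpret N: ideal ?N ?P by (rule tensor_kernel_ideal[OF alg])
  have plus: "x \<oplus>\<^bsub>?P\<^esub> y = x + y" and zero: "\<zero>\<^bsub>?P\<^esub> = 0" for x y by (simp_all add: pre_tensor_ring_def)
  have carP: "c \<in> carrier ?P \<longleftrightarrow> Poly_Mapping.keys c \<subseteq> ?S" for c by (simp add: pre_tensor_ring_def)
  have ofP: "frag_of (a, b) \<in> carrier ?P" if "a \<in> carrier A" "b \<in> carrier B" for a b
    using that by (simp add: carP)
  obtain h0 where h0: "h0 \<in> hom (free_Abelian_group ?S) (add_monoid C)"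
    "\<And>x. x \<in> ?S \<Longrightarrow> h0 (frag_of x) = (\<lambda>(a, b). \<beta> a b) x"
  proof (rule comm_group.free_Abelian_group_universal[OF C.a_comm_group])
    show "(\<lambda>(a, b). \<beta> a b) ` ?S \<subseteq> carrier (add_monoid C)" using \<beta> by auto
  qed blast
  have h0c: "h0 c \<in> carrier C" if "c \<in> carrier ?P" for c
    using h0(1) that carP by (auto simp: hom_def Pi_iff)
  have h0add: "h0 (c + d) = h0 c \<oplus>\<^bsub>C\<^esub> h0 d" if "c \<in> carrier ?P" "d \<in> carrier ?P" for c d
    using h0(1) that carP by (auto simp: hom_def)
  have h0of: "h0 (frag_of (a, b)) = \<beta> a b" if "a \<in> carrier A" "b \<in> carrier B" for a b
    using h0(2)[of "(a, b)"] that by simp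
  have diffP: "c - d \<in> carrier ?P" if "c \<in> carrier ?P" "d \<in> carrier ?P" for c d
    using that keys_diff_subset[of c ?S d] carP by blast
  have h0zero: "h0 0 = \<zero>\<^bsub>C\<^esub>"
  proof -
    have "0 \<in> carrier ?P" by (simp add: carP)
    then have "h0 0 \<in> carrier C" "h0 0 = h0 0 \<oplus>\<^bsub>C\<^esub> h0 0" using h0c h0add[of 0 0] by auto
    then show ?thesis using C.add.r_cancel_one'[of "h0 0" "h0 0"] by simp
  qed
  have h0diff: "h0 (c - d) = \<zero>\<^bsub>C\<^esub> \<longleftrightarrow> h0 c = h0 d" if "c \<in> carrier ?P" "d \<in> carrier ?P" for c d
  proof -
    have "h0 c = h0 (c - d) \<oplus>\<^bsub>C\<^esub> h0 d" using h0add[OF diffP[OF that] that(2)] by simp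
    moreover have "h0 (c - d) \<oplus>\<^bsub>C\<^esub> h0 d = h0 d \<longleftrightarrow> h0 (c - d) = \<zero>\<^bsub>C\<^esub>"
      using C.add.r_cancel_one[of "h0 d" "h0 (c - d)"] h0c[OF that(2)] h0c[OF diffP[OF that]] by simp
    ultimately show ?thesis by simp
  qed
  have "subgroup {c \<in> carrier ?P. h0 c = \<zero>\<^bsub>C\<^esub>} (add_monoid ?P)"
  proof (rule group.subgroupI[OF N.a_group])
    show "{c \<in> carrier ?P. h0 c = \<zero>\<^bsub>C\<^esub>} \<noteq> {}" using h0zero carP by (auto intro!: exI[of _ 0])
    fix a assume a: "a \<in> {c \<in> carrier ?P. h0 c = \<zero>\<^bsub>C\<^esub>}"
    have "0 \<in> carrier ?P" by (simp add: carP)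
    then have m: "- a \<in> carrier ?P" "h0 (- a) = \<zero>\<^bsub>C\<^esub>" using a diffP[of 0 a] h0diff[of 0 a] h0zero by auto
    have "inv\<^bsub>add_monoid ?P\<^esub> a = - a"
      using a m N.minus_equality[of "- a" a] unfolding a_inv_def by (simp add: plus zero)
    then show "inv\<^bsub>add_monoid ?P\<^esub> a \<in> {c \<in> carrier ?P. h0 c = \<zero>\<^bsub>C\<^esub>}" using m by simp
    fix b assume "b \<in> {c \<in> carrier ?P. h0 c = \<zero>\<^bsub>C\<^esub>}"
    then show "a \<otimes>\<^bsub>add_monoid ?P\<^esub> b \<in> {c \<in> carrier ?P. h0 c = \<zero>\<^bsub>C\<^esub>}"
      using a h0add N.a_closed[of a b] by (auto simp: plus)
  qed auto
  moreover have "tensor_relators K A B \<subseteq> {c \<in> carrier ?P. h0 c = \<zero>\<^bsub>C\<^esub>}"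
  proof
    fix c assume "c \<in> tensor_relators K A B"
    then consider (left) a a' b where "c = frag_of (a \<oplus>\<^bsub>A\<^esub> a', b) - frag_of (a, b) - frag_of (a', b)"
        "a \<in> carrier A" "a' \<in> carrier A" "b \<in> carrier B"
      | (right) a b b' where "c = frag_of (a, b \<oplus>\<^bsub>B\<^esub> b') - frag_of (a, b) - frag_of (a, b')"
        "a \<in> carrier A" "b \<in> carrier B" "b' \<in> carrier B"
      | (scalar) k a b where "c = frag_of (k \<odot>\<^bsub>A\<^esub> a, b) - frag_of (a, k \<odot>\<^bsub>B\<^esub> b)"
        "k \<in> carrier K" "a \<in> carrier A" "b \<in> carrier B"
      unfolding tensor_relators_def by blast
    then show "c \<in> {c \<in> carrier ?P. h0 c = \<zero>\<^bsub>C\<^esub>}"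
    proof cases
      case left
      have *: "frag_of (a \<oplus>\<^bsub>A\<^esub> a', b) \<in> carrier ?P" "frag_of (a, b) + frag_of (a', b) \<in> carrier ?P"
        using left ofP N.a_closed[of "frag_of (a, b)" "frag_of (a', b)"] by (auto simp: plus)
      have "h0 (frag_of (a \<oplus>\<^bsub>A\<^esub> a', b)) = h0 (frag_of (a, b) + frag_of (a', b))"
        using left ofP by (simp add: h0add h0of add_left)
      then show ?thesis using h0diff[OF *] diffP[OF *] left(1) by (simp add: diff_diff_eq)
    next
      case right
      have *: "frag_of (a, b \<oplus>\<^bsub>B\<^esub> b') \<in> carrier ?P" "frag_of (a, b) + frag_of (a, b') \<in> carrier ?P"
        using right ofP N.a_closed[of "frag_of (a, b)" "frag_of (a, b')"] by (auto simp: plus)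
      have "h0 (frag_of (a, b \<oplus>\<^bsub>B\<^esub> b')) = h0 (frag_of (a, b) + frag_of (a, b'))"
        using right ofP by (simp add: h0add h0of add_right)
      then show ?thesis using h0diff[OF *] diffP[OF *] right(1) by (simp add: diff_diff_eq)
    next
      case scalar
      have *: "frag_of (k \<odot>\<^bsub>A\<^esub> a, b) \<in> carrier ?P" "frag_of (a, k \<odot>\<^bsub>B\<^esub> b) \<in> carrier ?P"
        using scalar ofP by auto
      have "h0 (frag_of (k \<odot>\<^bsub>A\<^esub> a, b)) = h0 (frag_of (a, k \<odot>\<^bsub>B\<^esub> b))"
        using scalar by (simp add: h0of assms(7))
      then show ?thesis using h0diff[OF *] diffP[OF *] scalar(1) by simp
    qed
  qed
  ultimately have kernel: "?N \<subseteq> {c \<in> carrier ?P. h0 c = \<zero>\<^bsub>C\<^esub>}"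
    unfolding tensor_kernel_def by (intro group.generate_subgroup_incl[OF N.a_group])
  define h where "h Y = h0 (SOME c. c \<in> Y)" for Y
  have hcoset: "h (?N +>\<^bsub>?P\<^esub> c) = h0 c" if c: "c \<in> carrier ?P" for c
  proof -
    define d where "d = (SOME d. d \<in> ?N +>\<^bsub>?P\<^esub> c)"
    have "d \<in> ?N +>\<^bsub>?P\<^esub> c" unfolding d_def by (rule someI) (rule N.a_rcos_self[OF c])
    then obtain e where e: "e \<in> ?N" "d = e + c" by (auto simp: a_r_coset_def' plus)
    have "e \<in> carrier ?P" "h0 e = \<zero>\<^bsub>C\<^esub>" using e(1) kernel by auto
    then show ?thesis unfolding h_def d_def[symmetric] e(2) using c h0add h0c by simp
  qed
  have car: "carrier (tensor_ring K A B) = {?N +>\<^bsub>?P\<^esub> c | c. c \<in> carrier ?P}"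
    by (auto simp: tensor_ring_def FactRing_def A_RCOSETS_def')
  have addT: "(?N +>\<^bsub>?P\<^esub> c) \<oplus>\<^bsub>tensor_ring K A B\<^esub> (?N +>\<^bsub>?P\<^esub> d) = ?N +>\<^bsub>?P\<^esub> (c + d)"
    if "c \<in> carrier ?P" "d \<in> carrier ?P" for c d
    using N.a_rcos_sum[OF that] by (simp add: tensor_ring_def FactRing_def plus)
  show ?thesis
  proof (rule that)
    show "h x \<in> carrier C" if "x \<in> carrier (tensor_ring K A B)" for x
      using that hcoset h0c by (auto simp: car)
    show "h (x \<oplus>\<^bsub>tensor_ring K A B\<^esub> y) = h x \<oplus>\<^bsub>C\<^esub> h y"
      if xy: "x \<in> carrier (tensor_ring K A B)" "y \<in> carrier (tensor_ring K A B)" for x y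
    proof -
      obtain c d where cd: "x = ?N +>\<^bsub>?P\<^esub> c" "y = ?N +>\<^bsub>?P\<^esub> d" "c \<in> carrier ?P" "d \<in> carrier ?P"
        using xy by (auto simp: car)
      have "c + d \<in> carrier ?P" using N.a_closed[OF cd(3,4)] by (simp add: plus)
      then show ?thesis unfolding cd(1,2) addT[OF cd(3,4)] using cd(3,4) by (simp add: hcoset h0add)
    qed
    show "h (pure_tensor K A B a b) = \<beta> a b" if "a \<in> carrier A" "b \<in> carrier B" for a b
      unfolding pure_tensor_def using hcoset[OF ofP[OF that]] h0of[OF that] by simp
  qed
qed

text \<open>The additive map \<open>h\<close> is the one induced by \<open>(a, b) \<mapsto> \<phi> b a\<close>, that is \<open>id \<otimes> \<phi>\<close>; its \<open>A\<close>-linearity is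
  checked on generators. The lemma is stated for two arbitrary factors to serve both sides.\<close>

lemma slice_of_functional:
  assumes "algebra K A" "cring B" "cring R" and hom: "f \<in> ring_hom A R" "g \<in> ring_hom B R"
    and spanned: "carrier R \<subseteq> additive_span R (elementary_tensors R f g (carrier A) (carrier B))"
    and \<phi>: "\<And>b. b \<in> carrier B \<Longrightarrow> \<phi> b \<in> carrier K"
    and W: "W \<subseteq> carrier B" "\<And>w. w \<in> W \<Longrightarrow> \<phi> w = \<zero>\<^bsub>K\<^esub>" and n: "n \<in> carrier B" "\<phi> n = \<one>\<^bsub>K\<^esub>"
    and h: "\<And>x. x \<in> carrier R \<Longrightarrow> h x \<in> carrier A"
      "\<And>x y. x \<in> carrier R \<Longrightarrow> y \<in> carrier R \<Longrightarrow> h (x \<oplus>\<^bsub>R\<^esub> y) = h x \<oplus>\<^bsub>A\<^esub> h y"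
      "\<And>a b. a \<in> carrier A \<Longrightarrow> b \<in> carrier B \<Longrightarrow> h (f a \<otimes>\<^bsub>R\<^esub> g b) = \<phi> b \<odot>\<^bsub>A\<^esub> a"
  shows "\<exists>\<sigma>\<in>slices A R f g W. \<sigma> (g n) = \<one>\<^bsub>A\<^esub>"
proof (intro bexI[of _ h])
  interpret A: cring A using assms(1) by (simp add: algebra_def)
  interpret B: cring B by fact
  interpret KA: algebra K A by fact
  interpret R: cring R by fact
  interpret f: ring_hom_cring A R f by unfold_locales (rule hom(1))
  interpret g: ring_hom_cring B R g by unfold_locales (rule hom(2))
  have hg: "h (g b) = \<phi> b \<odot>\<^bsub>A\<^esub> \<one>\<^bsub>A\<^esub>" if "b \<in> carrier B" for b
    using h(3)[OF A.one_closed that] that by simp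
  then show "h (g n) = \<one>\<^bsub>A\<^esub>" using n by simp
  let ?S = "elementary_tensors R f g (carrier A) (carrier B)"
  have S: "?S \<subseteq> carrier R" by (auto simp: elementary_tensors_def)
  have h0: "h \<zero>\<^bsub>R\<^esub> = \<zero>\<^bsub>A\<^esub>"
    using h(3)[of "\<zero>\<^bsub>A\<^esub>" "\<zero>\<^bsub>B\<^esub>"] \<phi>[of "\<zero>\<^bsub>B\<^esub>"] by simp
  have "h (f a \<otimes>\<^bsub>R\<^esub> x) = a \<otimes>\<^bsub>A\<^esub> h x" if a: "a \<in> carrier A" and x: "x \<in> carrier R" for a x
  proof -
    have "x \<in> additive_span R ?S" using spanned x by blast
    then show ?thesis
    proof induction
      case zero
      then show ?case using a h0 by simp
    next
      case (add s x)
      obtain m b where s: "s = f m \<otimes>\<^bsub>R\<^esub> g b" "m \<in> carrier A" "b \<in> carrier B"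
        using add.hyps(1) by (auto simp: elementary_tensors_def)
      have car: "s \<in> carrier R" "x \<in> carrier R" using add.hyps S R.additive_span_closed[OF S] by auto
      have "f a \<otimes>\<^bsub>R\<^esub> s = f (a \<otimes>\<^bsub>A\<^esub> m) \<otimes>\<^bsub>R\<^esub> g b" using s a by (simp add: R.m_assoc)
      then have "h (f a \<otimes>\<^bsub>R\<^esub> s) = \<phi> b \<odot>\<^bsub>A\<^esub> (a \<otimes>\<^bsub>A\<^esub> m)"
        using h(3)[of "a \<otimes>\<^bsub>A\<^esub> m" b] a s by simp
      also have "\<dots> = a \<otimes>\<^bsub>A\<^esub> (\<phi> b \<odot>\<^bsub>A\<^esub> m)"
        using a s \<phi> KA.smult_assoc2[of "\<phi> b" m a] by (simp add: A.m_comm)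
      also have "\<dots> = a \<otimes>\<^bsub>A\<^esub> h s" using h(3) s by simp
      finally show ?case using add.IH a car h(1,2) by (simp add: R.r_distr A.r_distr)
    qed
  qed
  moreover have "h (g w) = \<zero>\<^bsub>A\<^esub>" if "w \<in> W" for w using that W hg by auto
  ultimately show "h \<in> slices A R f g W" using h(1,2) by (auto simp: slices_def)
qed

lemma tensor_ring_frame:
  assumes K: "field K" and alg: "algebra K A" "algebra K B"
  shows "tensor_frame K A B (tensor_ring K A B) (tensor_inl K A B) (tensor_inr K A B)"
proof -
  interpret A: cring A using alg(1) by (simp add: algebra_def)
  interpret B: cring B using alg(2) by (simp add: algebra_def)
  interpret KA: algebra K A by fact
  interpret KB: algebra K B by fact
  let ?R = "tensor_ring K A B" and ?l = "tensor_inl K A B" and ?r = "tensor_inr K A B"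
  interpret R: cring ?R by (rule tensor_ring_cring[OF alg])
  note hom = tensor_in_hom[OF alg]
  interpret l: ring_hom_cring A ?R ?l by unfold_locales (rule hom(1))
  interpret r: ring_hom_cring B ?R ?r by unfold_locales (rule hom(2))
  let ?P = "pre_tensor_ring A B" and ?N = "tensor_kernel K A B"
  interpret N: ideal ?N ?P by (rule tensor_kernel_ideal[OF alg])
  have pure: "?l a \<otimes>\<^bsub>?R\<^esub> ?r b = pure_tensor K A B a b" if "a \<in> carrier A" "b \<in> carrier B" for a b
    using pure_tensor_mult[OF alg that(1) A.one_closed B.one_closed that(2)] that
    by (simp add: tensor_inl_def tensor_inr_def)
  let ?S = "elementary_tensors ?R ?l ?r (carrier A) (carrier B)"
  have S: "?S \<subseteq> carrier ?R" by (auto simp: elementary_tensors_def)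
  have negS: "\<ominus>\<^bsub>?R\<^esub> s \<in> ?S" if s: "s \<in> ?S" for s
  proof -
    obtain a b where ab: "s = ?l a \<otimes>\<^bsub>?R\<^esub> ?r b" "a \<in> carrier A" "b \<in> carrier B"
      using s by (auto simp: elementary_tensors_def)
    then have "\<ominus>\<^bsub>?R\<^esub> s = ?l (\<ominus>\<^bsub>A\<^esub> a) \<otimes>\<^bsub>?R\<^esub> ?r b" by (simp add: R.l_minus)
    then show ?thesis unfolding elementary_tensors_def using ab by blast
  qed
  have neg: "\<ominus>\<^bsub>?R\<^esub> x \<in> additive_span ?R ?S" if "x \<in> additive_span ?R ?S" for x
    using that
  proof induction
    case (add s x)
    then have "s \<in> carrier ?R" "x \<in> carrier ?R" using S R.additive_span_closed[OF S] by auto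
    then have "\<ominus>\<^bsub>?R\<^esub> (s \<oplus>\<^bsub>?R\<^esub> x) = \<ominus>\<^bsub>?R\<^esub> s \<oplus>\<^bsub>?R\<^esub> \<ominus>\<^bsub>?R\<^esub> x" by (rule R.minus_add)
    then show ?case using additive_span.add[OF negS[OF add.hyps(1)] add.IH] by simp
  qed (simp add: additive_span.zero)
  have "Poly_Mapping.keys c \<subseteq> carrier A \<times> carrier B \<and> ?N +>\<^bsub>?P\<^esub> c \<in> additive_span ?R ?S"
    if "Poly_Mapping.keys c \<subseteq> carrier A \<times> carrier B" for c
    using that
  proof (induction c rule: frag_induction)
    case zero
    have "?N +>\<^bsub>?P\<^esub> 0 = \<zero>\<^bsub>?R\<^esub>"
      using N.a_rcos_zero[OF N.is_ideal additive_subgroup.zero_closed[OF N.additive_subgroup_axioms]] by (simp add: tensor_ring_def FactRing_def pre_tensor_ring_def)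
    then show ?case by (simp add: additive_span.zero)
  next
    case (one x)
    obtain a b where x: "x = (a, b)" "a \<in> carrier A" "b \<in> carrier B" using one by auto
    then have "?N +>\<^bsub>?P\<^esub> frag_of x = ?l a \<otimes>\<^bsub>?R\<^esub> ?r b" using pure[OF x(2,3)] by (simp add: pure_tensor_def)
    then have "?N +>\<^bsub>?P\<^esub> frag_of x \<in> ?S" using x unfolding elementary_tensors_def by auto
    then show ?case using R.additive_span_superset[OF S] x by auto
  next
    case (diff c d)
    have keys: "Poly_Mapping.keys (c - d) \<subseteq> carrier A \<times> carrier B"
      using diff keys_diff_subset by blast
    have mem: "?N +>\<^bsub>?P\<^esub> e \<in> carrier ?R" if "Poly_Mapping.keys e \<subseteq> carrier A \<times> carrier B" for e
      using that by (auto simp: tensor_ring_def FactRing_def A_RCOSETS_def' pre_tensor_ring_def)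
    have "(?N +>\<^bsub>?P\<^esub> (c - d)) \<oplus>\<^bsub>?R\<^esub> (?N +>\<^bsub>?P\<^esub> d) = ?N +>\<^bsub>?P\<^esub> c"
      using N.a_rcos_sum[of "c - d" d] keys diff by (simp add: tensor_ring_def FactRing_def pre_tensor_ring_def)
    then have "(?N +>\<^bsub>?P\<^esub> c) \<oplus>\<^bsub>?R\<^esub> \<ominus>\<^bsub>?R\<^esub> (?N +>\<^bsub>?P\<^esub> d) = ?N +>\<^bsub>?P\<^esub> (c - d)"
      using mem[OF keys] mem[of d] diff by (metis R.a_assoc R.a_inv_closed R.r_neg R.r_zero)
    then show ?case using R.additive_span_add[OF S _ neg, of "?N +>\<^bsub>?P\<^esub> c" "?N +>\<^bsub>?P\<^esub> d"] diff keys by auto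
  qed
  then have spanned: "carrier ?R \<subseteq> additive_span ?R ?S"
    by (auto simp: tensor_ring_def FactRing_def A_RCOSETS_def' pre_tensor_ring_def)
  show ?thesis
  proof (rule tensor_frame.intro)
    show "?l (k \<odot>\<^bsub>A\<^esub> \<one>\<^bsub>A\<^esub>) = ?r (k \<odot>\<^bsub>B\<^esub> \<one>\<^bsub>B\<^esub>)" if "k \<in> carrier K" for k
      using pure_tensor_balanced(3)[OF alg A.one_closed A.one_closed B.one_closed B.one_closed that]
      by (simp add: tensor_inl_def tensor_inr_def)
    show "\<exists>\<sigma>\<in>slices A ?R ?l ?r W. \<sigma> (?r n) = \<one>\<^bsub>A\<^esub>" if W: "submodule W K B" and n: "n \<in> carrier B - W" for W n
    proof -
      obtain \<phi> where \<phi>: "\<And>b. b \<in> carrier B \<Longrightarrow> \<phi> b \<in> carrier K"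
        "\<And>b b'. b \<in> carrier B \<Longrightarrow> b' \<in> carrier B \<Longrightarrow> \<phi> (b \<oplus>\<^bsub>B\<^esub> b') = \<phi> b \<oplus>\<^bsub>K\<^esub> \<phi> b'"
        "\<And>k b. k \<in> carrier K \<Longrightarrow> b \<in> carrier B \<Longrightarrow> \<phi> (k \<odot>\<^bsub>B\<^esub> b) = k \<otimes>\<^bsub>K\<^esub> \<phi> b"
        "\<And>w. w \<in> W \<Longrightarrow> \<phi> w = \<zero>\<^bsub>K\<^esub>" "\<phi> n = \<one>\<^bsub>K\<^esub>"
        by (rule linear_functional_separating[OF K KB.module W n]) (erule that)
      obtain h where h: "\<And>x. x \<in> carrier ?R \<Longrightarrow> h x \<in> carrier A"
        "\<And>x y. x \<in> carrier ?R \<Longrightarrow> y \<in> carrier ?R \<Longrightarrow> h (x \<oplus>\<^bsub>?R\<^esub> y) = h x \<oplus>\<^bsub>A\<^esub> h y"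
        "\<And>a b. a \<in> carrier A \<Longrightarrow> b \<in> carrier B \<Longrightarrow> h (pure_tensor K A B a b) = \<phi> b \<odot>\<^bsub>A\<^esub> a"
      proof (rule tensor_ring_universal[OF alg A.abelian_group_axioms, of "\<lambda>a b. \<phi> b \<odot>\<^bsub>A\<^esub> a"])
        show "\<phi> b \<odot>\<^bsub>A\<^esub> (k \<odot>\<^bsub>A\<^esub> a) = \<phi> (k \<odot>\<^bsub>B\<^esub> b) \<odot>\<^bsub>A\<^esub> a"
          if "k \<in> carrier K" "a \<in> carrier A" "b \<in> carrier B" for k a b
          using that \<phi>(1,3) KA.smult_assoc1[of "\<phi> b" k a] KA.R.m_comm[of k "\<phi> b"] by simp
      qed (use \<phi>(1,2) in \<open>auto simp: KA.smult_r_distr KA.smult_l_distr\<close>)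
      show ?thesis
        by (rule slice_of_functional[OF alg(1) B.cring_axioms R.cring_axioms hom spanned, where \<phi> = \<phi> and h = h])
          (use \<phi> h n KB.submoduleE(1)[OF W] pure in auto)
    qed
    show "\<exists>\<sigma>\<in>slices B ?R ?r ?l V. \<sigma> (?l m) = \<one>\<^bsub>B\<^esub>" if V: "submodule V K A" and m: "m \<in> carrier A - V" for V m
    proof -
      obtain \<phi> where \<phi>: "\<And>a. a \<in> carrier A \<Longrightarrow> \<phi> a \<in> carrier K"
        "\<And>a a'. a \<in> carrier A \<Longrightarrow> a' \<in> carrier A \<Longrightarrow> \<phi> (a \<oplus>\<^bsub>A\<^esub> a') = \<phi> a \<oplus>\<^bsub>K\<^esub> \<phi> a'"
        "\<And>k a. k \<in> carrier K \<Longrightarrow> a \<in> carrier A \<Longrightarrow> \<phi> (k \<odot>\<^bsub>A\<^esub> a) = k \<otimes>\<^bsub>K\<^esub> \<phi> a"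
        "\<And>v. v \<in> V \<Longrightarrow> \<phi> v = \<zero>\<^bsub>K\<^esub>" "\<phi> m = \<one>\<^bsub>K\<^esub>"
        by (rule linear_functional_separating[OF K KA.module V m]) (erule that)
      obtain h where h: "\<And>x. x \<in> carrier ?R \<Longrightarrow> h x \<in> carrier B"
        "\<And>x y. x \<in> carrier ?R \<Longrightarrow> y \<in> carrier ?R \<Longrightarrow> h (x \<oplus>\<^bsub>?R\<^esub> y) = h x \<oplus>\<^bsub>B\<^esub> h y"
        "\<And>a b. a \<in> carrier A \<Longrightarrow> b \<in> carrier B \<Longrightarrow> h (pure_tensor K A B a b) = \<phi> a \<odot>\<^bsub>B\<^esub> b"
      proof (rule tensor_ring_universal[OF alg B.abelian_group_axioms, of "\<lambda>a b. \<phi> a \<odot>\<^bsub>B\<^esub> b"])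
        show "\<phi> (k \<odot>\<^bsub>A\<^esub> a) \<odot>\<^bsub>B\<^esub> b = \<phi> a \<odot>\<^bsub>B\<^esub> (k \<odot>\<^bsub>B\<^esub> b)"
          if "k \<in> carrier K" "a \<in> carrier A" "b \<in> carrier B" for k a b
          using that \<phi>(1,3) KB.smult_assoc1[of "\<phi> a" k b] KA.R.m_comm[of k "\<phi> a"] by simp
      qed (use \<phi>(1,2) in \<open>auto simp: KB.smult_r_distr KB.smult_l_distr\<close>)
      have comm: "?r b \<otimes>\<^bsub>?R\<^esub> ?l a = ?l a \<otimes>\<^bsub>?R\<^esub> ?r b" if "a \<in> carrier A" "b \<in> carrier B" for a b
        using that by (intro R.m_comm) auto
      have "?S \<subseteq> elementary_tensors ?R ?r ?l (carrier B) (carrier A)"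
      proof
        fix s assume "s \<in> ?S"
        then obtain a b where ab: "s = ?l a \<otimes>\<^bsub>?R\<^esub> ?r b" "a \<in> carrier A" "b \<in> carrier B"
          by (auto simp: elementary_tensors_def)
        then show "s \<in> elementary_tensors ?R ?r ?l (carrier B) (carrier A)"
          unfolding elementary_tensors_def using comm[OF ab(2,3)] by (intro CollectI exI[of _ b] exI[of _ a]) simp
      qed
      then have spanned': "carrier ?R \<subseteq> additive_span ?R (elementary_tensors ?R ?r ?l (carrier B) (carrier A))"
        using spanned additive_span_mono by blast
      show ?thesis
        by (rule slice_of_functional[OF alg(2) A.cring_axioms R.cring_axioms hom(2,1) spanned', where \<phi> = \<phi> and h = h])
          (use \<phi> h m KA.submoduleE(1)[OF V] pure comm in auto)
    qed
  qed (fact alg R.cring_axioms hom spanned)+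
qed

section \<open>The binomial formula for symbolic powers\<close>

lemma (in cring) genideal_mult_mem:
  assumes S: "S \<subseteq> carrier R" "S' \<subseteq> carrier R" and T: "ideal T R"
    and gens: "\<And>s s'. s \<in> S \<Longrightarrow> s' \<in> S' \<Longrightarrow> s \<otimes> s' \<in> T"
    and r: "r \<in> Idl S" "r' \<in> Idl S'"
  shows "r \<otimes> r' \<in> T"
proof -
  note Tcl = ideal_closed[OF T]
  have "Idl S \<subseteq> {r \<in> carrier R. \<forall>s'\<in>S'. r \<otimes> s' \<in> T}"
  proof (rule genideal_minimal[OF ideal_by_closure])
    fix x y assume xy: "x \<in> {r \<in> carrier R. \<forall>s'\<in>S'. r \<otimes> s' \<in> T}" "y \<in> {r \<in> carrier R. \<forall>s'\<in>S'. r \<otimes> s' \<in> T}"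
    then show "x \<oplus> y \<in> {r \<in> carrier R. \<forall>s'\<in>S'. r \<otimes> s' \<in> T}"
      using S(2) Tcl(3) by (auto simp: l_distr subset_iff)
  next
    fix c x assume "c \<in> carrier R" "x \<in> {r \<in> carrier R. \<forall>s'\<in>S'. r \<otimes> s' \<in> T}"
    then show "c \<otimes> x \<in> {r \<in> carrier R. \<forall>s'\<in>S'. r \<otimes> s' \<in> T}"
      using S(2) Tcl(4) by (auto simp: m_assoc subset_iff)
  qed (use S gens Tcl in \<open>auto simp: subset_iff\<close>)
  then have r1: "r \<in> carrier R" "\<forall>s'\<in>S'. r \<otimes> s' \<in> T" using r(1) by auto
  have "Idl S' \<subseteq> ideal_colon R T r"
    by (rule genideal_minimal[OF ideal_colon_ideal[OF T r1(1)]])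
      (use r1 S(2) in \<open>auto simp: ideal_colon_def m_comm subset_iff\<close>)
  then have "r' \<in> carrier R" "r' \<otimes> r \<in> T" using r(2) by (auto simp: ideal_colon_def)
  then show ?thesis using r1(1) by (simp add: m_comm)
qed

lemma (in ring_hom_cring) hom_genideal_mem:
  assumes "Y \<subseteq> carrier R" "f \<in> Idl\<^bsub>R\<^esub> Y"
  shows "h f \<in> Idl\<^bsub>S\<^esub> (h ` Y)"
proof -
  have Y: "h ` Y \<subseteq> carrier S" using assms(1) by auto
  have "Idl\<^bsub>R\<^esub> Y \<subseteq> {r \<in> carrier R. h r \<in> Idl\<^bsub>S\<^esub> (h ` Y)}"
    by (rule R.genideal_minimal[OF R.ideal_hom_preimage[OF S.cring_axioms homh S.genideal_ideal[OF Y]]])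
      (use assms(1) S.genideal_self[OF Y] in auto)
  then show ?thesis using assms(2) by blast
qed

context tensor_frame
begin

lemma tensors_mono: "U \<subseteq> U' \<Longrightarrow> V \<subseteq> V' \<Longrightarrow> tensors U V \<subseteq> tensors U' V'"
  by (auto simp: elementary_tensors_def)

lemma ideal_ext_sum_eq:
  assumes I: "ideal I A" and J: "ideal J B"
  shows "ideal_ext R inl I <+> ideal_ext R inr J = sum_ideal I J"
proof
  note Icl = A.ideal_closed[OF I] and Jcl = B.ideal_closed[OF J]
  note S = sum_ideal_ideal[OF I J]
  have im: "inl ` I \<subseteq> carrier R" "inr ` J \<subseteq> carrier R" using Icl(1) Jcl(1) by auto
  note L = R.genideal_ideal[OF im(1)] R.genideal_ideal[OF im(2)]
  note cl = R.ideal_closed[OF L(1)] R.ideal_closed[OF L(2)]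
  have "ideal_ext R inl I \<subseteq> sum_ideal I J"
    unfolding ideal_ext_def
  proof (rule R.genideal_minimal[OF S], rule subsetI)
    fix x assume "x \<in> inl ` I"
    then obtain m where "m \<in> I" "x = inl m" by blast
    then show "x \<in> sum_ideal I J"
      using sum_ideal_mem[OF I J, of m "\<one>\<^bsub>B\<^esub>"] Icl(1) by auto
  qed
  moreover have "ideal_ext R inr J \<subseteq> sum_ideal I J"
    unfolding ideal_ext_def
  proof (rule R.genideal_minimal[OF S], rule subsetI)
    fix x assume "x \<in> inr ` J"
    then obtain n where "n \<in> J" "x = inr n" by blast
    then show "x \<in> sum_ideal I J"
      using sum_ideal_mem[OF I J, of "\<one>\<^bsub>A\<^esub>" n] Jcl(1) by auto
  qed
  ultimately show "ideal_ext R inl I <+> ideal_ext R inr J \<subseteq> sum_ideal I J"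
    using R.ideal_closed(3)[OF S] by (auto simp: set_add_def')
  have sum: "ideal (ideal_ext R inl I <+> ideal_ext R inr J) R"
    unfolding ideal_ext_def by (rule R.add_ideals[OF L])
  show "sum_ideal I J \<subseteq> ideal_ext R inl I <+> ideal_ext R inr J"
    unfolding sum_ideal_def
  proof (rule additive_span_least)
    show "tensors I (carrier B) \<union> tensors (carrier A) J \<subseteq> ideal_ext R inl I <+> ideal_ext R inr J"
    proof
      fix x assume "x \<in> tensors I (carrier B) \<union> tensors (carrier A) J"
      then show "x \<in> ideal_ext R inl I <+> ideal_ext R inr J"
      proof
        assume "x \<in> tensors I (carrier B)"
        then obtain m n where x: "x = inl m \<otimes> inr n" "m \<in> I" "n \<in> carrier B" by (auto simp: elementary_tensors_def)
        have "inl m \<in> Idl (inl ` I)" using R.genideal_self[OF im(1)] x(2) by blast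
        then have "x \<in> Idl (inl ` I)" unfolding x(1) using cl(5) x(3) by simp
        moreover from this have "x = x \<oplus> \<zero>" using cl(1) by auto
        ultimately show ?thesis using cl(9) unfolding set_add_def' ideal_ext_def by blast
      next
        assume "x \<in> tensors (carrier A) J"
        then obtain m n where x: "x = inl m \<otimes> inr n" "m \<in> carrier A" "n \<in> J" by (auto simp: elementary_tensors_def)
        have "inr n \<in> Idl (inr ` J)" using R.genideal_self[OF im(2)] x(3) by blast
        then have "x \<in> Idl (inr ` J)" unfolding x(1) using cl(11) x(2) by simp
        moreover from this have "x = \<zero> \<oplus> x" using cl(8) by auto
        ultimately show ?thesis using cl(2) unfolding set_add_def' ideal_ext_def by blast
      qed
    qed
  qed (use R.ideal_closed[OF sum] in auto)
qed

lemma ideal_family_sum_ext_eq: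
  assumes "\<And>w. w \<in> W \<Longrightarrow> F w \<subseteq> carrier A" "\<And>w. w \<in> W \<Longrightarrow> H w \<subseteq> carrier B"
  shows "ideal_family_sum R (\<lambda>w. ideal_ext R inl (F w) \<cdot> ideal_ext R inr (H w)) W
    = Idl (\<Union>w\<in>W. tensors (F w) (H w))"
proof -
  let ?P = "\<Union>w\<in>W. ideal_ext R inl (F w) \<cdot> ideal_ext R inr (H w)" and ?Q = "\<Union>w\<in>W. tensors (F w) (H w)"
  have im: "inl ` F w \<subseteq> carrier R" "inr ` H w \<subseteq> carrier R" if "w \<in> W" for w
    using assms[OF that] by auto
  have Q: "?Q \<subseteq> carrier R" using tensors_closed[OF assms] by blast
  have P: "?P \<subseteq> carrier R"
    unfolding ideal_ext_def
    by (intro UN_least R.ideal_prod_in_carrier R.genideal_ideal im)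
  note idQ = R.genideal_ideal[OF Q]
  have "?P \<subseteq> Idl ?Q"
  proof
    fix x assume "x \<in> ?P"
    then obtain w where w: "w \<in> W" "x \<in> ideal_ext R inl (F w) \<cdot> ideal_ext R inr (H w)" by blast
    have prod: "r \<otimes> r' \<in> Idl ?Q" if "r \<in> ideal_ext R inl (F w)" "r' \<in> ideal_ext R inr (H w)" for r r'
    proof (rule R.genideal_mult_mem[OF im[OF w(1)] idQ _ that[unfolded ideal_ext_def]])
      fix s s' assume "s \<in> inl ` F w" "s' \<in> inr ` H w"
      then show "s \<otimes> s' \<in> Idl ?Q" using R.genideal_self[OF Q] w(1) tensors_mem by blast
    qed
    show "x \<in> Idl ?Q"
      using w(2) by (induction rule: ideal_prod.induct) (use prod R.ideal_closed(3)[OF idQ] in auto)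
  qed
  moreover have "?Q \<subseteq> ?P"
  proof
    fix x assume "x \<in> ?Q"
    then obtain w m n where w: "w \<in> W" and x: "x = inl m \<otimes> inr n" "m \<in> F w" "n \<in> H w"
      by (auto simp: elementary_tensors_def)
    have "inl m \<in> ideal_ext R inl (F w)" "inr n \<in> ideal_ext R inr (H w)"
      using R.genideal_self[OF im(1)[OF w]] R.genideal_self[OF im(2)[OF w]] x(2,3)
      unfolding ideal_ext_def by auto
    then show "x \<in> ?P" using w unfolding x(1) by (blast intro: ideal_prod.prod)
  qed
  ultimately show ?thesis
    unfolding ideal_family_sum_def
    using R.genideal_minimal[OF idQ] R.subset_Idl_subset[OF P] by blast
qed

lemma tensors_genideal_subset:
  assumes "F \<subseteq> carrier A" "H \<subseteq> carrier B" "ideal T R" "tensors F H \<subseteq> T"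
    and "f \<in> Idl\<^bsub>A\<^esub> F" "h \<in> Idl\<^bsub>B\<^esub> H"
  shows "inl f \<otimes> inr h \<in> T"
proof (rule R.genideal_mult_mem[OF _ _ assms(3) _ l.hom_genideal_mem[OF assms(1,5)] r.hom_genideal_mem[OF assms(2,6)]])
  show "inl ` F \<subseteq> carrier R" "inr ` H \<subseteq> carrier R" using assms(1,2) by auto
  fix s s' assume "s \<in> inl ` F" "s' \<in> inr ` H"
  then show "s \<otimes> s' \<in> T" using assms(4) tensors_mem by blast
qed

text \<open>At an associated prime \<open>P\<close> of \<open>R/(I + J)\<close>, choose associated primes \<open>p\<close> and \<open>q\<close> containing its
  contractions. Multipliers \<open>s \<notin> p\<close> and \<open>t \<notin> q\<close> for the two factors lie outside \<open>P\<close>, hence so does their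
  product because \<open>P\<close> is prime, and it is a multiplier for the product of the factors.\<close>

lemma symbolic_product_subset:
  assumes noeth: "noetherian_ring A" "noetherian_ring B" and I: "ideal I A" and J: "ideal J B"
    and sub: "tensors (rational_power A I w) (rational_power B J v) \<subseteq> rational_power R (sum_ideal I J) u"
  shows "tensors (rational_symbolic_power A I w) (rational_symbolic_power B J v)
    \<subseteq> rational_symbolic_power R (sum_ideal I J) u"
proof
  interpret swap: tensor_frame K B A R inr inl by (rule swapped)
  let ?L = "sum_ideal I J"
  note L = sum_ideal_ideal[OF I J]
  note E = R.genideal_ideal[OF R.rational_power_subset[of ?L u]]
  fix x assume "x \<in> tensors (rational_symbolic_power A I w) (rational_symbolic_power B J v)"
  then obtain f h where x: "x = inl f \<otimes> inr h"
    and f: "f \<in> rational_symbolic_power A I w" and h: "h \<in> rational_symbolic_power B J v"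
    by (auto simp: elementary_tensors_def)
  have fA: "f \<in> carrier A" and hB: "h \<in> carrier B"
    using f h by (auto simp: A.rational_symbolic_power_eq[OF I] B.rational_symbolic_power_eq[OF J])
  show "x \<in> rational_symbolic_power R ?L u"
    unfolding R.rational_symbolic_power_eq[OF L]
  proof (intro CollectI conjI ballI)
    show "x \<in> carrier R" using x fA hB by simp
    fix P assume P: "P \<in> associated_primes R (quot_module R ?L)"
    then have prime: "primeideal P R" by (simp add: associated_primes_def)
    obtain p where p: "p \<in> associated_primes A (quot_module A I)" "{s \<in> carrier A. inl s \<in> P} \<subseteq> p"
      by (rule associated_prime_contraction[OF noeth(1) I J P])
    have "P \<in> associated_primes R (quot_module R (swap.sum_ideal J I))"
      using P sum_ideal_swap[OF A.ideal_closed(1)[OF I] B.ideal_closed(1)[OF J]] by simp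
    then obtain q where q: "q \<in> associated_primes B (quot_module B J)" "{s \<in> carrier B. inr s \<in> P} \<subseteq> q"
      by (rule swap.associated_prime_contraction[OF noeth(2) J I])
    obtain s where s: "s \<in> carrier A - p" "s \<otimes>\<^bsub>A\<^esub> f \<in> Idl\<^bsub>A\<^esub> (rational_power A I w)"
      using f p(1) by (auto simp: A.rational_symbolic_power_eq[OF I] prime_saturation_def)
    obtain t where t: "t \<in> carrier B - q" "t \<otimes>\<^bsub>B\<^esub> h \<in> Idl\<^bsub>B\<^esub> (rational_power B J v)"
      using h q(1) by (auto simp: B.rational_symbolic_power_eq[OF J] prime_saturation_def)
    have st: "s \<in> carrier A" "t \<in> carrier B" using s t by auto
    have "inl s \<in> carrier R - P" "inr t \<in> carrier R - P" using s t p(2) q(2) by auto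
    then have "inl s \<otimes> inr t \<in> carrier R - P" by (rule R.prime_complement_mult[OF prime])
    moreover have "inl (s \<otimes>\<^bsub>A\<^esub> f) \<otimes> inr (t \<otimes>\<^bsub>B\<^esub> h) \<in> Idl (rational_power R ?L u)"
      by (rule tensors_genideal_subset[OF A.rational_power_subset B.rational_power_subset E _ s(2) t(2)])
        (use sub R.genideal_self[OF R.rational_power_subset[of ?L u]] in blast)
    moreover have "inl (s \<otimes>\<^bsub>A\<^esub> f) \<otimes> inr (t \<otimes>\<^bsub>B\<^esub> h) = (inl s \<otimes> inr t) \<otimes> x"
      using st fA hB by (simp add: x R.m_ac)
    ultimately show "x \<in> prime_saturation R P (Idl (rational_power R ?L u))"
      using x fA hB unfolding prime_saturation_def by auto
  qed
qed

lemma symbolic_binomial_filtration: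
  assumes "ideal I A" "ideal J B" "0 < u"
  shows "binomial_filtration K A B R inl inr (rational_symbolic_power A I) (rational_symbolic_power B J) u"
proof (rule binomial_filtration.intro[OF tensor_frame_axioms binomial_filtration_axioms.intro])
  show "rational_symbolic_power A I 0 = carrier A" "rational_symbolic_power B J 0 = carrier B"
    by (simp_all add: rational_symbolic_power_def)
qed (use assms in \<open>simp_all add: A.rational_symbolic_power_ideal B.rational_symbolic_power_ideal
    A.rational_symbolic_power_antimono B.rational_symbolic_power_antimono\<close>)

text \<open>For \<open>x\<close> in the symbolic power, the ideal \<open>G = T : x\<close> lies in no associated prime of \<open>R/(I + J)\<close>, so it is
  regular modulo \<open>I + J\<close>. Regularity passes to \<open>T\<close>, and \<open>G x \<subseteq> T\<close> then says \<open>x \<in> T\<close>.\<close>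

lemma symbolic_power_subset_binomial_sum:
  assumes noeth: "noetherian_ring A" "noetherian_ring B" "noetherian_ring R"
    and I: "ideal I A" and J: "ideal J B" and u: "0 < u"
    and sub: "rational_power R (sum_ideal I J) u
      \<subseteq> Idl (\<Union>w\<in>{w. 0 \<le> w \<and> w \<le> u}. tensors (rational_symbolic_power A I w) (rational_symbolic_power B J (u - w)))"
      (is "_ \<subseteq> ?T")
  shows "rational_symbolic_power R (sum_ideal I J) u \<subseteq> ?T"
proof
  interpret bin: binomial_filtration K A B R inl inr "rational_symbolic_power A I" "rational_symbolic_power B J" u
    by (rule symbolic_binomial_filtration[OF I J u])
  interpret NR: noetherian_cring R
    using noeth(3) R.cring_axioms by (simp add: noetherian_cring_def)
  let ?W = "{w. 0 \<le> w \<and> w \<le> u}"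
  have T: "?T = bin.binomial_sum ?W" by (simp add: bin.binomial_sum_def)
  have Tid: "ideal ?T R" unfolding T by (rule bin.binomial_sum_ideal)
  fix x assume x: "x \<in> rational_symbolic_power R (sum_ideal I J) u"
  note L = sum_ideal_ideal[OF I J]
  have xR: "x \<in> carrier R" using x by (simp add: R.rational_symbolic_power_eq[OF L])
  define G where "G = ideal_colon R ?T x"
  have G: "G \<subseteq> carrier R" by (auto simp: G_def ideal_colon_def)
  have "Idl (rational_power R (sum_ideal I J) u) \<subseteq> ?T" by (rule R.genideal_minimal[OF Tid sub])
  then have "\<not> G \<subseteq> P" if "P \<in> associated_primes R (quot_module R (sum_ideal I J))" for P
    using that x by (auto simp: R.rational_symbolic_power_eq[OF L] prime_saturation_def G_def ideal_colon_def)
  then have reg: "regular_modulo R G (sum_ideal I J)"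
    by (rule NR.regular_modulo_if_avoids_associated_primes[OF L G])
  have "regular_modulo R G (sum_ideal (rational_symbolic_power A I w) (rational_symbolic_power B J v))" for w v
    by (rule regular_modulo_locally_saturated[OF noeth(1,2) I J G reg bin.as_ideal _ bin.bs_ideal])
      (use A.rational_symbolic_power_saturated[OF I] B.rational_symbolic_power_saturated[OF J] in auto)
  then have "regular_modulo R G ?T"
    unfolding T by (intro bin.regular_modulo_binomial_sum[OF noeth(3) G])
  then show "x \<in> ?T"
    by (rule regular_moduloD[OF _ xR]) (simp add: G_def ideal_colon_def)
qed

end

theorem theorem3p15:
  fixes K :: "('k, 'l) ring_scheme"
    and A :: "('k, 'a, 'm) module_scheme"
    and B :: "('k, 'b, 'n) module_scheme"
    and R :: "('a \<times> 'b \<Rightarrow>\<^sub>0 int) set ring"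
    and extA :: "'a set \<Rightarrow> ('a \<times> 'b \<Rightarrow>\<^sub>0 int) set set"
    and extB :: "'b set \<Rightarrow> ('a \<times> 'b \<Rightarrow>\<^sub>0 int) set set"
    and I :: "'a set" and J :: "'b set" and u :: rat
  assumes "field K"
    and "algebra K A" and "noetherian_ring A"
    and "algebra K B" and "noetherian_ring B"
    and R: "R = tensor_ring K A B" and "noetherian_ring R"
    and extA: "extA = ideal_ext R (tensor_inl K A B)"
    and extB: "extB = ideal_ext R (tensor_inr K A B)"
    and "ideal I A" and "I \<noteq> {\<zero>\<^bsub>A\<^esub>}" and "I \<noteq> carrier A"
    and "ideal J B" and "J \<noteq> {\<zero>\<^bsub>B\<^esub>}" and "J \<noteq> carrier B"
    and "u > 0"
    and "rational_power R (extA I <+>\<^bsub>R\<^esub> extB J) u =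
      ideal_family_sum R
        (\<lambda>w. extA (rational_power A I w) \<cdot>\<^bsub>R\<^esub> extB (rational_power B J (u - w)))
        {w. 0 \<le> w \<and> w \<le> u}"
  shows "rational_symbolic_power R (extA I <+>\<^bsub>R\<^esub> extB J) u =
      ideal_family_sum R
        (\<lambda>w. extA (rational_symbolic_power A I w) \<cdot>\<^bsub>R\<^esub> extB (rational_symbolic_power B J (u - w)))
        {w. 0 \<le> w \<and> w \<le> u}"
proof -
  interpret tensor_frame K A B R "tensor_inl K A B" "tensor_inr K A B"
    unfolding R by (rule tensor_ring_frame) fact+
  note noeth = assms(3,5,7) and I = \<open>ideal I A\<close> and J = \<open>ideal J B\<close>
  let ?W = "{w. 0 \<le> w \<and> w \<le> u}"
  let ?T = "Idl\<^bsub>R\<^esub> (\<Union>w\<in>?W. tensors (rational_symbolic_power A I w) (rational_symbolic_power B J (u - w)))"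
  let ?E = "Idl\<^bsub>R\<^esub> (\<Union>w\<in>?W. tensors (rational_power A I w) (rational_power B J (u - w)))"
  have L: "extA I <+>\<^bsub>R\<^esub> extB J = sum_ideal I J"
    unfolding extA extB by (rule ideal_ext_sum_eq[OF I J])
  have symA: "rational_symbolic_power A I w \<subseteq> carrier A" for w
    using A.ideal_closed(1)[OF A.rational_symbolic_power_ideal[OF I]] .
  have symB: "rational_symbolic_power B J w \<subseteq> carrier B" for w
    using B.ideal_closed(1)[OF B.rational_symbolic_power_ideal[OF J]] .
  have "rational_power R (sum_ideal I J) u = ?E"
    using assms(17) unfolding L unfolding extA extB
    by (simp add: ideal_family_sum_ext_eq A.rational_power_subset B.rational_power_subset)
  moreover have "?E \<subseteq> ?T"
  proof (rule R.subset_Idl_subset)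
    show "(\<Union>w\<in>?W. tensors (rational_symbolic_power A I w) (rational_symbolic_power B J (u - w))) \<subseteq> carrier R"
      using tensors_closed[OF symA symB] by blast
  next
    show "(\<Union>w\<in>?W. tensors (rational_power A I w) (rational_power B J (u - w)))
        \<subseteq> (\<Union>w\<in>?W. tensors (rational_symbolic_power A I w) (rational_symbolic_power B J (u - w)))"
      by (intro UN_mono subset_refl tensors_mono A.rational_power_subset_symbolic[OF I] B.rational_power_subset_symbolic[OF J])
  qed
  ultimately have "rational_symbolic_power R (sum_ideal I J) u \<subseteq> ?T"
    by (intro symbolic_power_subset_binomial_sum[OF noeth I J \<open>u > 0\<close>]) simp
  moreover have "?T \<subseteq> rational_symbolic_power R (sum_ideal I J) u"
  proof (rule R.genideal_minimal[OF R.rational_symbolic_power_ideal[OF sum_ideal_ideal[OF I J]]], rule UN_least)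
    fix w assume w: "w \<in> ?W"
    have "(\<Union>w\<in>?W. tensors (rational_power A I w) (rational_power B J (u - w))) \<subseteq> carrier R"
      using tensors_closed[OF A.rational_power_subset B.rational_power_subset] by blast
    then have "tensors (rational_power A I w) (rational_power B J (u - w)) \<subseteq> ?E"
      using R.genideal_self w by blast
    then show "tensors (rational_symbolic_power A I w) (rational_symbolic_power B J (u - w))
        \<subseteq> rational_symbolic_power R (sum_ideal I J) u"
      using \<open>rational_power R (sum_ideal I J) u = ?E\<close>
      by (intro symbolic_product_subset[OF noeth(1,2) I J]) simp
  qed
  ultimately show ?thesis
    unfolding L unfolding extA extB by (simp add: ideal_family_sum_ext_eq symA symB)
qed

end
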